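(* The evaluation $\langle\cdot\rangle$ of closed seamed surfaces satisfies the following local relations, where $E_1=\alpha_1+\alpha_2$, $E_2=\alpha_1\alpha_2$, and surfaces in the same relation are identical outside the region described. (1) Neck-cutting. Suppose there is a PL-embedded $D^2\times[0,1]\subset\mathbb{R}^3$ whose intersection with the closed seamed surface $F$ is the tube $\partial D^2\times[0,1]$, carrying no seams and no dots. Let $G$ be obtained from $F$ by replacing the tube by the two disks $D^2\times\{0\}$ (bottom) and $D^2\times\{1\}$ (top), and let $G_b$, resp. $G_t$, be $G$ with one extra dot on the bottom, resp. top, disk. Then $\langle F\rangle=\langle G_t\rangle+\langle G_b\rangle-E_1\langle G\rangle$. (2) If instead the tube $\partial D^2\times[0,1]$ carries no dots and exactly one seam, $\partial D^2\times\{1/2\}$, co-oriented toward the top boundary $\partial D^2\times\{1\}$, then, with $G_b,G_t$ as in (1), $\langle F\rangle=\langle G_b\rangle-\langle G_t\rangle$. (3) For a seam of $F$, with $F'$ and $F''$ obtained from $F$ by adding one dot near a point of the seam on one side, resp. on the other side: $\langle F'\rangle+\langle F''\rangle=E_1\langle F\rangle$. (4) If $F'$ is obtained from $F$ by adding two dots near a point of a seam, one on each side of the seam: $\langle F'\rangle=E_2\langle F\rangle$. (5) If $F'$ and $F''$ are obtained from $F$ by adding one, resp. two, dots on the same facet: $\langle F''\rangle=E_1\langle F'\rangle-E_2\langle F\rangle$. (6) If $F_{\mathrm{in}}$, resp. $F_{\mathrm{out}}$, is obtained from $F$ by adding inside a facet a new seam bounding a dotless disk in that facet, co-oriented into, resp.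 out of, that disk: $\langle F_{\mathrm{in}}\rangle=-\langle F_{\mathrm{out}}\rangle=-\langle F\rangle$. (7) A 2-sphere with no seams evaluates to $0$ if it has no dots and to $1$ if it has exactly one dot.
   Context: A closed seamed surface is a closed compact surface $F$ PL-embedded in $\mathbb{R}^3$ (hence orientable), equipped with finitely many disjoint simple closed curves on $F$ (seams), each with a co-orientation (a preferred side in $F$), and with finitely many dots placed on $F$ away from the seams. Facets are the connected components of the complement of the seams in $F$ (or their closures). A checkerboard coloring $c$ of $F$ is a map from the set of facets to $\{1,2\}$ such that along every seam the two sides have different colors; $\mathrm{adm}(F)$ denotes the set of these. Given $c$, a seam is colored by the color of the facet into which its co-orientation points. Notation: $\theta(F)$ = number of seams of $F$; $\theta_1(c)$ = number of seams of color $1$; $d_i(c)$ = number of dots on facets of color $i$; $F_1(c)$ = union of the closed facets of color $1$; $\overline{F}_1(c)$ = the closed surface obtained from $F_1(c)$ by attaching a disk along each boundary circle, so $\chi(\overline{F}_1(c))=\chi(F_1(c))+\theta(F)$, which is even. The evaluation is $$\langle F,c\rangle=(-1)^{\theta_1(c)+\chi(\overline{F}_1(c))/2}\,\frac{\alpha_1^{d_1(c)}\alpha_2^{d_2(c)}}{(\alpha_2-\alpha_1)^{\chi(F)/2}}\in\mathbb{Z}[\alpha_1,\alpha_2,(\alpha_1-\alpha_2)^{-1}],\qquad \langle F\rangle=\sum_{c\in\mathrm{adm}(F)}\langle F,c\rangle .$$ The sum $\langle F\rangle$ lies in the ring $\mathbb{Z}[E_1,E_2]$ of symmetric polynomials in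 $\alpha_1,\alpha_2$.
   Formalization: A seam is colored by the facet its co-orientation points out of, not into: with the stated convention (2) and (6) hold only with opposite sign (sphere, one seam toward the dotted half: -1 instead of 1). The change multiplies the evaluation by (-1)^θ(F). *)

theory Defs
  imports "HOL-Analysis.Analysis" "HOL-Computational_Algebra.Polynomial_Factorial"
begin

section \<open>Piecewise linear topology\<close>

definition triangulates :: "'a::euclidean_space set set \<Rightarrow> 'a set \<Rightarrow> bool" where
  "triangulates K S \<longleftrightarrow> simplicial_complex K \<and> \<Union>K = S"

text \<open>Affine on every simplex of some finite triangulation of the compact set \<open>S\<close>;
  continuity is automatic, since the simplices are finitely many closed sets.\<close>

definition pl_on :: "'a::euclidean_space set \<Rightarrow> ('a \<Rightarrow> 'b::euclidean_space) \<Rightarrow> bool" where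
  "pl_on S f \<longleftrightarrow>
     (\<exists>K. triangulates K S \<and> (\<forall>\<sigma>\<in>K. \<exists>A b. linear A \<and> (\<forall>x\<in>\<sigma>. f x = A x + b)))"

definition pl_embedding :: "'a::euclidean_space set \<Rightarrow> ('a \<Rightarrow> 'b::euclidean_space) \<Rightarrow> bool" where
  "pl_embedding S f \<longleftrightarrow> pl_on S f \<and> inj_on f S"

definition pl_homeomorphic :: "'a::euclidean_space set \<Rightarrow> 'b::euclidean_space set \<Rightarrow> bool" where
  "pl_homeomorphic S T \<longleftrightarrow> (\<exists>f. pl_embedding S f \<and> f ` S = T)"

text \<open>The PL disk \<open>D\<^sup>2\<close> is the square, the PL 2-sphere the boundary of the cube.\<close>

abbreviation D2 :: "(real^2) set" where "D2 \<equiv> cbox (- 1) 1"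
abbreviation bdD2 :: "(real^2) set" where "bdD2 \<equiv> frontier D2"
abbreviation S2 :: "(real^3) set" where "S2 \<equiv> frontier (cbox (- 1) 1)"

text \<open>Closed surfaces need be neither connected nor nonempty.\<close>

definition closed_pl_surface :: "(real^3) set \<Rightarrow> bool" where
  "closed_pl_surface S \<longleftrightarrow>
     (\<exists>K. triangulates K S) \<and>
     (\<forall>x\<in>S. \<exists>f. pl_embedding D2 f \<and> f ` D2 \<subseteq> S \<and> x \<in> f ` interior D2 \<and>
        openin (top_of_set S) (f ` interior D2))"

text \<open>A library simplicial complex contains the empty face, which is not counted.\<close>

definition euler_char :: "'a::euclidean_space set \<Rightarrow> int" where
  "euler_char S = (\<Sum>\<sigma>\<in>(SOME K. triangulates K S) - {{}}. (- 1) ^ nat (aff_dim \<sigma>))"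


section \<open>Seamed surfaces\<close>

text \<open>The germ of \<open>A\<close> along \<open>s\<close>, as a filter: two sets have the same germ iff they agree on
  some open neighbourhood of \<open>s\<close>.\<close>

definition germ :: "'a::topological_space set \<Rightarrow> 'a set \<Rightarrow> 'a filter" where
  "germ s A = (INF W\<in>{W. open W \<and> s \<subseteq> W}. principal (W \<inter> A))"

text \<open>A co-orientation of a seam is recorded as the ordered pair of the germs of its two sides:
  it points out of the first and into the second (preferred) one. Since germs do not
  depend on a choice of collars, co-orientations can be compared between surfaces
  that agree near the seam. Values of \<open>coor\<close> at sets that are not seams are irrelevant.\<close>

record seamed_surface =
  surf :: "(real^3) set"
  seams :: "(real^3) set set"
  coor :: "(real^3) set \<Rightarrow> (real^3) filter \<times> (real^3) filter"
  dots :: "(real^3) set"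

text \<open>\<open>s\<close> is the core of a two-sided collar in \<open>S\<close> with negative half \<open>N\<close> and positive half \<open>P\<close>.\<close>

definition bicollar ::
  "(real^3) set \<Rightarrow> (real^3) set \<Rightarrow> (real^3) set \<Rightarrow> (real^3) set \<Rightarrow> bool" where
  "bicollar S s N P \<longleftrightarrow>
     (\<exists>h :: (real^2) \<times> real \<Rightarrow> real^3.
        pl_embedding (bdD2 \<times> {-1..1}) h \<and> h ` (bdD2 \<times> {-1..1}) \<subseteq> S \<and>
        h ` (bdD2 \<times> {0}) = s \<and>
        h ` (bdD2 \<times> {-1..<0}) = N \<and> h ` (bdD2 \<times> {0<..1}) = P)"

definition closed_seamed_surface :: "seamed_surface \<Rightarrow> bool" where
  "closed_seamed_surface F \<longleftrightarrow>
     closed_pl_surface (surf F) \<and>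
     finite (seams F) \<and> pairwise disjnt (seams F) \<and>
     (\<forall>s\<in>seams F. s \<subseteq> surf F \<and> pl_homeomorphic bdD2 s \<and>
        (\<exists>N P. bicollar (surf F) s N P \<and> coor F s = (germ s N, germ s P))) \<and>
     finite (dots F) \<and> dots F \<subseteq> surf F - \<Union>(seams F)"

definition facets :: "seamed_surface \<Rightarrow> (real^3) set set" where
  "facets F = components (surf F - \<Union>(seams F))"

definition facet_out :: "seamed_surface \<Rightarrow> (real^3) set \<Rightarrow> (real^3) set" where
  "facet_out F s = (THE f. f \<in> facets F \<and> (\<forall>\<^sub>F x in fst (coor F s). x \<in> f))"

definition facet_into :: "seamed_surface \<Rightarrow> (real^3) set \<Rightarrow> (real^3) set" where
  "facet_into F s = (THE f. f \<in> facets F \<and> (\<forall>\<^sub>F x in snd (coor F s). x \<in> f))"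

definition adm :: "seamed_surface \<Rightarrow> ((real^3) set \<Rightarrow> nat) set" where
  "adm F = {c \<in> facets F \<rightarrow>\<^sub>E {1, 2}. \<forall>s\<in>seams F. c (facet_out F s) \<noteq> c (facet_into F s)}"


section \<open>Evaluation\<close>

text \<open>The field of fractions of the polynomial ring in \<open>\<alpha>1\<close>, \<open>\<alpha>2\<close> over the integers; the
  evaluations lie in its subring generated by \<open>\<alpha>1\<close>, \<open>\<alpha>2\<close> and the inverse of \<open>\<alpha>1 - \<alpha>2\<close>.\<close>

type_synonym coeff = "int poly poly fract"

definition \<alpha>1 :: coeff where "\<alpha>1 = to_fract [:[:0, 1:]:]"
definition \<alpha>2 :: coeff where "\<alpha>2 = to_fract [:0, 1:]"
definition E1 :: coeff where "E1 = \<alpha>1 + \<alpha>2"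
definition E2 :: coeff where "E2 = \<alpha>1 * \<alpha>2"

text \<open>Pitfall: a seam gets the color of the facet its co-orientation points OUT of.
  Coloring it by the facet the co-orientation points INTO multiplies the evaluation by
  \<open>(- 1) ^ card (seams F)\<close>, and the relations for cutting a neck along a seam and for adding a
  seam around a dotless disk then hold only with the opposite signs. For example, a sphere
  with one seam, co-oriented towards the half that carries the only dot, evaluates to 1
  here, in agreement with the seamed neck-cutting relation, and to -1 with the other choice.\<close>

definition seam_color :: "seamed_surface \<Rightarrow> ((real^3) set \<Rightarrow> nat) \<Rightarrow> (real^3) set \<Rightarrow> nat" where
  "seam_color F c s = c (facet_out F s)"

definition num_seams :: "seamed_surface \<Rightarrow> ((real^3) set \<Rightarrow> nat) \<Rightarrow> nat \<Rightarrow> nat" where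
  "num_seams F c i = card {s \<in> seams F. seam_color F c s = i}"

definition num_dots :: "seamed_surface \<Rightarrow> ((real^3) set \<Rightarrow> nat) \<Rightarrow> nat \<Rightarrow> nat" where
  "num_dots F c i = card {p \<in> dots F. \<exists>f\<in>facets F. p \<in> f \<and> c f = i}"

definition colored_part :: "seamed_surface \<Rightarrow> ((real^3) set \<Rightarrow> nat) \<Rightarrow> nat \<Rightarrow> (real^3) set" where
  "colored_part F c i = (\<Union>f\<in>{f \<in> facets F. c f = i}. closure f)"

text \<open>The Euler characteristic of the colored part after capping off its boundary circles,
  one for each seam.\<close>

definition capped_euler_char :: "seamed_surface \<Rightarrow> ((real^3) set \<Rightarrow> nat) \<Rightarrow> nat \<Rightarrow> int" where
  "capped_euler_char F c i = euler_char (colored_part F c i) + int (card (seams F))"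

text \<open>Both Euler characteristics are even for closed seamed surfaces, so \<open>div\<close> is exact.\<close>

definition eval_coloring :: "seamed_surface \<Rightarrow> ((real^3) set \<Rightarrow> nat) \<Rightarrow> coeff" where
  "eval_coloring F c =
     (- 1) powi (int (num_seams F c 1) + capped_euler_char F c 1 div 2) *
     (\<alpha>1 ^ num_dots F c 1 * \<alpha>2 ^ num_dots F c 2 / (\<alpha>2 - \<alpha>1) powi (euler_char (surf F) div 2))"

definition evaluation :: "seamed_surface \<Rightarrow> coeff" where
  "evaluation F = (\<Sum>c\<in>adm F. eval_coloring F c)"


section \<open>Local modifications\<close>

definition add_dot :: "real^3 \<Rightarrow> seamed_surface \<Rightarrow> seamed_surface" where
  "add_dot p F = F\<lparr>dots := insert p (dots F)\<rparr>"

definition neck :: "((real^2) \<times> real \<Rightarrow> real^3) \<Rightarrow> seamed_surface \<Rightarrow> bool" where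
  "neck h F \<longleftrightarrow>
     pl_embedding (D2 \<times> {0..1}) h \<and>
     h ` (D2 \<times> {0..1}) \<inter> surf F = h ` (bdD2 \<times> {0..1}) \<and>
     h ` (bdD2 \<times> {0..1}) \<inter> dots F = {}"

text \<open>Replaces the tube by the two disks and discards the seams on the tube.\<close>

definition cut_neck ::
  "((real^2) \<times> real \<Rightarrow> real^3) \<Rightarrow> seamed_surface \<Rightarrow> seamed_surface" where
  "cut_neck h F =
     F\<lparr>surf := (surf F - h ` (bdD2 \<times> {0..1})) \<union> h ` (D2 \<times> {0}) \<union> h ` (D2 \<times> {1}),
       seams := {s \<in> seams F. s \<inter> h ` (bdD2 \<times> {0..1}) = {}}\<rparr>"

definition add_seam_in ::
  "(real^2 \<Rightarrow> real^3) \<Rightarrow> seamed_surface \<Rightarrow> seamed_surface" where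
  "add_seam_in g F = (let s = g ` bdD2; D = g ` D2 in
     F\<lparr>seams := insert s (seams F),
       coor := (coor F)(s := (germ s (surf F - D), germ s (D - s)))\<rparr>)"

definition add_seam_out ::
  "(real^2 \<Rightarrow> real^3) \<Rightarrow> seamed_surface \<Rightarrow> seamed_surface" where
  "add_seam_out g F = (let s = g ` bdD2; D = g ` D2 in
     F\<lparr>seams := insert s (seams F),
       coor := (coor F)(s := (germ s (D - s), germ s (surf F - D)))\<rparr>)"

end

theory Submission
  imports Defs
begin

text \<open>The Euler characteristic extends to an integer valuation on the class of sets generated by
  compact convex sets: a linear relation between indicators of compact convex sets forces the
  corresponding relation between the numbers of nonempty ones. Hence \<open>euler_char\<close> does not depend on
  the triangulation, is additive and invariant under PL embeddings, circles and annuli have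
  characteristic 0 and discs 1.

  Colorings are treated as locally constant functions on the complement of the seams. The closure of
  the part of color 1 adds precisely the seams, which do not contribute to the Euler characteristic.
  Each relation then comes from a bijection of colorings that changes every weight by a fixed factor;
  Euler characteristics change by even numbers whenever they are halved, so parity is never needed.

  The topological input is invariance of domain in charts, and Janiszewski's theorem to see that the
  outer side of a seam bounding a disc is connected, so that this seam has a facet on either side.\<close>

section \<open>The Euler characteristic as a valuation\<close>

text \<open>Facets are a poor index set for comparing surfaces: a cut or a new seam merges and
  splits them. Functions on points can be restricted, recolored on a disc and glued, so the
  bijections of colorings become explicit formulas. The same operations leave open discs and
  half-open tubes, which are no unions of closed simplices; this is why a characteristic additive on
  non-closed pieces is wanted, and not merely the invariance of \<open>euler_char\<close>. A new
  seam comes with a PL disc but with no collar on its outer side. Co-orientations are therefore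
  handled only through germs carried by thin connected sets, and the modified surfaces are never
  shown to be closed seamed surfaces again. Cutting a neck raises the characteristic of the surface
  by 2, so each weight of \<open>F\<close> is plus or minus \<open>\<alpha>2 - \<alpha>1\<close>
  times the weight of the cut coloring. The cut surface has further colorings, whose caps have the
  wrong pair of colors; they disappear because \<open>\<alpha>1 + \<alpha>2 - E1\<close>,
  respectively \<open>alpha i - alpha i\<close>, is zero.\<close>

lemma convex_halfspace_split:
  fixes C :: "'a::euclidean_space set"
  assumes "convex C"
  shows "(if C = {} then 0 else k) =
    (if C \<inter> {x. n \<bullet> x \<le> b} = {} then 0 else k) + (if C \<inter> {x. n \<bullet> x \<ge> b} = {} then 0 else k)
    - (if C \<inter> {x. n \<bullet> x = b} = {} then 0 else k :: int)"
proof -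
  \<comment> \<open>Connectedness: a convex set meeting both closed half-spaces meets the
    hyperplane. What remains is a case distinction on which pieces are empty.\<close>
  have mid: "C \<inter> {x. n \<bullet> x = b} \<noteq> {}"
    if ne: "C \<inter> {x. n \<bullet> x \<le> b} \<noteq> {}" "C \<inter> {x. n \<bullet> x \<ge> b} \<noteq> {}"
  proof -
    obtain x y where "x \<in> C" "y \<in> C" "n \<bullet> x \<le> b" "b \<le> n \<bullet> y" using ne by blast
    from connected_ivt_hyperplane [OF convex_connected [OF assms] this] show ?thesis by auto
  qed
  have un: "C = C \<inter> {x. n \<bullet> x \<le> b} \<union> C \<inter> {x. n \<bullet> x \<ge> b}"
    by (auto simp: linear)
  have sub: "C \<inter> {x. n \<bullet> x = b} \<subseteq> C \<inter> {x. n \<bullet> x \<le> b}" "C \<inter> {x. n \<bullet> x = b} \<subseteq> C \<inter> {x. n \<bullet> x \<ge> b}"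
    by auto
  show ?thesis
    using mid un sub by (smt (verit) Un_empty subset_empty)
qed

text \<open>If the nonempty sets have no common point, a hyperplane separates one of them from the
  intersection of some others. Cutting along it leaves three families, each with fewer
  subfamilies having a common point.\<close>

lemma sum_convex_eq_0:
  fixes C :: "'i \<Rightarrow> 'a::euclidean_space set" and a :: "'i \<Rightarrow> int"
  assumes "finite I" and "\<And>i. i \<in> I \<Longrightarrow> compact (C i) \<and> convex (C i)"
    and "\<And>x. (\<Sum>i\<in>I. a i * indicator (C i) x) = 0"
  shows "(\<Sum>i\<in>I. if C i = {} then 0 else a i) = 0"
  using assms(2,3)
proof (induction "card {J. J \<subseteq> I \<and> J \<noteq> {} \<and> \<Inter>(C ` J) \<noteq> {}}" arbitrary: C rule: less_induct)
  case less
  note fin = \<open>finite I\<close>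
  define I' where "I' = {i\<in>I. C i \<noteq> {}}"
  have I': "(\<Sum>i\<in>I. if C i = {} then 0 else a i) = (\<Sum>i\<in>I'. a i)"
    unfolding I'_def using fin by (subst sum.inter_filter) (auto intro: sum.cong)
  show ?case
  \<comment> \<open>If all nonempty members share a point \<open>x\<close>, the assumed relation
    evaluated at \<open>x\<close> is already the desired sum.\<close>
  proof (cases "I' = {} \<or> \<Inter>(C ` I') \<noteq> {}")
    case True
    then consider "I' = {}" | x where "x \<in> \<Inter>(C ` I')" by blast
    then show ?thesis
    proof cases
      case (2 x)
      have "(\<Sum>i\<in>I. if C i = {} then 0 else a i) = (\<Sum>i\<in>I. a i * indicator (C i) x)"
        using 2 by (intro sum.cong) (auto simp: I'_def indicator_def)
      then show ?thesis using less.prems(2) by simp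
    qed (simp add: I')
  next
    case False
    then have "I' \<noteq> {}" "\<Inter>(C ` I') = {}" by auto
    then have I'_P: "I' \<subseteq> I' \<and> I' \<noteq> {} \<and> \<Inter>(C ` I') = {}" by simp
    \<comment> \<open>\<open>J\<close> is a smallest subfamily with empty intersection. Its members
      are nonempty, so removing one index \<open>i\<close> leaves a nonempty subfamily, which by
      minimality has a nonempty intersection \<open>A\<close>. The compact convex sets
      \<open>A\<close> and \<open>C i\<close> are disjoint and can be separated strictly.\<close>
    obtain J where "J \<subseteq> I' \<and> J \<noteq> {} \<and> \<Inter>(C ` J) = {}"
        "\<forall>J'. J' \<subseteq> I' \<and> J' \<noteq> {} \<and> \<Inter>(C ` J') = {} \<longrightarrow> card J \<le> card J'"
      using ex_has_least_nat [of "\<lambda>J. J \<subseteq> I' \<and> J \<noteq> {} \<and> \<Inter>(C ` J) = {}" I' card, OF I'_P] by metis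
    then have J: "J \<subseteq> I'" "J \<noteq> {}" "\<Inter>(C ` J) = {}"
      and min: "\<And>J'. \<lbrakk>J' \<subseteq> I'; J' \<noteq> {}; \<Inter>(C ` J') = {}\<rbrakk> \<Longrightarrow> card J \<le> card J'"
      by blast+
    obtain i where "i \<in> J" using J by auto
    have finJ: "finite J" using J(1) fin by (auto simp: I'_def intro: finite_subset)
    have iI: "i \<in> I" "C i \<noteq> {}" using \<open>i \<in> J\<close> J(1) by (auto simp: I'_def)
    define J0 where "J0 = J - {i}"
    have J0: "J0 \<noteq> {}" "J0 \<subseteq> I" using J \<open>i \<in> J\<close> iI by (auto simp: J0_def I'_def)
    define A where "A = \<Inter>(C ` J0)"
    have "card J0 < card J"
      unfolding J0_def using \<open>i \<in> J\<close> finJ by (meson card_Diff1_less)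
    then have A: "A \<noteq> {}" unfolding A_def using min [of J0] J J0 by (force simp: J0_def)
    have disj: "A \<inter> C i = {}" using J(3) \<open>i \<in> J\<close> by (auto simp: A_def J0_def)
    have "compact A" "convex A"
      using less.prems(1) J0 unfolding A_def
      by (auto intro!: compact_Inter convex_Inter)
    then obtain n b where nb: "\<forall>x\<in>A. n \<bullet> x < b" "\<forall>x\<in>C i. n \<bullet> x > b"
      using separating_hyperplane_compact_closed [OF \<open>convex A\<close> \<open>compact A\<close> A, of "C i"] less.prems(1) [OF iI(1)] disj
        compact_imp_closed by blast
    \<comment> \<open>Each half-space and the hyperplane itself misses \<open>A\<close> or
      \<open>C i\<close>. Hence \<open>J0\<close> or \<open>{i}\<close> loses its common point after
      intersecting with \<open>H\<close>, while no subfamily gains one, and the measure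
      drops.\<close>
    have IH: "(\<Sum>i\<in>I. if C i \<inter> H = {} then 0 else a i) = 0"
      if "closed H" "convex H" "A \<inter> H = {} \<or> C i \<inter> H = {}" for H
    proof (rule less.hyps)
      define N where "N = (\<lambda>C::'i \<Rightarrow> 'a set. {J. J \<subseteq> I \<and> J \<noteq> {} \<and> \<Inter>(C ` J) \<noteq> {}})"
      have 1: "N (\<lambda>i. C i \<inter> H) \<subseteq> N C" by (auto simp: N_def)
      have 2: "J0 \<in> N C" "{i} \<in> N C" using J0 A iI by (auto simp: N_def A_def)
      have "\<Inter>((\<lambda>i. C i \<inter> H) ` J0) = A \<inter> H" using J0(1) by (auto simp: A_def)
      then have 3: "J0 \<notin> N (\<lambda>i. C i \<inter> H) \<or> {i} \<notin> N (\<lambda>i. C i \<inter> H)"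
        using that(3) by (auto simp: N_def)
      have "finite (N C)" using fin by (simp add: N_def)
      then have "card (N (\<lambda>i. C i \<inter> H)) < card (N C)"
        by (rule psubset_card_mono) (use 1 2 3 in blast)
      then show "card {J. J \<subseteq> I \<and> J \<noteq> {} \<and> (\<Inter>i\<in>J. C i \<inter> H) \<noteq> {}} <
          card {J. J \<subseteq> I \<and> J \<noteq> {} \<and> \<Inter> (C ` J) \<noteq> {}}"
        by (simp only: N_def)
      show "compact (C j \<inter> H) \<and> convex (C j \<inter> H)" if "j \<in> I" for j
        using less.prems(1) [OF that] \<open>closed H\<close> \<open>convex H\<close> by (auto intro: compact_Int_closed convex_Int)
      show "(\<Sum>i\<in>I. a i * indicator (C i \<inter> H) x) = 0" for x
      proof -
        have "(\<Sum>i\<in>I. a i * indicator (C i \<inter> H) x) = (\<Sum>i\<in>I. a i * indicator (C i) x) * indicator H x"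
          by (simp add: indicator_inter_arith sum_distrib_right mult.assoc)
        then show ?thesis using less.prems(2) by simp
      qed
    qed
    have "(\<Sum>i\<in>I. if C i = {} then 0 else a i) =
      (\<Sum>i\<in>I. if C i \<inter> {x. n \<bullet> x \<le> b} = {} then 0 else a i) +
      (\<Sum>i\<in>I. if C i \<inter> {x. n \<bullet> x \<ge> b} = {} then 0 else a i) -
      (\<Sum>i\<in>I. if C i \<inter> {x. n \<bullet> x = b} = {} then 0 else a i)"
      unfolding sum.distrib [symmetric] sum_subtractf [symmetric]
      by (intro sum.cong refl convex_halfspace_split) (use less.prems(1) in auto)
    also have "\<dots> = 0"
      using IH [OF closed_halfspace_le convex_halfspace_le, of n b]
        IH [OF closed_halfspace_ge convex_halfspace_ge, of b n]
        IH [OF closed_hyperplane convex_hyperplane, of n b] nb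
      by (force simp: disjoint_iff not_le)
    finally show ?thesis .
  qed
qed

text \<open>A relation and not a function, since independence of the chosen expression is what has
  to be proved. Zero and differences already generate all integer combinations of indicators, which
  keeps inductions at three cases.\<close>

inductive has_euler :: "('a::euclidean_space \<Rightarrow> int) \<Rightarrow> int \<Rightarrow> bool" where
  zero: "has_euler (\<lambda>x. 0) 0"
| convex: "\<lbrakk>compact C; convex C; C \<noteq> {}\<rbrakk> \<Longrightarrow> has_euler (indicator C) 1"
| diff: "\<lbrakk>has_euler f m; has_euler g n\<rbrakk> \<Longrightarrow> has_euler (\<lambda>x. f x - g x) (m - n)"

text \<open>Flattens a derivation into a formal integer combination, the form to which
  \<open>sum_convex_eq_0\<close> applies.\<close>

lemma has_euler_imp_list:
  fixes f :: "'a::euclidean_space \<Rightarrow> int"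
  assumes "has_euler f n"
  shows "\<exists>xs. (\<forall>p\<in>set xs. compact (snd p) \<and> convex (snd p)) \<and>
    f = (\<lambda>x. \<Sum>p\<leftarrow>xs. fst p * indicator (snd p) x) \<and>
    n = (\<Sum>p\<leftarrow>xs. if snd p = {} then 0 else fst p)"
  using assms
proof induction
  case zero
  then show ?case by (intro exI [of _ "[]"]) auto
next
  case (convex C)
  then show ?case by (intro exI [of _ "[(1, C)]"]) auto
next
  case (diff f m g n)
  obtain xs where xs: "\<forall>p\<in>set xs. compact (snd p) \<and> convex (snd p)"
      "f = (\<lambda>x. \<Sum>p\<leftarrow>xs. fst p * indicator (snd p) x)"
      "m = (\<Sum>p\<leftarrow>xs. if snd p = {} then 0 else fst p)"
    using diff.IH(1) by blast
  obtain ys where ys: "\<forall>p\<in>set ys. compact (snd p) \<and> convex (snd p)"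
      "g = (\<lambda>x. \<Sum>p\<leftarrow>ys. fst p * indicator (snd p) x)"
      "n = (\<Sum>p\<leftarrow>ys. if snd p = {} then 0 else fst p)"
    using diff.IH(2) by blast
  have neg: "(\<Sum>p\<leftarrow>ys. - (F p :: int)) = - (\<Sum>p\<leftarrow>ys. F p)" for F
    by (induction ys) auto
  show ?case
  proof (intro exI conjI)
    let ?zs = "xs @ map (\<lambda>p. (- fst p, snd p)) ys"
    show "\<forall>p\<in>set ?zs. compact (snd p) \<and> convex (snd p)"
      using xs(1) ys(1) by auto
    show "(\<lambda>x. f x - g x) = (\<lambda>x. \<Sum>p\<leftarrow>?zs. fst p * indicator (snd p) x)"
      by (simp add: xs(2) ys(2) o_def neg)
    have "(\<lambda>p::int \<times> 'a set. if snd p = {} then 0 else - fst p) = (\<lambda>p. - (if snd p = {} then 0 else fst p))"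
      by auto
    moreover have "(\<lambda>p::int \<times> 'a set. if snd p = {} then 0 else fst p) \<circ> (\<lambda>p. (- fst p, snd p)) =
        (\<lambda>p. if snd p = {} then 0 else - fst p)"
      by (auto simp: fun_eq_iff)
    ultimately show "m - n = (\<Sum>p\<leftarrow>?zs. if snd p = {} then 0 else fst p)"
      unfolding xs(3) ys(3) by (simp add: neg)
  qed
qed

lemma has_euler_zero_unique:
  assumes "has_euler (\<lambda>x::'a::euclidean_space. 0) n"
  shows "n = 0"
proof -
  obtain xs where xs: "\<forall>p\<in>set xs. compact (snd p) \<and> convex (snd p)"
      "(\<lambda>x::'a. 0) = (\<lambda>x. \<Sum>p\<leftarrow>xs. fst p * indicator (snd p) x)"
      "n = (\<Sum>p\<leftarrow>xs. if snd p = {} then 0 else fst p)"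
    using has_euler_imp_list [OF assms] by blast
  have zero: "(\<Sum>p\<leftarrow>xs. fst p * indicator (snd p) x) = 0" for x
    using xs(2) by metis
  \<comment> \<open>Positions in the list serve as indices, so repeated sets stay separate members
    of the family.\<close>
  have "(\<Sum>i\<in>{0..<length xs}. if snd (xs ! i) = {} then 0 else fst (xs ! i)) = 0"
  proof (rule sum_convex_eq_0)
    show "(\<Sum>i\<in>{0..<length xs}. fst (xs ! i) * indicator (snd (xs ! i)) x) = 0" for x
      using zero [of x] by (simp add: sum_list_sum_nth)
  qed (use xs(1) in auto)
  then show ?thesis by (simp add: xs(3) sum_list_sum_nth)
qed

lemma has_euler_unique:
  assumes "has_euler f m" "has_euler f n"
  shows "m = n"
  using has_euler_zero_unique [of "m - n"] has_euler.diff [OF assms] by simp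

lemma has_euler_add:
  assumes "has_euler f m" "has_euler g n"
  shows "has_euler (\<lambda>x. f x + g x) (m + n)"
  using has_euler.diff [OF assms(1) has_euler.diff [OF has_euler.zero assms(2)]] by simp

section \<open>Sums and products of functions with an Euler value\<close>

lemma has_euler_sum:
  assumes "\<And>i. i \<in> I \<Longrightarrow> has_euler (f i) (n i)"
  shows "has_euler (\<lambda>x. \<Sum>i\<in>I. f i x) (\<Sum>i\<in>I. n i)"
  using assms
  by (induction I rule: infinite_finite_induct) (auto intro: has_euler.zero has_euler_add)

lemma has_euler_mult_indicator:
  assumes "has_euler f m" "compact C" "convex C"
  shows "\<exists>k. has_euler (\<lambda>x. f x * indicator C x) k"
  using assms(1)
proof induction
  case zero
  then show ?case using has_euler.zero by auto
next
  case (convex D)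
  show ?case
  proof (cases "D \<inter> C = {}")
    case True
    then have "(\<lambda>x. indicator D x * indicator C x) = (\<lambda>x. 0 :: int)"
      by (auto simp: indicator_def fun_eq_iff)
    then show ?thesis using has_euler.zero by metis
  next
    case False
    then have "has_euler (indicator (D \<inter> C)) 1"
      using convex assms by (intro has_euler.convex) (auto intro: convex_Int compact_Int)
    moreover have "indicator (D \<inter> C) = (\<lambda>x. indicator D x * indicator C x :: int)"
      by (auto simp: indicator_def fun_eq_iff)
    ultimately show ?thesis by metis
  qed
next
  case (diff f m g n)
  then show ?case by (auto simp: left_diff_distrib intro: has_euler.diff)
qed

text \<open>The value is not multiplicative, so only its existence is asserted. This suffices to
  close the sets with an Euler value under intersection.\<close>

lemma has_euler_mult:
  assumes "has_euler f m" "has_euler g n"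
  shows "\<exists>k. has_euler (\<lambda>x. f x * g x) k"
  using assms(2)
proof induction
  case zero
  then show ?case using has_euler.zero by auto
next
  case (convex C)
  then show ?case using has_euler_mult_indicator assms(1) by blast
next
  case (diff f m g n)
  then show ?case by (auto simp: right_diff_distrib intro: has_euler.diff)
qed

text \<open>On unions of open simplices this is the Euler characteristic with compact support:
  additive on disjoint pieces that need not be closed, with value \<open>(- 1) ^ n\<close> on an
  open cell of dimension \<open>n\<close>.\<close>

definition has_chi :: "'a::euclidean_space set \<Rightarrow> int \<Rightarrow> bool" where
  "has_chi A n \<longleftrightarrow> has_euler (indicator A) n"

definition chi :: "'a::euclidean_space set \<Rightarrow> int" where
  "chi A = (THE n. has_chi A n)"

lemma chi_unique: "has_chi A n \<Longrightarrow> chi A = n"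
  unfolding chi_def has_chi_def using has_euler_unique by blast

lemma has_chi_chi: "has_chi A n \<Longrightarrow> has_chi A (chi A)"
  using chi_unique by blast

lemma has_chi_empty [simp]: "has_chi {} 0"
  using has_euler.zero by (simp add: has_chi_def indicator_def [abs_def])

lemma has_chi_convex: "\<lbrakk>compact C; convex C; C \<noteq> {}\<rbrakk> \<Longrightarrow> has_chi C 1"
  by (simp add: has_chi_def has_euler.convex)

lemma has_chi_Diff:
  assumes "has_chi B m" "has_chi A n" "A \<subseteq> B"
  shows "has_chi (B - A) (m - n)"
proof -
  have "indicator (B - A) = (\<lambda>x. indicator B x - indicator A x :: int)"
    using assms(3) by (auto simp: indicator_def fun_eq_iff)
  then show ?thesis using has_euler.diff assms by (metis has_chi_def)
qed

lemma has_chi_UN_disjoint: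
  assumes "finite I" "\<And>i. i \<in> I \<Longrightarrow> has_chi (A i) (n i)" "disjoint_family_on A I"
  shows "has_chi (\<Union>i\<in>I. A i) (\<Sum>i\<in>I. n i)"
proof -
  have "indicator (\<Union>i\<in>I. A i) = (\<lambda>x. \<Sum>i\<in>I. indicator (A i) x :: int)"
    using indicator_UN_disjoint [OF assms(1,3)] by blast
  then show ?thesis
    using has_euler_sum [of I "\<lambda>i. indicator (A i)" n] assms(2) by (simp add: has_chi_def)
qed

lemma has_chi_Un:
  assumes "has_chi A m" "has_chi B n" "A \<inter> B = {}"
  shows "has_chi (A \<union> B) (m + n)"
proof -
  have "indicator (A \<union> B) = (\<lambda>x. indicator A x + indicator B x :: int)"
    using assms(3) by (auto simp: indicator_def fun_eq_iff)
  then show ?thesis using has_euler_add assms by (metis has_chi_def)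
qed

lemma has_chi_Int:
  assumes "has_chi A m" "has_chi B n"
  shows "\<exists>k. has_chi (A \<inter> B) k"
  using has_euler_mult assms unfolding has_chi_def
  by (metis (no_types, lifting) ext indicator_inter_arith)

text \<open>Every convex generator \<open>C\<close> may be replaced by \<open>C \<times> Q\<close>,
  which is again nonempty, compact and convex. Applied to the circle and an interval it gives the
  tube, applied to a disc and a point the caps.\<close>

lemma has_chi_times:
  assumes "has_chi A n" "compact Q" "convex Q" "Q \<noteq> {}"
  shows "has_chi (A \<times> Q) n"
proof -
  have "has_euler (\<lambda>(x,y). f x * indicator Q y) n" if "has_euler f n" for f n
    using that
  proof induction
    case zero
    then show ?case using has_euler.zero by (simp add: case_prod_unfold)
  next
    case (convex C)
    have "indicator (C \<times> Q) = (\<lambda>(x,y). indicator C x * indicator Q y :: int)"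
      by (auto simp: indicator_def fun_eq_iff)
    then show ?case
      using has_euler.convex [of "C \<times> Q"] convex assms by (simp add: compact_Times convex_Times)
  next
    case (diff f m g n)
    then show ?case
      using has_euler.diff by (fastforce simp: case_prod_unfold left_diff_distrib)
  qed
  moreover have "indicator (A \<times> Q) = (\<lambda>(x,y). indicator A x * indicator Q y :: int)"
    by (auto simp: indicator_def fun_eq_iff)
  ultimately show ?thesis using assms(1) by (metis has_chi_def)
qed

section \<open>Simplicial complexes and polyhedral sets\<close>

text \<open>A point of the relative boundary lies in a proper face, of smaller dimension. The
  measure is shifted by one because the empty set has affine dimension -1.\<close>

lemma polytope_rel_interior_face:
  fixes P :: "'a::euclidean_space set"
  assumes "polytope P" "x \<in> P"
  shows "\<exists>F. F face_of P \<and> x \<in> rel_interior F"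
  using assms
proof (induction "nat (aff_dim P + 1)" arbitrary: P rule: less_induct)
  case less
  show ?case
  proof (cases "x \<in> rel_interior P")
    case True
    then show ?thesis
      using less.prems face_of_refl polytope_imp_convex by blast
  next
    case False
    then have "x \<in> rel_frontier P"
      using less.prems closure_subset by (auto simp: rel_frontier_def)
    then obtain F where F: "F face_of P" "F \<noteq> P" "x \<in> F"
      using rel_frontier_of_polyhedron_alt [OF polytope_imp_polyhedron [OF less.prems(1)]] by auto
    have "aff_dim F < aff_dim P"
      using F face_of_aff_dim_lt less.prems(1) polytope_imp_convex by blast
    moreover have "aff_dim F \<ge> -1" by (rule aff_dim_geq)
    ultimately have "nat (aff_dim F + 1) < nat (aff_dim P + 1)" by linarith
    then obtain G where "G face_of F" "x \<in> rel_interior G"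
      using less.hyps [of F] F less.prems(1) face_of_polytope_polytope by blast
    then show ?thesis using F(1) face_of_trans by blast
  qed
qed

text \<open>The expansion of the product of \<open>1 - 1\<close> over \<open>C\<close>.\<close>

lemma sum_minus_one_power_card_Pow:
  assumes "finite C" "C \<noteq> {}"
  shows "(\<Sum>c\<in>Pow C. (- 1 :: int) ^ card c) = 0"
proof -
  have "(\<Prod>x\<in>C. (1::int) - 1) = (\<Sum>c\<in>Pow C. (- 1) ^ card c * (\<Prod>x\<in>c. 1) * (\<Prod>x\<in>C - c. 1))"
    using assms(1) by (rule prod_diff_conv_sum)
  then show ?thesis using assms by (simp add: power_0_left card_gt_0_iff)
qed

text \<open>The closed simplex has value 1 and is the disjoint union of its open faces, one for each
  nonempty set of vertices. The proper ones are known by induction, and the vanishing alternating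
  sum over all subsets of \<open>C\<close> leaves the stated value for the top face.\<close>

lemma has_chi_rel_interior_convex_hull:
  fixes C :: "'a::euclidean_space set"
  assumes "\<not> affine_dependent C" "C \<noteq> {}"
  shows "has_chi (rel_interior (convex hull C)) ((- 1) ^ (card C - 1))"
proof -
  have "finite C" using assms aff_independent_finite by blast
  then show ?thesis using assms
  proof (induction C rule: finite_psubset_induct)
    case (psubset C)
    let ?R = "\<lambda>c. rel_interior (convex hull c)"
    let ?I = "Pow C - {{}, C}"
    have face: "convex hull c face_of convex hull C" if "c \<subseteq> C" for c
      using face_of_convex_hull_affine_independent [OF psubset.prems(1)] that by blast
    have IH: "has_chi (?R c) (- ((- 1) ^ card c))" if "c \<in> ?I" for c
    proof -
      have "\<not> affine_dependent c" using psubset.prems(1) that affine_dependent_subset by blast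
      moreover have "card c > 0" using that psubset.hyps by (auto simp: card_gt_0_iff intro: finite_subset)
      moreover have "(- 1 :: int) ^ (card c - 1) = - ((- 1) ^ card c)" if "card c > 0"
        using that by (cases "card c") auto
      ultimately show ?thesis using psubset.IH [of c] that by auto
    qed
    \<comment> \<open>Faces whose relative interiors meet coincide, and affine independence recovers
      the vertices as the extreme points of the face.\<close>
    have eq: "c = d" if "c \<in> Pow C" "d \<in> Pow C" "x \<in> ?R c" "x \<in> ?R d" for c d x
    proof -
      have "convex hull c = convex hull d"
        by (rule face_of_eq [OF face face]) (use that in auto)
      then show ?thesis
        using that psubset.prems(1)
        by (metis PowD affine_dependent_subset affine_hull_convex_hull affine_independent_span_eq
            extreme_point_of_convex_hull_affine_independent set_eq_iff)
    qed
    have dis: "disjoint_family_on ?R ?I"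
      unfolding disjoint_family_on_def using eq by blast
    have un: "has_chi (\<Union>c\<in>?I. ?R c) (\<Sum>c\<in>?I. - ((- 1) ^ card c))"
      by (rule has_chi_UN_disjoint [OF _ IH dis]) (use psubset.hyps in auto)
    have "?R C = convex hull C - (\<Union>c\<in>?I. ?R c)"
    proof
      show "?R C \<subseteq> convex hull C - (\<Union>c\<in>?I. ?R c)"
        using rel_interior_subset [of "convex hull C"] eq [of C] by auto
      show "convex hull C - (\<Union>c\<in>?I. ?R c) \<subseteq> ?R C"
      proof
        fix x assume x: "x \<in> convex hull C - (\<Union>c\<in>?I. ?R c)"
        have "polytope (convex hull C)" using psubset.hyps by (auto simp: polytope_def)
        then obtain F where "F face_of convex hull C" "x \<in> rel_interior F"
          using polytope_rel_interior_face [of "convex hull C" x] x by blast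
        moreover then obtain c where "c \<subseteq> C" "F = convex hull c"
          using face_of_convex_hull_affine_independent [OF psubset.prems(1)] by blast
        moreover have "c \<noteq> {}" using calculation by auto
        ultimately show "x \<in> ?R C" using x by blast
      qed
    qed
    moreover have "has_chi (convex hull C) 1"
      by (rule has_chi_convex) (use psubset finite_imp_compact_convex_hull in auto)
    moreover have "(\<Union>c\<in>?I. ?R c) \<subseteq> convex hull C"
    proof (rule UN_least)
      fix c assume "c \<in> ?I"
      then have "convex hull c \<subseteq> convex hull C" by (intro hull_mono) auto
      then show "?R c \<subseteq> convex hull C" using rel_interior_subset [of "convex hull c"] by simp
    qed
    ultimately have "has_chi (?R C) (1 - (\<Sum>c\<in>?I. - ((- 1) ^ card c)))"
      using has_chi_Diff un by metis
    moreover have "(\<Sum>c\<in>Pow C. (- 1 :: int) ^ card c) = 1 + (- 1) ^ card C + (\<Sum>c\<in>?I. (- 1) ^ card c)"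
      using psubset.hyps psubset.prems(2)
      by (subst sum.subset_diff [of "{{}, C}"]) auto
    moreover have "(- 1 :: int) ^ (card C - 1) = - ((- 1) ^ card C)"
      using psubset by (cases "card C") auto
    ultimately show ?case
      using sum_minus_one_power_card_Pow [OF psubset.hyps psubset.prems(2)]
      by (simp add: sum_negf) (smt (verit))
  qed
qed

lemma has_chi_rel_interior_simplex:
  assumes "n simplex S" "S \<noteq> {}"
  shows "has_chi (rel_interior S) ((- 1) ^ nat (aff_dim S))"
proof -
  obtain C where C: "\<not> affine_dependent C" "int (card C) = n + 1" "S = convex hull C"
    using assms(1) by (auto simp: simplex_def)
  have "nat (aff_dim S) = card C - 1"
    using aff_dim_simplex [OF assms(1)] C(2) by simp
  moreover have "C \<noteq> {}" using assms(2) C(3) by auto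
  ultimately show ?thesis using has_chi_rel_interior_convex_hull [OF C(1)] C(3) by metis
qed

text \<open>A face of \<open>\<sigma>\<close> that meets the relative interior of
  \<open>\<sigma>\<close> is \<open>\<sigma>\<close> itself.\<close>

lemma simplicial_complex_subset_if_meets:
  assumes "simplicial_complex K" "\<sigma> \<in> K" "\<tau> \<in> K" "rel_interior \<sigma> \<inter> \<tau> \<noteq> {}"
  shows "\<sigma> \<subseteq> \<tau>"
proof -
  have "\<sigma> \<inter> \<tau> face_of \<sigma>" using assms by (auto simp: simplicial_complex_def)
  moreover have "(\<sigma> \<inter> \<tau>) \<inter> rel_interior \<sigma> \<noteq> {}" using assms(4) rel_interior_subset by blast
  ultimately have "\<sigma> \<inter> \<tau> = \<sigma>" using face_of_disjoint_rel_interior by blast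
  then show ?thesis by blast
qed

lemma simplicial_complex_rel_interior_unique:
  assumes "simplicial_complex K" "\<sigma> \<in> K" "\<tau> \<in> K" "rel_interior \<sigma> \<inter> rel_interior \<tau> \<noteq> {}"
  shows "\<sigma> = \<tau>"
proof
  have "rel_interior \<sigma> \<inter> \<tau> \<noteq> {}" "rel_interior \<tau> \<inter> \<sigma> \<noteq> {}"
    using assms(4) rel_interior_subset [of \<sigma>] rel_interior_subset [of \<tau>] by auto
  then show "\<sigma> \<subseteq> \<tau>" "\<tau> \<subseteq> \<sigma>"
    using simplicial_complex_subset_if_meets [OF assms(1)] assms(2,3) by simp_all
qed

lemma simplicial_complex_polytope: "\<lbrakk>simplicial_complex K; \<sigma> \<in> K\<rbrakk> \<Longrightarrow> polytope \<sigma>"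
  unfolding simplicial_complex_def by (elim conjE, drule (1) bspec, erule exE, erule simplex_imp_polytope)

lemma simplicial_complex_rel_interior_cover:
  assumes "simplicial_complex K" "x \<in> \<Union>K"
  shows "\<exists>\<sigma>\<in>K. x \<in> rel_interior \<sigma>"
proof -
  obtain \<tau> where \<tau>: "\<tau> \<in> K" "x \<in> \<tau>" using assms(2) by blast
  then obtain \<sigma> where "\<sigma> face_of \<tau>" "x \<in> rel_interior \<sigma>"
    using polytope_rel_interior_face simplicial_complex_polytope [OF assms(1)] by blast
  then show ?thesis using assms(1) \<tau>(1) unfolding simplicial_complex_def by blast
qed

text \<open>Unions of open simplices of \<open>K\<close>. In contrast to subcomplexes they are
  closed under differences, so they include the complement of the seams and the color
  classes.\<close>

definition cellular :: "'a::euclidean_space set set \<Rightarrow> 'a set \<Rightarrow> bool" where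
  "cellular K A \<longleftrightarrow> simplicial_complex K \<and> A \<subseteq> \<Union>K \<and>
     (\<forall>\<sigma>\<in>K. rel_interior \<sigma> \<subseteq> A \<or> rel_interior \<sigma> \<inter> A = {})"

lemma cellular_Un: "\<lbrakk>cellular K A; cellular K B\<rbrakk> \<Longrightarrow> cellular K (A \<union> B)"
  unfolding cellular_def by blast

lemma cellular_Diff: "\<lbrakk>cellular K A; cellular K B\<rbrakk> \<Longrightarrow> cellular K (A - B)"
  unfolding cellular_def by blast

lemma cellular_Union: "\<lbrakk>simplicial_complex K; \<And>A. A \<in> \<A> \<Longrightarrow> cellular K A\<rbrakk> \<Longrightarrow> cellular K (\<Union>\<A>)"
  unfolding cellular_def by (intro conjI ballI) (simp, fast, fast)

lemma cellular_obtain: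
  assumes "cellular K A" "x \<in> A"
  obtains \<sigma> where "\<sigma> \<in> K" "x \<in> rel_interior \<sigma>" "rel_interior \<sigma> \<subseteq> A"
  using assms simplicial_complex_rel_interior_cover [of K x] unfolding cellular_def by blast

lemma cellular_eq_UN:
  assumes "cellular K A"
  shows "A = (\<Union>\<sigma>\<in>{\<sigma> \<in> K - {{}}. rel_interior \<sigma> \<subseteq> A}. rel_interior \<sigma>)"
proof (intro subset_antisym subsetI)
  fix x assume "x \<in> A"
  then obtain \<sigma> where "\<sigma> \<in> K" "x \<in> rel_interior \<sigma>" "rel_interior \<sigma> \<subseteq> A"
    by (rule cellular_obtain [OF assms])
  moreover then have "\<sigma> \<noteq> {}" by auto
  ultimately show "x \<in> (\<Union>\<sigma>\<in>{\<sigma> \<in> K - {{}}. rel_interior \<sigma> \<subseteq> A}. rel_interior \<sigma>)" by simp blast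
qed auto

text \<open>The empty face has to be taken out by hand, since its relative interior is contained in
  every \<open>A\<close>.\<close>

lemma cellular_has_chi:
  assumes "cellular K A"
  shows "has_chi A (\<Sum>\<sigma>\<in>{\<sigma> \<in> K - {{}}. rel_interior \<sigma> \<subseteq> A}. (- 1) ^ nat (aff_dim \<sigma>))"
proof -
  have K: "simplicial_complex K" using assms by (simp add: cellular_def)
  have "disjoint_family_on rel_interior {\<sigma> \<in> K - {{}}. rel_interior \<sigma> \<subseteq> A}"
    unfolding disjoint_family_on_def
  proof (intro ballI impI)
    fix \<sigma> \<tau> assume "\<sigma> \<in> {\<sigma> \<in> K - {{}}. rel_interior \<sigma> \<subseteq> A}" "\<tau> \<in> {\<sigma> \<in> K - {{}}. rel_interior \<sigma> \<subseteq> A}" "\<sigma> \<noteq> \<tau>"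
    then show "rel_interior \<sigma> \<inter> rel_interior \<tau> = {}"
      using simplicial_complex_rel_interior_unique [OF K, of \<sigma> \<tau>] by blast
  qed
  moreover have "finite K" using K by (simp add: simplicial_complex_def)
  moreover have "has_chi (rel_interior \<sigma>) ((- 1) ^ nat (aff_dim \<sigma>))" if "\<sigma> \<in> K - {{}}" for \<sigma>
    using that K has_chi_rel_interior_simplex unfolding simplicial_complex_def by blast
  ultimately show ?thesis
    by (subst (1) cellular_eq_UN [OF assms]) (intro has_chi_UN_disjoint, auto)
qed

section \<open>Independence of the triangulation\<close>

lemma triangulates_rel_interior_subset:
  assumes "triangulates K S" "\<sigma> \<in> K"
  shows "rel_interior \<sigma> \<subseteq> S"
proof -
  have "\<sigma> \<subseteq> \<Union>K" using assms(2) by (rule Union_upper)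
  with rel_interior_subset [of \<sigma>] show ?thesis using assms(1) by (simp add: triangulates_def)
qed

lemma triangulates_cellular: "triangulates K S \<Longrightarrow> cellular K S"
  using triangulates_rel_interior_subset [of K S] unfolding cellular_def
  by (intro conjI ballI disjI1) (simp_all add: triangulates_def)

text \<open>The alternating sum over the triangulation picked by \<open>SOME\<close> is a value of
  \<open>has_chi S\<close>, and such values are unique.\<close>

theorem euler_char_eq_chi:
  assumes "triangulates K S"
  shows "euler_char S = chi S"
proof -
  define L where "L = (SOME K. triangulates K S)"
  have L: "triangulates L S" unfolding L_def using assms by (rule someI)
  have "{\<sigma> \<in> L - {{}}. rel_interior \<sigma> \<subseteq> S} = L - {{}}"
    using triangulates_rel_interior_subset [OF L] by blast
  then have "has_chi S (\<Sum>\<sigma>\<in>L - {{}}. (- 1) ^ nat (aff_dim \<sigma>))"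
    using cellular_has_chi [OF triangulates_cellular [OF L]] by simp
  from chi_unique [OF this] show ?thesis
    unfolding euler_char_def L_def by simp
qed

text \<open>A closed set contains with an open simplex also the closed one, so the simplices inside
  \<open>A\<close> form a subcomplex. This leads from \<open>chi\<close> of composite sets back to
  \<open>euler_char\<close>.\<close>

lemma cellular_closed_triangulates:
  assumes "cellular K A" "closed A"
  shows "triangulates {\<sigma> \<in> K. \<sigma> \<subseteq> A} A"
proof -
  have K: "simplicial_complex K" using assms by (simp add: cellular_def)
  have *: "\<sigma> \<subseteq> A" if "\<sigma> \<in> K" "rel_interior \<sigma> \<subseteq> A" for \<sigma>
  proof -
    have "convex \<sigma>" "closed \<sigma>"
      using simplicial_complex_polytope [OF K that(1)] polytope_imp_convex polytope_imp_closed by auto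
    then have "closure (rel_interior \<sigma>) = \<sigma>" by (simp add: convex_closure_rel_interior)
    then show ?thesis using closure_minimal [OF that(2) assms(2)] by simp
  qed
  have un: "\<Union>{\<sigma> \<in> K. \<sigma> \<subseteq> A} = A"
  proof (intro subset_antisym subsetI)
    fix x assume "x \<in> A"
    then obtain \<sigma> where "\<sigma> \<in> K" "x \<in> rel_interior \<sigma>" "rel_interior \<sigma> \<subseteq> A"
      by (rule cellular_obtain [OF assms(1)])
    with * show "x \<in> \<Union>{\<sigma> \<in> K. \<sigma> \<subseteq> A}" using rel_interior_subset [of \<sigma>] by blast
  qed auto
  have sc: "simplicial_complex {\<sigma> \<in> K. \<sigma> \<subseteq> A}"
  proof -
    have K': "finite K" "\<forall>S\<in>K. \<exists>n. n simplex S" "\<forall>F S. S \<in> K \<and> F face_of S \<longrightarrow> F \<in> K"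
      "\<forall>S S'. S \<in> K \<and> S' \<in> K \<longrightarrow> S \<inter> S' face_of S"
      using K unfolding simplicial_complex_def by - (elim conjE; assumption)+
    show ?thesis
      unfolding simplicial_complex_def
    proof (intro conjI allI impI ballI)
      show "F \<in> {\<sigma> \<in> K. \<sigma> \<subseteq> A}" if "S \<in> {\<sigma> \<in> K. \<sigma> \<subseteq> A} \<and> F face_of S" for F S
        using that K'(3) face_of_imp_subset [of F S] by fast
    qed (use K'(1,2,4) in \<open>simp_all\<close>)
  qed
  show ?thesis unfolding triangulates_def using un sc by (rule conjI [rotated])
qed

text \<open>The polytopes may overlap arbitrarily, which makes stability under PL images and
  products immediate. A triangulation is recovered by refinement when it is needed.\<close>

definition polyset :: "'a::euclidean_space set \<Rightarrow> bool" where
  "polyset S \<longleftrightarrow> (\<exists>Q. finite Q \<and> (\<forall>P\<in>Q. polytope P) \<and> S = \<Union>Q)"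

lemma polyset_polytope: "polytope P \<Longrightarrow> polyset P"
  unfolding polyset_def by (intro exI [of _ "{P}"]) auto

lemma polyset_compact: "polyset S \<Longrightarrow> compact S"
  unfolding polyset_def using polytope_imp_compact by (auto intro: compact_Union)

lemma triangulates_polyset: "triangulates K S \<Longrightarrow> polyset S"
  unfolding triangulates_def polyset_def
  by (intro exI [of _ K]) (auto simp: simplicial_complex_polytope, simp add: simplicial_complex_def)

lemma finite_halfspaces_polytope:
  fixes P :: "'a::euclidean_space set"
  assumes "polytope P"
  shows "\<exists>I. finite I \<and> P = {x. \<forall>(a,b)\<in>I. a \<bullet> x \<le> b}"
proof -
  obtain F where F: "finite F" "P = \<Inter>F" "\<forall>h\<in>F. \<exists>a b. a \<noteq> 0 \<and> h = {x. a \<bullet> x \<le> b}"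
    using polytope_imp_polyhedron [OF assms] by (auto simp: polyhedron_def)
  then obtain a b where ab: "\<forall>h\<in>F. h = {x. a h \<bullet> x \<le> b h}" by metis
  have "P = {x. \<forall>(a,b)\<in>(\<lambda>h. (a h, b h)) ` F. a \<bullet> x \<le> b}"
    unfolding F(2) using ab by auto
  then show ?thesis using F(1) by blast
qed

text \<open>A box around all polytopes is subdivided along every hyperplane bounding one of them,
  and the cells are triangulated. A simplex then lies on one side of each hyperplane, hence an open
  simplex lies in a given polytope or misses it.\<close>

lemma polytopes_common_refinement:
  fixes Q :: "'a::euclidean_space set set"
  assumes "finite Q" "\<And>P. P \<in> Q \<Longrightarrow> polytope P"
  obtains K where "\<And>P. P \<in> Q \<Longrightarrow> cellular K P" "simplicial_complex K"
proof -
  have "\<forall>P\<in>Q. \<exists>I. finite I \<and> P = {x. \<forall>(a,b)\<in>I. a \<bullet> x \<le> b}"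
    by (intro ballI finite_halfspaces_polytope assms(2))
  from bchoice [OF this] obtain I
    where I_all: "\<forall>P\<in>Q. finite (I P) \<and> P = {x. \<forall>(a,b)\<in>I P. a \<bullet> x \<le> b}" ..
  have I_finite: "finite (I P)" if "P \<in> Q" for P
    using bspec [OF I_all that] by (rule conjunct1)
  have I: "x \<in> P \<longleftrightarrow> (\<forall>(a,b)\<in>I P. a \<bullet> x \<le> b)" if "P \<in> Q" for P x
    by (subst (1) conjunct2 [OF bspec [OF I_all that]]) (rule mem_Collect_eq)
  have "bounded (\<Union>Q)" using assms by (intro bounded_Union ballI polytope_imp_bounded)
  then obtain u :: 'a where u: "\<Union>Q \<subseteq> cbox (- u) u"
    using bounded_subset_cbox_symmetric by blast
  \<comment> \<open>An instance of \<open>cell_subdivision_lemma\<close>: the initial complex is the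
    single box, and the last clause says that no cell has points strictly on both sides of a listed
    hyperplane.\<close>
  have "\<exists>G. \<Union>G = \<Union>{cbox (- u) u} \<and> finite G \<and>
       (\<forall>C\<in>G. \<exists>D. D \<in> {cbox (- u) u} \<and> C \<subseteq> D) \<and>
       (\<forall>C\<in>{cbox (- u) u}. \<forall>x\<in>C. \<exists>D. D \<in> G \<and> x \<in> D \<and> D \<subseteq> C) \<and>
       (\<forall>X\<in>G. polytope X) \<and> (\<forall>X\<in>G. aff_dim X \<le> int DIM('a)) \<and>
       (\<forall>X\<in>G. \<forall>Y\<in>G. X \<inter> Y face_of X) \<and>
       (\<forall>X\<in>G. \<forall>x\<in>X. \<forall>y\<in>X. \<forall>a b. (a,b) \<in> \<Union>(I ` Q) \<longrightarrow>
          a \<bullet> x \<le> b \<and> a \<bullet> y \<le> b \<or> a \<bullet> x \<ge> b \<and> a \<bullet> y \<ge> b)"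
    by (rule cell_subdivision_lemma)
      (use I_finite assms(1) in \<open>auto simp: polytope_interval aff_dim_le_DIM face_of_refl\<close>)
  then obtain G where G: "\<Union>G = cbox (- u) u" "finite G" "\<And>X. X \<in> G \<Longrightarrow> polytope X"
      "\<And>X Y. X \<in> G \<Longrightarrow> Y \<in> G \<Longrightarrow> X \<inter> Y face_of X"
      "\<forall>X\<in>G. \<forall>x\<in>X. \<forall>y\<in>X. \<forall>a b. (a,b) \<in> \<Union>(I ` Q) \<longrightarrow>
          a \<bullet> x \<le> b \<and> a \<bullet> y \<le> b \<or> a \<bullet> x \<ge> b \<and> a \<bullet> y \<ge> b"
    by (elim exE conjE) simp
  have "\<exists>K. simplicial_complex K \<and> \<Union>K = \<Union>G \<and> (\<forall>\<sigma>\<in>K. \<exists>C\<in>G. \<sigma> \<subseteq> C)"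
  proof (rule simplicial_subdivision_of_cell_complex [OF G(2,3,4)])
    fix K
    assume "simplicial_complex K" "\<Union>K = \<Union>G" "\<And>\<sigma>. \<sigma> \<in> K \<Longrightarrow> \<exists>C. C \<in> G \<and> \<sigma> \<subseteq> C"
    then show ?thesis by (intro exI [of _ K]) (simp add: Bex_def)
  qed
  then obtain K where K: "simplicial_complex K" "\<Union>K = \<Union>G" "\<forall>\<sigma>\<in>K. \<exists>C\<in>G. \<sigma> \<subseteq> C"
    by (elim exE conjE)
  have "cellular K P" if "P \<in> Q" for P
  proof -
    have "\<sigma> \<subseteq> P" if \<sigma>: "\<sigma> \<in> K" "rel_interior \<sigma> \<inter> P \<noteq> {}" for \<sigma>
    proof -
      obtain p where p: "p \<in> rel_interior \<sigma>" "p \<in> P" using \<sigma> by blast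
      obtain X where X: "X \<in> G" "\<sigma> \<subseteq> X" using K(3) \<sigma>(1) by blast
      have conv: "convex \<sigma>"
        using simplicial_complex_polytope [OF K(1) \<sigma>(1)] polytope_imp_convex by auto
      \<comment> \<open>If \<open>y\<close> violated the inequality, all of \<open>\<sigma>\<close>
        would lie in the opposite half-space. Then \<open>p\<close> is a relative interior point on
        a supporting hyperplane, so \<open>\<sigma>\<close> lies in that hyperplane, contrary to the
        choice of \<open>y\<close>.\<close>
      have "a \<bullet> y \<le> b" if y: "y \<in> \<sigma>" and ab: "(a,b) \<in> I P" for y a b
      proof (rule ccontr)
        assume gt: "\<not> a \<bullet> y \<le> b"
        have ge: "a \<bullet> z \<ge> b" if "z \<in> \<sigma>" for z
        proof -
          have "(a,b) \<in> \<Union>(I ` Q)" "y \<in> X" "z \<in> X" using ab \<open>P \<in> Q\<close> X(2) y that by auto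
          then show ?thesis using G(5) [rule_format, OF X(1), of y z a b] gt by linarith
        qed
        have "a \<bullet> p \<le> b" using p(2) I [OF \<open>P \<in> Q\<close>, of p] ab by auto
        moreover have "p \<in> \<sigma>" using p(1) rel_interior_subset [of \<sigma>] by blast
        ultimately have "p \<in> (\<sigma> \<inter> {x. a \<bullet> x = b}) \<inter> rel_interior \<sigma>"
          using ge [of p] p(1) by auto
        then have "\<sigma> \<inter> {x. a \<bullet> x = b} = \<sigma>"
          using face_of_disjoint_rel_interior [OF face_of_Int_supporting_hyperplane_ge [OF conv ge]] by auto
        then show False using y gt by auto
      qed
      then show ?thesis using I [OF \<open>P \<in> Q\<close>] by auto
    qed
    moreover have "P \<subseteq> \<Union>K" using u that K(2) G(1) by auto
    ultimately show ?thesis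
      using K(1) subset_trans [OF rel_interior_subset] unfolding cellular_def by metis
  qed
  then show ?thesis using that K(1) by blast
qed

lemma polysets_common_refinement:
  fixes \<A> :: "'a::euclidean_space set set"
  assumes "finite \<A>" "\<And>A. A \<in> \<A> \<Longrightarrow> polyset A"
  shows "\<exists>K. simplicial_complex K \<and> (\<forall>A\<in>\<A>. cellular K A)"
proof -
  have "\<forall>A\<in>\<A>. \<exists>Q. finite Q \<and> (\<forall>P\<in>Q. polytope P) \<and> A = \<Union>Q" using assms(2) by (simp add: polyset_def)
  from bchoice [OF this] obtain Q
    where Q: "\<forall>A\<in>\<A>. finite (Q A) \<and> (\<forall>P\<in>Q A. polytope P) \<and> A = \<Union>(Q A)" ..
  have "finite (\<Union>(Q ` \<A>))" "\<And>P. P \<in> \<Union>(Q ` \<A>) \<Longrightarrow> polytope P" using Q assms(1) by blast+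
  then obtain K where K: "\<And>P. P \<in> \<Union>(Q ` \<A>) \<Longrightarrow> cellular K P" "simplicial_complex K"
    using polytopes_common_refinement by blast
  have "cellular K A" if A: "A \<in> \<A>" for A
  proof -
    have "cellular K (\<Union>(Q A))" using K A by (intro cellular_Union) auto
    moreover have "A = \<Union>(Q A)" using Q A by blast
    ultimately show ?thesis by metis
  qed
  then show ?thesis using K(2) by blast
qed

lemma polyset_triangulable:
  assumes "polyset S"
  shows "\<exists>K. triangulates K S"
proof -
  obtain K where "cellular K S"
    using polysets_common_refinement [of "{S}"] assms by auto
  moreover have "closed S" using assms by (simp add: polyset_compact compact_imp_closed)
  ultimately show ?thesis using cellular_closed_triangulates by blast
qed

lemma polyset_euler_char: "polyset S \<Longrightarrow> euler_char S = chi S"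
  using polyset_triangulable euler_char_eq_chi by blast

lemma cellular_has_chi_chi: "cellular K A \<Longrightarrow> has_chi A (chi A)"
  by (rule has_chi_chi [OF cellular_has_chi])

lemma polyset_has_chi:
  assumes "polyset S"
  shows "has_chi S (chi S)"
proof -
  obtain K where "triangulates K S" using polyset_triangulable [OF assms] by blast
  then show ?thesis by (intro cellular_has_chi_chi triangulates_cellular)
qed

lemma cellular_closed_polyset: "\<lbrakk>cellular K A; closed A\<rbrakk> \<Longrightarrow> polyset A"
  using cellular_closed_triangulates triangulates_polyset by blast

text \<open>A box with nonempty interior has the union of its proper faces as frontier; a degenerate
  box is its own frontier.\<close>

lemma polyset_frontier_cbox: "polyset (frontier (cbox a b))"
proof (cases "interior (cbox a b) = {}")
  case True
  then show ?thesis by (simp add: frontier_def polyset_polytope polytope_interval)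
next
  case False
  then have "frontier (cbox a b) = \<Union>{F. F face_of cbox a b \<and> F \<noteq> cbox a b}"
    using rel_frontier_of_polyhedron_alt [OF polytope_imp_polyhedron [OF polytope_interval]]
      rel_frontier_nonempty_interior by metis
  moreover have "finite {F. F face_of cbox a b \<and> F \<noteq> cbox a b}"
    using finite_polytope_faces [OF polytope_interval]
    by (rule rev_finite_subset) auto
  ultimately show ?thesis
    unfolding polyset_def
    by (intro exI [of _ "{F. F face_of cbox a b \<and> F \<noteq> cbox a b}"])
      (auto intro: face_of_polytope_polytope [OF polytope_interval])
qed

lemma polyset_times: "\<lbrakk>polyset S; polytope P\<rbrakk> \<Longrightarrow> polyset (S \<times> P)"
  unfolding polyset_def
proof (elim exE conjE)
  fix Q assume "polytope P" "finite Q" "\<forall>P\<in>Q. polytope P" "S = \<Union>Q"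
  then show "\<exists>Q. finite Q \<and> (\<forall>P\<in>Q. polytope P) \<and> S \<times> P = \<Union>Q"
    by (intro exI [of _ "(\<lambda>A. A \<times> P) ` Q"]) (auto intro: polytope_Times)
qed

section \<open>Piecewise linear maps\<close>

text \<open>Each polytope of \<open>A\<close> is cut along the simplices on which \<open>f\<close>
  is affine; affine images of polytopes are polytopes.\<close>

lemma pl_on_polyset:
  assumes "pl_on S f" "polyset A" "A \<subseteq> S"
  shows "polyset (f ` A)"
proof -
  obtain K where K: "triangulates K S" "\<forall>\<sigma>\<in>K. \<exists>L b. linear L \<and> (\<forall>x\<in>\<sigma>. f x = L x + b)"
    using assms(1) by (auto simp: pl_on_def)
  obtain Q where Q: "finite Q" "\<forall>P\<in>Q. polytope P" "A = \<Union>Q"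
    using assms(2) by (auto simp: polyset_def)
  have sc: "simplicial_complex K" "finite K" "\<Union>K = S"
    using K(1) by (auto simp: triangulates_def simplicial_complex_def)
  have "polytope (f ` (P \<inter> \<sigma>))" if "P \<in> Q" "\<sigma> \<in> K" for P \<sigma>
  proof -
    obtain L b where L: "linear L" "\<forall>x\<in>\<sigma>. f x = L x + b" using K(2) \<open>\<sigma> \<in> K\<close> by blast
    have "f ` (P \<inter> \<sigma>) = (+) b ` L ` (P \<inter> \<sigma>)"
      using L(2) by (force simp: add.commute image_iff)
    moreover have "polytope (P \<inter> \<sigma>)"
      using Q(2) that simplicial_complex_polytope [OF sc(1)] polytope_Int by blast
    ultimately show ?thesis
      using polytope_linear_image [OF L(1)] polytope_translation_eq by metis
  qed
  moreover have "f ` A = (\<Union>(P,\<sigma>)\<in>Q \<times> K. f ` (P \<inter> \<sigma>))"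
    using Q(3) sc(3) assms(3) by blast
  ultimately show ?thesis
    unfolding polyset_def using Q(1) sc(2)
    by (intro exI [of _ "(\<lambda>(P,\<sigma>). f ` (P \<inter> \<sigma>)) ` (Q \<times> K)"]) auto
qed

lemma pl_on_continuous:
  assumes "pl_on S f"
  shows "continuous_on S f"
proof -
  obtain K where K: "triangulates K S" "\<forall>\<sigma>\<in>K. \<exists>L b. linear L \<and> (\<forall>x\<in>\<sigma>. f x = L x + b)"
    using assms(1) by (auto simp: pl_on_def)
  have sc: "simplicial_complex K" "finite K" "\<Union>K = S"
    using K(1) by (auto simp: triangulates_def simplicial_complex_def)
  have "continuous_on \<sigma> f" if "\<sigma> \<in> K" for \<sigma>
  proof -
    obtain L b where L: "linear L" "\<forall>x\<in>\<sigma>. f x = L x + b" using K(2) \<open>\<sigma> \<in> K\<close> by blast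
    then have "continuous_on \<sigma> (\<lambda>x. L x + b)"
      by (intro continuous_intros linear_continuous_on) (simp add: linear_linear)
    then show ?thesis using L(2) continuous_on_cong by fastforce
  qed
  moreover have "closed \<sigma>" if "\<sigma> \<in> K" for \<sigma>
    using simplicial_complex_polytope [OF sc(1) that] polytope_imp_closed by auto
  ultimately have "continuous_on (\<Union>\<sigma>\<in>K. \<sigma>) f"
    using continuous_on_closed_Union [of K "\<lambda>x. x" f] sc(2) by blast
  then show ?thesis using sc(3) by simp
qed

text \<open>Induction on the derivation for \<open>A\<close>. Its convex sets may leave
  \<open>C\<close>, outside which nothing is known about \<open>f\<close>, so every function in the
  derivation is multiplied by the indicator of \<open>C\<close> before it is transported. Uniqueness
  identifies the resulting value with \<open>n\<close>.\<close>

lemma affine_image_has_chi: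
  fixes f :: "'a::euclidean_space \<Rightarrow> 'b::euclidean_space"
  assumes "compact C" "convex C" "linear L" "\<forall>x\<in>C. f x = L x + b" "inj_on f C"
    and "has_chi A n" "A \<subseteq> C"
  shows "has_chi (f ` A) n"
proof -
  \<comment> \<open>Transport of integer functions along \<open>f\<close>, extended by 0 off the
    image of \<open>C\<close>. It is compatible with differences and sends indicators of subsets of
    \<open>C\<close> to indicators of their images.\<close>
  define push where "push g y = (if y \<in> f ` C then g (inv_into C f y) else 0 :: int)" for g y
  have push_indicator: "push (indicator D) = indicator (f ` D)" if "D \<subseteq> C" for D
  proof
    fix y
    show "push (indicator D) y = indicator (f ` D) y"
    proof (cases "y \<in> f ` C")
      case True
      then obtain x where x: "x \<in> C" "y = f x" by blast
      then have "y \<in> f ` D \<longleftrightarrow> x \<in> D"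
        using inj_on_image_mem_iff [OF assms(5) x(1) that] by simp
      then show ?thesis using x assms(5) True by (simp add: push_def indicator_def)
    next
      case False
      then have "y \<notin> f ` D" using that by blast
      then show ?thesis using False by (simp add: push_def)
    qed
  qed
  have "\<exists>m. has_euler (\<lambda>x. g x * indicator C x) m \<and> has_euler (push (\<lambda>x. g x * indicator C x)) m"
    if "has_euler g k" for g k
    using that
  proof induction
    case zero
    have "push (\<lambda>x. 0) = (\<lambda>y::'b. 0)" by (auto simp: push_def fun_eq_iff)
    moreover have "has_euler (\<lambda>y::'b. 0) 0" "has_euler (\<lambda>y::'a. 0) 0" by (rule has_euler.zero)+
    ultimately show ?case by auto
  next
    case (convex D)
    have DC: "indicator (D \<inter> C) = (\<lambda>x. indicator D x * indicator C x :: int)"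
      by (auto simp: indicator_def fun_eq_iff)
    have image: "f ` (D \<inter> C) = (+) b ` L ` (D \<inter> C)"
      using assms(4) by (force simp: add.commute image_iff)
    have cc: "compact (D \<inter> C)" "convex (D \<inter> C)"
      using convex assms by (auto intro: compact_Int convex_Int)
    then have "compact (f ` (D \<inter> C))" "convex (f ` (D \<inter> C))"
      unfolding image using assms(3)
      by (simp_all add: compact_translation compact_continuous_image linear_continuous_on convex_translation
          convex_linear_image linear_linear)
    then have "has_chi (D \<inter> C) 1 \<and> has_chi (f ` (D \<inter> C)) 1" if "D \<inter> C \<noteq> {}"
      using cc that by (intro conjI has_chi_convex) auto
    moreover have "has_chi (D \<inter> C) 0 \<and> has_chi (f ` (D \<inter> C)) 0" if "D \<inter> C = {}"
      using that has_chi_empty by (metis image_empty)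
    ultimately have "\<exists>m. has_chi (D \<inter> C) m \<and> has_chi (f ` (D \<inter> C)) m" by meson
    then show ?case
      using push_indicator [of "D \<inter> C"] by (simp add: has_chi_def DC)
  next
    case (diff f' m' g' n')
    then obtain m1 m2 where m12:
      "has_euler (\<lambda>x. f' x * indicator C x) m1" "has_euler (push (\<lambda>x. f' x * indicator C x)) m1"
      "has_euler (\<lambda>x. g' x * indicator C x) m2" "has_euler (push (\<lambda>x. g' x * indicator C x)) m2"
      by blast
    have "push (\<lambda>x. (f' x - g' x) * indicator C x) =
        (\<lambda>y. push (\<lambda>x. f' x * indicator C x) y - push (\<lambda>x. g' x * indicator C x) y)"
      by (auto simp: push_def left_diff_distrib fun_eq_iff)
    then show ?case
      using has_euler.diff [OF m12(1,3)] has_euler.diff [OF m12(2,4)]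
      by (intro exI [of _ "m1 - m2"]) (simp add: left_diff_distrib)
  qed
  from this [OF assms(6) [unfolded has_chi_def]]
  obtain m where m: "has_euler (\<lambda>x. indicator A x * indicator C x) m"
      "has_euler (push (\<lambda>x. indicator A x * indicator C x)) m"
    by blast
  have "(\<lambda>x. indicator A x * indicator C x) = (indicator A :: 'a \<Rightarrow> int)"
    using assms(7) by (auto simp: indicator_def fun_eq_iff)
  then show ?thesis
    using m push_indicator [OF assms(7)] has_euler_unique assms(6) unfolding has_chi_def by metis
qed

text \<open>\<open>A\<close> is split along the open simplices of a triangulation on which
  \<open>f\<close> is affine. Injectivity keeps the images of the pieces disjoint, so their values
  may be added on both sides.\<close>

lemma pl_embedding_has_chi:
  fixes f :: "'a::euclidean_space \<Rightarrow> 'b::euclidean_space"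
  assumes "pl_embedding S f" "has_chi A n" "A \<subseteq> S"
  shows "has_chi (f ` A) n"
proof -
  obtain K where K: "triangulates K S" "\<forall>\<sigma>\<in>K. \<exists>L b. linear L \<and> (\<forall>x\<in>\<sigma>. f x = L x + b)"
    and inj: "inj_on f S"
    using assms(1) by (auto simp: pl_on_def pl_embedding_def)
  have sc: "simplicial_complex K" "finite K" "\<Union>K = S"
    using K(1) by (auto simp: triangulates_def simplicial_complex_def)
  have sub: "rel_interior \<sigma> \<subseteq> S" if "\<sigma> \<in> K" for \<sigma>
    using that sc(3) rel_interior_subset by blast
  have "\<exists>k. has_chi (A \<inter> rel_interior \<sigma>) k \<and> has_chi (f ` (A \<inter> rel_interior \<sigma>)) k" if "\<sigma> \<in> K" for \<sigma>
  proof -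
    have poly: "polytope \<sigma>" using simplicial_complex_polytope [OF sc(1) that] .
    obtain L b where L: "linear L" "\<forall>x\<in>\<sigma>. f x = L x + b" using K(2) \<open>\<sigma> \<in> K\<close> by blast
    have "\<exists>k. has_chi (rel_interior \<sigma>) k"
    proof (cases "\<sigma> = {}")
      case True
      then show ?thesis using has_chi_empty by (metis rel_interior_empty)
    next
      case False
      then show ?thesis
        using has_chi_rel_interior_simplex sc(1) that unfolding simplicial_complex_def by blast
    qed
    then obtain k where k: "has_chi (A \<inter> rel_interior \<sigma>) k"
      using has_chi_Int [OF assms(2)] by blast
    have "inj_on f \<sigma>" using inj sc(3) that inj_on_subset by blast
    then have "has_chi (f ` (A \<inter> rel_interior \<sigma>)) k"
      using affine_image_has_chi [OF polytope_imp_compact polytope_imp_convex L] poly k rel_interior_subset by blast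
    then show ?thesis using k by blast
  qed
  then obtain k where k: "\<And>\<sigma>. \<sigma> \<in> K \<Longrightarrow> has_chi (A \<inter> rel_interior \<sigma>) (k \<sigma>)"
      "\<And>\<sigma>. \<sigma> \<in> K \<Longrightarrow> has_chi (f ` (A \<inter> rel_interior \<sigma>)) (k \<sigma>)"
    by metis
  have "disjoint_family_on (\<lambda>\<sigma>. A \<inter> rel_interior \<sigma>) K"
    unfolding disjoint_family_on_def using simplicial_complex_rel_interior_unique [OF sc(1)] by fast
  moreover then have "disjoint_family_on (\<lambda>\<sigma>. f ` (A \<inter> rel_interior \<sigma>)) K"
    unfolding disjoint_family_on_def using inj_on_image_Int [OF inj] sub by (metis image_empty inf.coboundedI2)
  ultimately have "has_chi (\<Union>\<sigma>\<in>K. A \<inter> rel_interior \<sigma>) (sum k K)"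
      "has_chi (\<Union>\<sigma>\<in>K. f ` (A \<inter> rel_interior \<sigma>)) (sum k K)"
    by - (rule has_chi_UN_disjoint [OF sc(2)]; (assumption | rule k, assumption))+
  moreover have "(\<Union>\<sigma>\<in>K. A \<inter> rel_interior \<sigma>) = A"
    using simplicial_complex_rel_interior_cover [OF sc(1)] sc(3) assms(3) by blast
  moreover then have "(\<Union>\<sigma>\<in>K. f ` (A \<inter> rel_interior \<sigma>)) = f ` A"
    by (metis image_UN)
  ultimately have "has_chi A (sum k K)" "has_chi (f ` A) (sum k K)" by simp_all
  moreover then have "sum k K = n" using assms(2) chi_unique by metis
  ultimately show ?thesis by simp
qed

section \<open>Boxes\<close>

text \<open>\<open>J\<close> lists the directions in which the box is open, \<open>L\<close> those
  pinned to an end. Opening one more direction removes two disjoint end slices with the same value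
  \<open>e\<close>, which changes \<open>e\<close> into \<open>e - 2 * e = - e\<close>.\<close>

lemma has_chi_partial_box:
  fixes v :: "'n::finite \<Rightarrow> real"
  assumes "J \<inter> L = {}" "\<forall>k\<in>L. v k \<in> {-1, 1}"
  shows "has_chi {x::real^'n. x \<in> cbox (- 1) 1 \<and> (\<forall>j\<in>J. -1 < x $ j \<and> x $ j < 1) \<and> (\<forall>k\<in>L. x $ k = v k)}
    ((- 1) ^ card J)"
proof -
  define A where "A J L v = {x::real^'n. x \<in> cbox (- 1) 1 \<and> (\<forall>j\<in>J. -1 < x $ j \<and> x $ j < 1) \<and> (\<forall>k\<in>L. x $ k = v k)}"
    for J L v
  have "finite J" by simp
  then have "has_chi (A J L v) ((- 1) ^ card J)" using assms
  proof (induction J arbitrary: L v rule: finite_induct)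
    case empty
    \<comment> \<open>Pinned coordinates become intervals with equal ends, so the base case is again
      a closed box.\<close>
    define a b :: "real^'n" where "a = (\<chi> i. if i \<in> L then v i else -1)" and "b = (\<chi> i. if i \<in> L then v i else 1)"
    have "A {} L v = cbox a b"
    proof (intro set_eqI iffI)
      fix x assume "x \<in> A {} L v"
      then show "x \<in> cbox a b" by (auto simp: A_def mem_box_cart a_def b_def)
    next
      fix x assume "x \<in> cbox a b"
      then have x: "a $ i \<le> x $ i \<and> x $ i \<le> b $ i" for i by (auto simp: mem_box_cart)
      have "x $ i = v i" if "i \<in> L" for i using x [of i] that by (simp add: a_def b_def)
      moreover have "-1 \<le> x $ i \<and> x $ i \<le> 1" for i
        using x [of i] empty.prems(2) by (cases "i \<in> L") (auto simp: a_def b_def)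
      ultimately show "x \<in> A {} L v" by (auto simp: A_def mem_box_cart)
    qed
    moreover have "a \<in> cbox a b" by (auto simp: mem_box_cart a_def b_def)
    ultimately show ?case using has_chi_convex [of "cbox a b"] by (auto simp: compact_cbox convex_box)
  next
    case (insert j J)
    define B where "B r = A J (insert j L) (v(j := r))" for r
    have j: "j \<notin> L" using insert.prems by auto
    have IH0: "has_chi (A J L v) ((- 1) ^ card J)"
      by (rule insert.IH) (use insert.prems in auto)
    have IH1: "has_chi (B r) ((- 1) ^ card J)" if "r = -1 \<or> r = 1" for r
      unfolding B_def by (rule insert.IH) (use insert.prems insert.hyps that in auto)
    have mem: "x \<in> B r \<longleftrightarrow> x \<in> A J L v \<and> x $ j = r" for x r
      using j by (auto simp: B_def A_def)
    have "has_chi (B (-1) \<union> B 1) ((- 1) ^ card J + (- 1) ^ card J)"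
      by (rule has_chi_Un) (use IH1 mem in auto)
    then have "has_chi (A J L v - (B (-1) \<union> B 1)) ((- 1) ^ card J - ((- 1) ^ card J + (- 1) ^ card J))"
      by (rule has_chi_Diff [OF IH0]) (use mem in auto)
    moreover have "A (insert j J) L v = A J L v - (B (-1) \<union> B 1)"
      using mem by (auto simp: A_def mem_box_cart order_less_le)
    moreover have "(- 1) ^ card J - ((- 1) ^ card J + (- 1) ^ card J) = (- 1 :: int) ^ card (insert j J)"
      using insert.hyps by simp
    ultimately show ?case by metis
  qed
  then show ?thesis by (simp only: A_def)
qed

lemma has_chi_open_box: "has_chi (box (- 1) 1 :: (real^'n) set) ((- 1) ^ CARD('n::finite))"
proof -
  have "{x::real^'n. x \<in> cbox (- 1) 1 \<and> (\<forall>j\<in>UNIV. -1 < x $ j \<and> x $ j < 1) \<and> (\<forall>k\<in>{}. x $ k = 0)} = box (- 1) 1"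
    by (auto simp: mem_box_cart less_imp_le)
  then show ?thesis using has_chi_partial_box [of "UNIV :: 'n set" "{}" "\<lambda>k. 0"] by simp
qed

lemma has_chi_frontier_box:
  "has_chi (frontier (cbox (- 1) 1) :: (real^'n) set) (1 - (- 1) ^ CARD('n::finite))"
proof -
  have "0 \<in> (cbox (- 1) 1 :: (real^'n) set)" by (simp add: mem_box_cart)
  then have "has_chi (cbox (- 1) 1 :: (real^'n) set) 1"
    by (intro has_chi_convex) (auto simp: compact_cbox convex_box)
  moreover have "frontier (cbox (- 1) 1) = (cbox (- 1) 1 :: (real^'n) set) - box (- 1) 1"
    by (rule frontier_cbox)
  ultimately show ?thesis
    using has_chi_Diff has_chi_open_box box_subset_cbox by metis
qed

lemma has_chi_D2: "has_chi D2 1"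
proof -
  have "0 \<in> D2" by (simp add: mem_box_cart)
  then show ?thesis by (intro has_chi_convex) (auto simp: compact_cbox convex_box)
qed

lemma has_chi_bdD2: "has_chi bdD2 0"
  using has_chi_frontier_box [where 'n=2] by simp

lemma has_chi_S2: "has_chi S2 2"
  using has_chi_frontier_box [where 'n=3] by simp

section \<open>Colorings as locally constant functions\<close>

lemma closure_Union_finite: "finite \<A> \<Longrightarrow> closure (\<Union>\<A>) = \<Union>(closure ` \<A>)"
  by (induction \<A> rule: finite_induct) (auto simp: closure_Un)

text \<open>Neighbourhoods are taken open in the ambient space and not in \<open>X\<close>, so that
  they can be reused after the surface around them has changed.\<close>

definition loc_const :: "'a::topological_space set \<Rightarrow> ('a \<Rightarrow> 'b) \<Rightarrow> bool" where
  "loc_const X \<phi> \<longleftrightarrow> (\<forall>x\<in>X. \<exists>W. open W \<and> x \<in> W \<and> (\<forall>y\<in>W \<inter> X. \<phi> y = \<phi> x))"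

lemma loc_const_connected:
  assumes "loc_const X \<phi>" "connected C" "C \<subseteq> X" "x \<in> C" "y \<in> C"
  shows "\<phi> x = \<phi> y"
proof -
  have "\<phi> constant_on C"
  proof (rule locally_constant_imp_constant [OF assms(2)])
    fix a assume "a \<in> C"
    then obtain W where W: "open W" "a \<in> W" "\<forall>y\<in>W \<inter> X. \<phi> y = \<phi> a"
      using assms(1,3) unfolding loc_const_def by blast
    then show "\<exists>T. openin (top_of_set C) T \<and> a \<in> T \<and> (\<forall>x\<in>T. \<phi> x = \<phi> a)"
      using \<open>a \<in> C\<close> assms(3) by (intro exI [of _ "C \<inter> W"]) (auto intro: openin_open_Int)
  qed
  then show ?thesis using assms(4,5) by (auto simp: constant_on_def)
qed

definition region :: "seamed_surface \<Rightarrow> (real^3) set" where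
  "region F = surf F - \<Union>(seams F)"

text \<open>The filter \<open>\<F>\<close> describes one side of \<open>s\<close> in \<open>S\<close>: it is carried by arbitrarily thin
  connected sets next to \<open>s\<close>, and these accumulate at every point of \<open>s\<close>.\<close>

definition side :: "'a::topological_space set \<Rightarrow> 'a set \<Rightarrow> 'a filter \<Rightarrow> bool" where
  "side S s \<F> \<longleftrightarrow>
     (\<forall>W. open W \<and> s \<subseteq> W \<longrightarrow> (\<exists>C. connected C \<and> C \<subseteq> W \<inter> S - s \<and> (\<forall>\<^sub>F x in \<F>. x \<in> C))) \<and>
     (\<forall>A. (\<forall>\<^sub>F x in \<F>. x \<in> A) \<longrightarrow> s \<subseteq> closure A)"

lemma side_not_bot: "\<lbrakk>side S s \<F>; s \<noteq> {}\<rbrakk> \<Longrightarrow> \<F> \<noteq> bot"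
  unfolding side_def by (metis closure_empty eventually_bot subset_empty)

text \<open>A side depends only on the surface near \<open>s\<close>. This carries the seams away
  from the neck over to the cut surface.\<close>

lemma side_cong:
  assumes "side S s \<F>" "open V" "s \<subseteq> V" "S \<inter> V \<subseteq> S'"
  shows "side S' s \<F>"
  unfolding side_def
proof (intro conjI allI impI)
  fix W assume "open W \<and> s \<subseteq> W"
  then have "open (W \<inter> V) \<and> s \<subseteq> W \<inter> V" using assms by auto
  then obtain C where "connected C" "C \<subseteq> (W \<inter> V) \<inter> S - s" "\<forall>\<^sub>F x in \<F>. x \<in> C"
    using assms(1) unfolding side_def by meson
  then show "\<exists>C. connected C \<and> C \<subseteq> W \<inter> S' - s \<and> (\<forall>\<^sub>F x in \<F>. x \<in> C)"
    using assms(4) by (intro exI [of _ C]) auto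
qed (use assms(1) in \<open>simp add: side_def\<close>)

text \<open>What the evaluation needs, without charts and collars. The modified surfaces are only
  shown to be tame, which spares building charts across the rims of the caps or a collar outside a
  new seam. For \<open>F\<close> itself the charts enter separately through
  \<open>surface\<close>.\<close>

definition tame :: "seamed_surface \<Rightarrow> bool" where
  "tame F \<longleftrightarrow> polyset (surf F) \<and> finite (seams F) \<and> pairwise disjnt (seams F) \<and>
     (\<forall>s\<in>seams F. s \<subseteq> surf F \<and> polyset s \<and> s \<noteq> {} \<and> has_chi s 0 \<and>
        side (surf F) s (fst (coor F s)) \<and> side (surf F) s (snd (coor F s))) \<and>
     finite (dots F) \<and> dots F \<subseteq> region F"

definition germ_color :: "('a \<Rightarrow> 'b) \<Rightarrow> 'a filter \<Rightarrow> 'b" where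
  "germ_color \<phi> \<F> = (THE i. \<forall>\<^sub>F x in \<F>. \<phi> x = i)"

lemma germ_color_eq:
  assumes "\<F> \<noteq> bot" "\<forall>\<^sub>F x in \<F>. \<phi> x = i"
  shows "germ_color \<phi> \<F> = i"
  unfolding germ_color_def
proof (rule the_equality [where P = "\<lambda>i. \<forall>\<^sub>F x in \<F>. \<phi> x = i", OF assms(2)])
  fix j assume "\<forall>\<^sub>F x in \<F>. \<phi> x = j"
  with assms(2) have "\<forall>\<^sub>F x in \<F>. j = i" by eventually_elim simp
  then show "j = i" using assms(1) by simp
qed

text \<open>Extensionality makes two colorings equal as soon as they agree on
  \<open>region F\<close>, as the bijections below require.\<close>

definition colorings :: "seamed_surface \<Rightarrow> (real^3 \<Rightarrow> nat) set" where
  "colorings F = {\<phi> \<in> region F \<rightarrow>\<^sub>E {1, 2}. loc_const (region F) \<phi> \<and>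
     (\<forall>s\<in>seams F. germ_color \<phi> (fst (coor F s)) \<noteq> germ_color \<phi> (snd (coor F s)))}"

definition alpha :: "nat \<Rightarrow> coeff" where
  "alpha i = (if i = 1 then \<alpha>1 else \<alpha>2)"

definition capped_chi :: "seamed_surface \<Rightarrow> (real^3 \<Rightarrow> nat) \<Rightarrow> int" where
  "capped_chi F \<phi> = chi {x \<in> region F. \<phi> x = 1} + int (card (seams F))"

definition seams_of_color_1 :: "seamed_surface \<Rightarrow> (real^3 \<Rightarrow> nat) \<Rightarrow> int" where
  "seams_of_color_1 F \<phi> = int (card {s \<in> seams F. germ_color \<phi> (fst (coor F s)) = 1})"

definition weight :: "seamed_surface \<Rightarrow> (real^3 \<Rightarrow> nat) \<Rightarrow> coeff" where
  "weight F \<phi> = (- 1) powi (seams_of_color_1 F \<phi> + capped_chi F \<phi> div 2) *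
     ((\<Prod>p\<in>dots F. alpha (\<phi> p)) / (\<alpha>2 - \<alpha>1) powi (chi (surf F) div 2))"

section \<open>Facets and colorings of a fixed tame surface\<close>

context
  fixes F :: seamed_surface
  assumes tame: "tame F"
begin

lemma tame_seam:
  assumes "s \<in> seams F"
  shows "s \<subseteq> surf F" "polyset s" "s \<noteq> {}" "has_chi s 0"
    "side (surf F) s (fst (coor F s))" "side (surf F) s (snd (coor F s))"
    "fst (coor F s) \<noteq> bot" "snd (coor F s) \<noteq> bot"
  using tame assms side_not_bot unfolding tame_def by blast+

lemma tame_finite: "finite (seams F)" "finite (dots F)"
  using tame unfolding tame_def by blast+

lemma tame_closed:
  shows "closed (surf F)" and "A \<subseteq> seams F \<Longrightarrow> closed (\<Union>A)"
proof -
  show "closed (surf F)" using tame by (simp add: tame_def polyset_compact compact_imp_closed)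
  show "closed (\<Union>A)" if "A \<subseteq> seams F"
    using that tame_finite(1) tame_seam(2)
    by (intro closed_Union) (auto simp: polyset_compact compact_imp_closed intro: finite_subset)
qed

lemma tame_complex: obtains K where "simplicial_complex K" "cellular K (region F)" "cellular K (\<Union>(seams F))"
proof -
  have "finite (insert (surf F) (seams F))" using tame by (simp add: tame_def)
  moreover have "polyset A" if "A \<in> insert (surf F) (seams F)" for A
    using that tame by (auto simp: tame_def)
  ultimately have "\<exists>K. simplicial_complex K \<and> (\<forall>A\<in>insert (surf F) (seams F). cellular K A)"
    by (rule polysets_common_refinement)
  then obtain K where K: "simplicial_complex K" "\<forall>A\<in>insert (surf F) (seams F). cellular K A" by blast
  then have "cellular K (\<Union>(seams F))" by (intro cellular_Union) auto
  with K that show thesis unfolding region_def by (simp add: cellular_Diff)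
qed

lemma facets_eq: "facets F = components (region F)"
  by (simp add: facets_def region_def)

text \<open>Open simplices are connected, so each facet is a union of open simplices of one finite
  complex.\<close>

lemma finite_facets: "finite (facets F)"
proof -
  obtain K where K: "simplicial_complex K" "cellular K (region F)" by (rule tame_complex)
  have "f \<in> (\<lambda>L. \<Union>(rel_interior ` L)) ` Pow K" if "f \<in> facets F" for f
  proof -
    have f: "f \<in> components (region F)" using that by (simp add: facets_eq)
    have "\<exists>\<sigma>\<in>K. x \<in> rel_interior \<sigma> \<and> rel_interior \<sigma> \<subseteq> f" if "x \<in> f" for x
    proof -
      have "x \<in> region F" using that in_components_subset [OF f] by blast
      with K(2) obtain \<sigma> where \<sigma>: "\<sigma> \<in> K" "x \<in> rel_interior \<sigma>" "rel_interior \<sigma> \<subseteq> region F"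
        by (rule cellular_obtain)
      have "connected (rel_interior \<sigma>)"
        using simplicial_complex_polytope [OF K(1) \<sigma>(1)]
        by (intro convex_connected convex_rel_interior polytope_imp_convex)
      then have "rel_interior \<sigma> \<subseteq> f"
        using components_maximal [OF f _ \<sigma>(3)] that \<sigma>(2) by blast
      then show ?thesis using \<sigma> by blast
    qed
    then have "f = \<Union>(rel_interior ` {\<sigma> \<in> K. rel_interior \<sigma> \<subseteq> f})" by blast
    then show ?thesis by (intro image_eqI [of _ _ "{\<sigma> \<in> K. rel_interior \<sigma> \<subseteq> f}"]) auto
  qed
  moreover have "finite ((\<lambda>L. \<Union>(rel_interior ` L)) ` Pow K)"
    using K(1) by (simp add: simplicial_complex_def)
  ultimately show ?thesis by (meson finite_subset subsetI)
qed

lemma facet_component: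
  assumes "f \<in> facets F" "x \<in> f"
  shows "connected_component_set (region F) x = f"
  using assms unfolding facets_eq by (metis componentsE connected_component_eq)

lemma facet_subset: "f \<in> facets F \<Longrightarrow> f \<subseteq> region F"
  unfolding facets_eq by (rule in_components_subset)

lemma component_facet: "x \<in> region F \<Longrightarrow> connected_component_set (region F) x \<in> facets F"
  unfolding facets_eq by (rule componentsI)

text \<open>The remaining facets are finitely many relatively closed sets.\<close>

lemma facet_open:
  assumes "f \<in> facets F" "x \<in> f"
  shows "\<exists>W. open W \<and> x \<in> W \<and> W \<inter> region F \<subseteq> f"
proof -
  have "closedin (top_of_set (region F)) (\<Union>(facets F - {f}))"
    using finite_facets by (intro closedin_Union) (auto simp: facets_eq closedin_component)
  then obtain T where T: "closed T" "\<Union>(facets F - {f}) = region F \<inter> T"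
    by (auto simp: closedin_closed)
  have "x \<notin> \<Union>(facets F - {f})"
    using assms components_nonoverlap [of _ "region F" f] unfolding facets_eq by blast
  moreover have "region F = \<Union>(facets F)" unfolding facets_eq by simp
  ultimately show ?thesis using T assms by (intro exI [of _ "- T"]) auto
qed

text \<open>Near \<open>s\<close> and away from the other seams, a side is carried by a connected
  subset of \<open>region F\<close>, hence by a single component. This gives meaning to the
  descriptions in \<open>facet_out\<close> and \<open>facet_into\<close>.\<close>

lemma side_facet:
  assumes "s \<in> seams F" "side (surf F) s \<F>"
  shows "\<exists>!f. f \<in> facets F \<and> (\<forall>\<^sub>F x in \<F>. x \<in> f)"
proof -
  have nb: "\<F> \<noteq> bot" using side_not_bot [OF assms(2)] tame_seam(3) [OF assms(1)] .
  define W where "W = - \<Union>(seams F - {s})"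
  have "open W" unfolding W_def by (intro open_Compl tame_closed) auto
  moreover have "s \<subseteq> W"
    using assms(1) tame unfolding W_def tame_def pairwise_def disjnt_def by blast
  ultimately obtain C where C: "connected C" "C \<subseteq> W \<inter> surf F - s" "\<forall>\<^sub>F x in \<F>. x \<in> C"
    using assms(2) unfolding side_def by blast
  have sub: "C \<subseteq> region F" using C(2) by (auto simp: W_def region_def)
  have "C \<noteq> {}" using C(3) nb by auto
  then have "region F \<noteq> {}" using sub by auto
  then obtain f where f: "f \<in> facets F" "C \<subseteq> f"
    using exists_component_superset [OF sub _ C(1)] unfolding facets_eq by blast
  have ev: "\<forall>\<^sub>F x in \<F>. x \<in> f" using C(3) by (rule eventually_mono) (use f in auto)
  show ?thesis
  proof (rule ex1I [of _ f])
    fix g assume g: "g \<in> facets F \<and> (\<forall>\<^sub>F x in \<F>. x \<in> g)"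
    then have fg: "\<forall>\<^sub>F x in \<F>. x \<in> f \<inter> g" using ev by (auto intro: eventually_conj)
    have "f \<inter> g \<noteq> {}"
    proof
      assume "f \<inter> g = {}"
      with fg have "\<forall>\<^sub>F x in \<F>. False" by (simp only: empty_iff)
      then show False using nb by simp
    qed
    then show "g = f" using g f(1) components_eq unfolding facets_eq by blast
  qed (use f(1) ev in simp)
qed

lemma facet_out:
  assumes "s \<in> seams F"
  shows "facet_out F s \<in> facets F" "\<forall>\<^sub>F x in fst (coor F s). x \<in> facet_out F s"
  using theI' [OF side_facet [OF assms tame_seam(5) [OF assms]]] unfolding facet_out_def by auto

lemma facet_into:
  assumes "s \<in> seams F"
  shows "facet_into F s \<in> facets F" "\<forall>\<^sub>F x in snd (coor F s). x \<in> facet_into F s"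
  using theI' [OF side_facet [OF assms tame_seam(6) [OF assms]]] unfolding facet_into_def by auto

lemma loc_const_germ_color:
  assumes "loc_const (region F) \<phi>" "s \<in> seams F" "side (surf F) s \<F>"
  shows "\<forall>\<^sub>F x in \<F>. x \<in> region F \<and> \<phi> x = germ_color \<phi> \<F>"
    and "germ_color \<phi> \<F> \<in> \<phi> ` region F"
proof -
  have nb: "\<F> \<noteq> bot" using side_not_bot [OF assms(3)] tame_seam(3) [OF assms(2)] .
  obtain f where f: "f \<in> facets F" "\<forall>\<^sub>F x in \<F>. x \<in> f" using side_facet [OF assms(2,3)] by blast
  then obtain a where a: "a \<in> f" using nb by (metis eventually_False eventually_mono)
  have "connected f" using f(1) in_components_connected unfolding facets_eq by blast
  then have "\<phi> x = \<phi> a" if "x \<in> f" for x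
    using loc_const_connected [OF assms(1)] facet_subset [OF f(1)] that a by blast
  then have ev: "\<forall>\<^sub>F x in \<F>. x \<in> region F \<and> \<phi> x = \<phi> a"
    using f(2) facet_subset [OF f(1)] by (auto elim: eventually_mono)
  then have "germ_color \<phi> \<F> = \<phi> a" by (intro germ_color_eq [OF nb]) (auto elim: eventually_mono)
  then show "\<forall>\<^sub>F x in \<F>. x \<in> region F \<and> \<phi> x = germ_color \<phi> \<F>" "germ_color \<phi> \<F> \<in> \<phi> ` region F"
    using ev a facet_subset [OF f(1)] by auto
qed

definition spread :: "((real^3) set \<Rightarrow> nat) \<Rightarrow> real^3 \<Rightarrow> nat" where
  "spread c = (\<lambda>x\<in>region F. c (connected_component_set (region F) x))"

lemma spread_facet: "\<lbrakk>f \<in> facets F; x \<in> f\<rbrakk> \<Longrightarrow> spread c x = c f"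
  using facet_subset facet_component by (auto simp: spread_def)

lemma loc_const_spread: "loc_const (region F) (spread c)"
  unfolding loc_const_def
proof
  fix x assume x: "x \<in> region F"
  define f where "f = connected_component_set (region F) x"
  have f: "f \<in> facets F" "x \<in> f" using x component_facet by (auto simp: f_def)
  then obtain W where W: "open W" "x \<in> W" "W \<inter> region F \<subseteq> f" using facet_open by blast
  have "spread c y = spread c x" if "y \<in> W \<inter> region F" for y
    using spread_facet [OF f(1), of y] spread_facet [OF f] W(3) that by auto
  then show "\<exists>W. open W \<and> x \<in> W \<and> (\<forall>y\<in>W \<inter> region F. spread c y = spread c x)"
    using W by blast
qed

lemma spread_germ_color:
  assumes "s \<in> seams F"
  shows "germ_color (spread c) (fst (coor F s)) = c (facet_out F s)"
    "germ_color (spread c) (snd (coor F s)) = c (facet_into F s)"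
  using facet_out [OF assms] facet_into [OF assms] spread_facet
  by (auto intro!: germ_color_eq tame_seam [OF assms] elim: eventually_mono)

lemma spread_colorings:
  assumes "c \<in> adm F"
  shows "spread c \<in> colorings F"
proof -
  have "c \<in> facets F \<rightarrow>\<^sub>E {1, 2}" using assms by (simp add: adm_def)
  then have "spread c \<in> region F \<rightarrow>\<^sub>E {1, 2}"
    using component_facet by (fastforce simp: spread_def PiE_iff)
  moreover have "\<forall>s\<in>seams F. c (facet_out F s) \<noteq> c (facet_into F s)" using assms by (simp add: adm_def)
  ultimately show ?thesis
    using loc_const_spread by (simp add: colorings_def spread_germ_color)
qed

lemma bij_betw_spread: "bij_betw spread (adm F) (colorings F)"
proof (rule bij_betw_imageI)
  show "inj_on spread (adm F)"
  proof (rule inj_onI)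
    fix c d assume cd: "c \<in> adm F" "d \<in> adm F" "spread c = spread d"
    show "c = d"
    proof (rule PiE_ext)
      show "c \<in> facets F \<rightarrow>\<^sub>E {1, 2}" "d \<in> facets F \<rightarrow>\<^sub>E {1, 2}" using cd by (simp_all add: adm_def)
      fix f assume f: "f \<in> facets F"
      then obtain x where "x \<in> f" using in_components_nonempty unfolding facets_eq by blast
      then show "c f = d f" using spread_facet [OF f] cd(3) by metis
    qed
  qed
  have "\<phi> \<in> spread ` adm F" if \<phi>: "\<phi> \<in> colorings F" for \<phi>
  proof -
    \<comment> \<open>The preimage reads off each color at an arbitrary point of the facet;
      connectedness makes the choice harmless.\<close>
    define c where "c = (\<lambda>f\<in>facets F. \<phi> (SOME x. x \<in> f))"
    have some: "(SOME x. x \<in> f) \<in> f" if "f \<in> facets F" for f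
      using in_components_nonempty that unfolding facets_eq by (metis some_in_eq)
    have lc: "loc_const (region F) \<phi>" and ext: "\<phi> \<in> region F \<rightarrow>\<^sub>E {1, 2}"
      using \<phi> by (simp_all add: colorings_def)
    have spread: "spread c = \<phi>"
    proof
      fix x
      show "spread c x = \<phi> x"
      proof (cases "x \<in> region F")
        case True
        define f where "f = connected_component_set (region F) x"
        have f: "f \<in> facets F" "x \<in> f" using True component_facet by (auto simp: f_def)
        have "spread c x = \<phi> (SOME x. x \<in> f)" using spread_facet [OF f] f(1) by (simp add: c_def)
        also have "\<dots> = \<phi> x"
          by (rule loc_const_connected [OF lc _ facet_subset [OF f(1)] some [OF f(1)] f(2)])
            (use f(1) in_components_connected in \<open>auto simp: facets_eq\<close>)
        finally show ?thesis .
      next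
        case False
        then show ?thesis using ext by (auto simp: spread_def PiE_iff extensional_def)
      qed
    qed
    have "c \<in> facets F \<rightarrow>\<^sub>E {1, 2}"
    proof (rule PiE_I)
      fix f assume f: "f \<in> facets F"
      then have "(SOME x. x \<in> f) \<in> region F" using some facet_subset by blast
      then show "c f \<in> {1, 2}" using ext f by (simp add: c_def PiE_iff)
    qed (simp add: c_def)
    moreover have "c (facet_out F s) \<noteq> c (facet_into F s)" if "s \<in> seams F" for s
    proof -
      have "germ_color \<phi> (fst (coor F s)) \<noteq> germ_color \<phi> (snd (coor F s))"
        using \<phi> that by (simp add: colorings_def)
      then show ?thesis using spread_germ_color [OF that, of c] unfolding spread by metis
    qed
    ultimately have "c \<in> adm F" by (simp add: adm_def)
    then show ?thesis using spread by blast
  qed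
  then show "spread ` adm F = colorings F" using spread_colorings by blast
qed

lemma finite_colorings: "finite (colorings F)"
proof -
  have "adm F \<subseteq> facets F \<rightarrow>\<^sub>E {1, 2}" by (auto simp: adm_def)
  then have "finite (adm F)" using finite_facets by (meson finite.emptyI finite.insertI finite_PiE finite_subset)
  then show ?thesis using bij_betw_finite [OF bij_betw_spread] by blast
qed

section \<open>Euler characteristics of the color classes\<close>

lemma color_class_cellular:
  assumes "loc_const (region F) \<phi>" "cellular K (region F)"
  shows "cellular K {x \<in> region F. \<phi> x = i}"
  unfolding cellular_def
proof (intro conjI ballI)
  show K: "simplicial_complex K" using assms(2) by (simp add: cellular_def)
  show "{x \<in> region F. \<phi> x = i} \<subseteq> \<Union>K" using assms(2) by (auto simp: cellular_def)
  fix \<sigma> assume \<sigma>: "\<sigma> \<in> K"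
  \<comment> \<open>An open simplex inside the region is connected, hence monochromatic.\<close>
  have conn: "connected (rel_interior \<sigma>)"
    using simplicial_complex_polytope [OF K \<sigma>]
    by (intro convex_connected convex_rel_interior polytope_imp_convex)
  consider "rel_interior \<sigma> \<subseteq> region F" | "rel_interior \<sigma> \<inter> region F = {}"
    using assms(2) \<sigma> by (auto simp: cellular_def)
  then show "rel_interior \<sigma> \<subseteq> {x \<in> region F. \<phi> x = i} \<or> rel_interior \<sigma> \<inter> {x \<in> region F. \<phi> x = i} = {}"
  proof cases
    case 1
    then show ?thesis using loc_const_connected [OF assms(1) conn 1] by blast
  qed auto
qed

lemma has_chi_color_class:
  assumes "loc_const (region F) \<phi>"
  shows "has_chi {x \<in> region F. \<phi> x = i} (chi {x \<in> region F. \<phi> x = i})"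
proof -
  obtain K where "cellular K (region F)" by (rule tame_complex)
  then show ?thesis by (intro cellular_has_chi_chi color_class_cellular assms)
qed

lemma has_chi_seams: "has_chi (\<Union>(seams F)) 0"
proof -
  have "disjoint_family_on (\<lambda>s. s) (seams F)"
    using tame unfolding tame_def pairwise_def disjnt_def disjoint_family_on_def by blast
  then have "has_chi (\<Union>s\<in>seams F. s) (\<Sum>s\<in>seams F. 0)"
    by (intro has_chi_UN_disjoint tame_finite tame_seam(4))
  then show ?thesis by simp
qed

text \<open>The sides of a seam carry different colors out of two, so each color occurs on one side
  of every seam and accumulates at all of it. No other points are added, since the points of the
  other color have neighbourhoods free of this one.\<close>

lemma closure_color_class:
  assumes "\<phi> \<in> colorings F" "i \<in> {1, 2}"
  shows "closure {x \<in> region F. \<phi> x = i} = {x \<in> region F. \<phi> x = i} \<union> \<Union>(seams F)"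
proof
  have lc: "loc_const (region F) \<phi>" and two: "\<phi> ` region F \<subseteq> {1, 2}"
    using assms(1) by (auto simp: colorings_def)
  have "s \<subseteq> closure {x \<in> region F. \<phi> x = i}" if s: "s \<in> seams F" for s
  proof -
    have "germ_color \<phi> (fst (coor F s)) \<noteq> germ_color \<phi> (snd (coor F s))"
      using assms(1) s by (simp add: colorings_def)
    moreover have "germ_color \<phi> (fst (coor F s)) \<in> {1, 2}" "germ_color \<phi> (snd (coor F s)) \<in> {1, 2}"
      using loc_const_germ_color(2) [OF lc s tame_seam(5) [OF s]]
        loc_const_germ_color(2) [OF lc s tame_seam(6) [OF s]] two by blast+
    ultimately consider "germ_color \<phi> (fst (coor F s)) = i" | "germ_color \<phi> (snd (coor F s)) = i"
      using assms(2) by auto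
    then show ?thesis
    proof cases
      case 1
      have "\<forall>\<^sub>F x in fst (coor F s). x \<in> {x \<in> region F. \<phi> x = i}"
        using loc_const_germ_color(1) [OF lc s tame_seam(5) [OF s]] 1 by simp
      then show ?thesis using tame_seam(5) [OF s] unfolding side_def by blast
    next
      case 2
      have "\<forall>\<^sub>F x in snd (coor F s). x \<in> {x \<in> region F. \<phi> x = i}"
        using loc_const_germ_color(1) [OF lc s tame_seam(6) [OF s]] 2 by simp
      then show ?thesis using tame_seam(6) [OF s] unfolding side_def by blast
    qed
  qed
  then show "{x \<in> region F. \<phi> x = i} \<union> \<Union>(seams F) \<subseteq> closure {x \<in> region F. \<phi> x = i}"
    using closure_subset [of "{x \<in> region F. \<phi> x = i}"] by blast
  have "closed ({x \<in> region F. \<phi> x = i} \<union> \<Union>(seams F))"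
  proof -
    have "\<forall>x\<in>region F. \<exists>W. open W \<and> x \<in> W \<and> (\<forall>y\<in>W \<inter> region F. \<phi> y = \<phi> x)"
      using lc by (simp add: loc_const_def)
    from bchoice [OF this] obtain W
      where W: "\<forall>x\<in>region F. open (W x) \<and> x \<in> W x \<and> (\<forall>y\<in>W x \<inter> region F. \<phi> y = \<phi> x)" ..
    define V where "V = (\<Union>x\<in>{x \<in> region F. \<phi> x \<noteq> i}. W x) - \<Union>(seams F)"
    have "open V" unfolding V_def using W tame_closed(2) by (intro open_Diff open_UN) auto
    moreover have "closed (surf F)" by (rule tame_closed)
    moreover have "{x \<in> region F. \<phi> x = i} \<union> \<Union>(seams F) = surf F - V"
    proof (intro subset_antisym subsetI)
      fix x assume x: "x \<in> {x \<in> region F. \<phi> x = i} \<union> \<Union>(seams F)"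
      then have "x \<in> surf F" using tame_seam(1) by (auto simp: region_def)
      moreover have "x \<notin> V"
      proof
        assume "x \<in> V"
        then obtain y where "y \<in> region F" "\<phi> y \<noteq> i" "x \<in> W y" "x \<notin> \<Union>(seams F)"
          unfolding V_def by blast
        moreover then have "x \<in> region F" "\<phi> x = i" using x by auto
        ultimately show False using W by (metis IntI)
      qed
      ultimately show "x \<in> surf F - V" by simp
    next
      fix x assume "x \<in> surf F - V"
      then show "x \<in> {x \<in> region F. \<phi> x = i} \<union> \<Union>(seams F)"
        using W unfolding V_def region_def by blast
    qed
    ultimately show ?thesis by (simp add: closed_Diff)
  qed
  then show "closure {x \<in> region F. \<phi> x = i} \<subseteq> {x \<in> region F. \<phi> x = i} \<union> \<Union>(seams F)"
    by (intro closure_minimal) auto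
qed

lemma euler_char_colored_part:
  assumes "c \<in> adm F"
  shows "euler_char (colored_part F c 1) = chi {x \<in> region F. spread c x = 1}"
proof -
  define X where "X = {x \<in> region F. spread c x = 1}"
  have col: "spread c \<in> colorings F" using spread_colorings [OF assms] .
  have "X = \<Union>{f \<in> facets F. c f = 1}"
  proof (intro subset_antisym subsetI)
    fix x assume "x \<in> X"
    then have x: "x \<in> region F" "spread c x = 1" by (auto simp: X_def)
    define f where "f = connected_component_set (region F) x"
    have f: "f \<in> facets F" "x \<in> f" using x component_facet by (auto simp: f_def)
    then show "x \<in> \<Union>{f \<in> facets F. c f = 1}" using spread_facet [OF f, of c] x(2) by auto
  next
    fix x assume "x \<in> \<Union>{f \<in> facets F. c f = 1}"
    then show "x \<in> X" using facet_subset spread_facet by (fastforce simp: X_def)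
  qed
  then have "colored_part F c 1 = closure X"
    unfolding colored_part_def using finite_facets by (simp add: closure_Union_finite)
  also have clX: "closure X = X \<union> \<Union>(seams F)"
    using closure_color_class [OF col, of 1] by (simp add: X_def)
  finally have part: "colored_part F c 1 = X \<union> \<Union>(seams F)" .
  obtain K where K: "cellular K (region F)" "cellular K (\<Union>(seams F))" by (rule tame_complex)
  have "cellular K X" unfolding X_def by (rule color_class_cellular [OF loc_const_spread K(1)])
  then have "cellular K (X \<union> \<Union>(seams F))" using K(2) by (rule cellular_Un)
  moreover have "closed (X \<union> \<Union>(seams F))" using clX by (metis closed_closure)
  ultimately have "euler_char (colored_part F c 1) = chi (X \<union> \<Union>(seams F))"
    unfolding part by (intro polyset_euler_char cellular_closed_polyset)
  also have "has_chi (X \<union> \<Union>(seams F)) (chi X + 0)"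
    using has_chi_color_class [OF loc_const_spread, of c 1] has_chi_seams
    by (intro has_chi_Un) (auto simp: X_def region_def)
  then have "chi (X \<union> \<Union>(seams F)) = chi X" using chi_unique by fastforce
  finally show ?thesis by (simp add: X_def)
qed

lemma num_dots_spread:
  assumes "c \<in> adm F"
  shows "\<alpha>1 ^ num_dots F c 1 * \<alpha>2 ^ num_dots F c 2 = (\<Prod>p\<in>dots F. alpha (spread c p))"
proof -
  have reg: "p \<in> region F" if "p \<in> dots F" for p using tame that by (auto simp: tame_def)
  have eq: "(\<exists>f\<in>facets F. p \<in> f \<and> c f = i) \<longleftrightarrow> spread c p = i" if "p \<in> dots F" for p i
    using component_facet [OF reg [OF that]] spread_facet reg [OF that]
    by (metis connected_component_refl_eq mem_Collect_eq)
  have two: "spread c p \<in> {1, 2}" if "p \<in> dots F" for p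
    using spread_colorings [OF assms] reg [OF that] by (auto simp: colorings_def)
  have n: "num_dots F c i = card {p \<in> dots F. spread c p = i}" for i
    unfolding num_dots_def by (rule arg_cong [where f = card]) (use eq in blast)
  have "dots F = {p \<in> dots F. spread c p = 1} \<union> {p \<in> dots F. spread c p = 2}" using two by auto
  then have "(\<Prod>p\<in>dots F. alpha (spread c p)) =
      (\<Prod>p\<in>{p \<in> dots F. spread c p = 1} \<union> {p \<in> dots F. spread c p = 2}. alpha (spread c p))" by (rule arg_cong)
  also have "\<dots> = (\<Prod>p\<in>{p \<in> dots F. spread c p = 1}. alpha (spread c p)) * (\<Prod>p\<in>{p \<in> dots F. spread c p = 2}. alpha (spread c p))"
    using tame_finite by (intro prod.union_disjoint) auto
  also have "\<dots> = \<alpha>1 ^ num_dots F c 1 * \<alpha>2 ^ num_dots F c 2"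
    by (simp add: n alpha_def)
  finally show ?thesis ..
qed

lemma eval_coloring_eq_weight:
  assumes "c \<in> adm F"
  shows "eval_coloring F c = weight F (spread c)"
proof -
  have "int (num_seams F c 1) = seams_of_color_1 F (spread c)"
    unfolding num_seams_def seams_of_color_1_def seam_color_def
    by (intro arg_cong [where f = "\<lambda>A. int (card A)"]) (auto simp: spread_germ_color)
  moreover have "capped_euler_char F c 1 = capped_chi F (spread c)"
    unfolding capped_euler_char_def capped_chi_def euler_char_colored_part [OF assms] ..
  moreover have "euler_char (surf F) = chi (surf F)"
    using tame by (intro polyset_euler_char) (simp add: tame_def)
  ultimately show ?thesis
    unfolding eval_coloring_def weight_def num_dots_spread [OF assms] by simp
qed

text \<open>The hinge of the proof: evaluations of different surfaces are compared through this sum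
  over point colorings.\<close>

theorem evaluation_eq_sum_weight: "evaluation F = (\<Sum>\<phi>\<in>colorings F. weight F \<phi>)"
  unfolding evaluation_def
  using sum.reindex_bij_betw [OF bij_betw_spread, of "weight F"] eval_coloring_eq_weight by simp

end

section \<open>Sides of a seam\<close>

lemma eventually_germ:
  "eventually P (germ s A) \<longleftrightarrow> (\<exists>W. open W \<and> s \<subseteq> W \<and> (\<forall>x\<in>W \<inter> A. P x))"
proof -
  have "eventually P (germ s A) \<longleftrightarrow>
      (\<exists>W\<in>{W. open W \<and> s \<subseteq> W}. eventually P (principal (W \<inter> A)))"
    unfolding germ_def
  proof (rule eventually_INF_base)
    show "{W. open W \<and> s \<subseteq> W} \<noteq> {}" by (auto intro: exI [of _ UNIV])
    fix V W assume "V \<in> {W. open W \<and> s \<subseteq> W}" "W \<in> {W. open W \<and> s \<subseteq> W}"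
    then show "\<exists>x\<in>{W. open W \<and> s \<subseteq> W}. principal (x \<inter> A) \<le> inf (principal (V \<inter> A)) (principal (W \<inter> A))"
      by (intro bexI [of _ "V \<inter> W"]) auto
  qed
  then show ?thesis by (auto simp: eventually_principal)
qed

text \<open>The tube lemma: the heights at which the collar leaves \<open>W\<close> form a compact
  set not containing 0.\<close>

lemma thin_collar:
  fixes k :: "'b::euclidean_space \<times> real \<Rightarrow> 'a::metric_space"
  assumes "continuous_on (B \<times> {0..1}) k" "compact B" "open W" "k ` (B \<times> {0}) \<subseteq> W"
  obtains \<delta> where "0 < \<delta>" "\<delta> \<le> 1" "k ` (B \<times> {0..\<delta>}) \<subseteq> W"
proof -
  define Z where "Z = (B \<times> {0..1}) \<inter> k -` (- W)"
  have cp: "compact (B \<times> {0..1::real})" using assms(2) by (intro compact_Times) auto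
  have "closed Z" unfolding Z_def
    by (rule continuous_closed_preimage [OF assms(1)]) (use cp assms(3) in \<open>auto intro: compact_imp_closed\<close>)
  then have "compact Z" using cp unfolding Z_def by (metis Int_lower1 compact_Int_closed inf.absorb_iff2 inf_assoc)
  then have "compact (snd ` Z)" by (intro compact_continuous_image continuous_intros)
  then have "open (- snd ` Z)" by (simp add: compact_imp_closed open_Compl)
  moreover have "0 \<in> - snd ` Z" using assms(4) unfolding Z_def image_subset_iff by fastforce
  ultimately obtain e where e: "e > 0" "ball 0 e \<subseteq> - snd ` Z" using open_contains_ball by blast
  show thesis
  proof (rule that [of "min (e / 2) 1"])
    show "k ` (B \<times> {0..min (e / 2) 1}) \<subseteq> W"
    proof clarify
      fix b and t :: real assume bt: "b \<in> B" "t \<in> {0..min (e / 2) 1}"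
      then have "t \<in> ball 0 e" using e(1) by (auto simp: dist_real_def)
      then have "(b, t) \<notin> Z" using e(2) by (metis ComplD image_eqI snd_conv subsetD)
      then show "k (b, t) \<in> W" using bt by (auto simp: Z_def)
    qed
  qed (use e in auto)
qed

text \<open>Asking for disjointness of \<open>s\<close> and \<open>N\<close> in place of an
  embedding also admits the cone parametrization of a disc, whose far end collapses to the
  center.\<close>

lemma half_collar_side:
  fixes k :: "'b::euclidean_space \<times> real \<Rightarrow> 'a::metric_space"
  assumes cont: "continuous_on (B \<times> {0..1}) k" and B: "compact B" "connected B"
    and s: "k ` (B \<times> {0}) = s" and N: "k ` (B \<times> {0<..1}) = N" and "N \<subseteq> S" and disj: "s \<inter> N = {}"
  shows "side S s (germ s N)"
  unfolding side_def
proof (intro conjI allI impI)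
  fix W assume W: "open W \<and> s \<subseteq> W"
  then obtain \<delta> where \<delta>: "0 < \<delta>" "\<delta> \<le> 1" "k ` (B \<times> {0..\<delta>}) \<subseteq> W"
    using thin_collar [OF cont B(1), of W] s by auto
  let ?C = "k ` (B \<times> {0<..\<delta>})"
  have "connected ?C"
  proof (rule connected_continuous_image)
    show "continuous_on (B \<times> {0<..\<delta>}) k" using \<delta> by (intro continuous_on_subset [OF cont]) auto
  qed (use B(2) in \<open>auto intro: connected_Times\<close>)
  moreover have "?C \<subseteq> N" unfolding N [symmetric] using \<delta> by (intro image_mono) auto
  moreover have "?C \<subseteq> W" using \<delta> by auto
  moreover have "\<forall>\<^sub>F x in germ s N. x \<in> ?C"
  proof -
    \<comment> \<open>The thick rest of the half collar is compact and disjoint from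
      \<open>s\<close>, so its complement is a neighbourhood of \<open>s\<close> in which only the
      thin part of \<open>N\<close> remains.\<close>
    let ?K = "k ` (B \<times> {\<delta>..1})"
    have "compact ?K"
    proof (rule compact_continuous_image)
      show "continuous_on (B \<times> {\<delta>..1}) k" using \<delta> by (intro continuous_on_subset [OF cont]) auto
    qed (use B(1) in \<open>auto intro: compact_Times\<close>)
    then have "open (- ?K)" by (simp add: compact_imp_closed open_Compl)
    moreover have "?K \<subseteq> N" unfolding N [symmetric] using \<delta> by (intro image_mono) auto
    then have "s \<subseteq> - ?K" using disj by blast
    moreover have "\<forall>x\<in>- ?K \<inter> N. x \<in> ?C"
    proof
      fix x assume that: "x \<in> - ?K \<inter> N"
      have "x \<in> k ` (B \<times> {0<..1})" using that by (simp add: N)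
      then obtain b t where bt: "b \<in> B" "0 < t" "t \<le> 1" "x = k (b, t)" by auto
      then have "\<not> \<delta> \<le> t" using that by auto
      then show "x \<in> ?C" using bt by auto
    qed
    ultimately show ?thesis unfolding eventually_germ by (intro exI [of _ "- ?K"] conjI)
  qed
  ultimately show "\<exists>C. connected C \<and> C \<subseteq> W \<inter> S - s \<and> (\<forall>\<^sub>F x in germ s N. x \<in> C)"
    using \<open>N \<subseteq> S\<close> disj by (intro exI [of _ ?C]) auto
next
  fix A assume "\<forall>\<^sub>F x in germ s N. x \<in> A"
  then obtain W where W: "open W" "s \<subseteq> W" "W \<inter> N \<subseteq> A" unfolding eventually_germ by blast
  show "s \<subseteq> closure A"
  proof
    fix x assume x: "x \<in> s"
    then obtain b where b: "b \<in> B" "x = k (b, 0)" using s by auto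
    have cont_b: "continuous_on ({b} \<times> {0..1}) k" using b by (intro continuous_on_subset [OF cont]) auto
    have "\<exists>y\<in>A. dist y x < e" if e: "e > 0" for e
    proof -
      obtain \<delta> where \<delta>: "0 < \<delta>" "\<delta> \<le> 1" "k ` ({b} \<times> {0..\<delta>}) \<subseteq> W \<inter> ball x e"
        by (rule thin_collar [OF cont_b, of "W \<inter> ball x e"]) (use W x b e in auto)
      have "(b, \<delta>) \<in> {b} \<times> {0..\<delta>}" using \<delta>(1) by simp
      then have "k (b, \<delta>) \<in> W \<inter> ball x e" using \<delta>(3) by blast
      moreover have "k (b, \<delta>) \<in> N" using b \<delta> N by auto
      ultimately show ?thesis using W(3) by (auto simp: dist_commute)
    qed
    then show "x \<in> closure A" by (simp add: closure_approachable)
  qed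
qed

lemma bdD2_facts: "compact bdD2" "connected bdD2" "bdD2 \<noteq> {}" "bdD2 \<subseteq> D2" "closed bdD2"
proof -
  have int: "(0::real^2) \<in> interior D2" by (simp add: interior_cbox mem_box_cart)
  then have ri: "rel_frontier D2 = bdD2" by (intro rel_frontier_nonempty_interior) auto
  show "compact bdD2" by (simp add: compact_frontier compact_cbox)
  show "closed bdD2" by simp
  have "aff_dim D2 = 2"
    using int by (subst aff_dim_nonempty_interior) (auto simp del: interior_cbox)
  then have "connected (rel_frontier D2)" by (intro connected_sphere_gen) (auto simp: convex_box bounded_cbox)
  then show "connected bdD2" by (simp only: ri)
  show "bdD2 \<subseteq> D2" by (simp add: frontier_subset_closed closed_cbox)
  have "(\<chi> i. 1) \<in> bdD2" by (auto simp: frontier_cbox mem_box_cart)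
  then show "bdD2 \<noteq> {}" by blast
qed

lemma bicollar_side:
  assumes "bicollar S s N P"
  shows "side S s (germ s N)" "side S s (germ s P)"
proof -
  obtain h :: "(real^2) \<times> real \<Rightarrow> real^3" where h: "pl_embedding (bdD2 \<times> {-1..1}) h"
      "h ` (bdD2 \<times> {-1..1}) \<subseteq> S" "h ` (bdD2 \<times> {0}) = s"
      "h ` (bdD2 \<times> {-1..<0}) = N" "h ` (bdD2 \<times> {0<..1}) = P"
    using assms unfolding bicollar_def by blast
  have cont: "continuous_on (bdD2 \<times> {-1..1}) h" and inj: "inj_on h (bdD2 \<times> {-1..1})"
    using h(1) by (auto simp: pl_embedding_def pl_on_continuous)
  have NP: "N \<subseteq> S" "P \<subseteq> S"
    using h(2) unfolding h(4,5) [symmetric] by (auto simp: image_subset_iff)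
  have "s \<inter> N = {}"
    unfolding h(3,4) [symmetric]
    by (subst inj_on_image_Int [OF inj, symmetric]) auto
  have "s \<inter> P = {}"
    unfolding h(3,5) [symmetric]
    by (subst inj_on_image_Int [OF inj, symmetric]) auto
  show "side S s (germ s P)"
    by (rule half_collar_side [of bdD2 h])
      (use h NP \<open>s \<inter> P = {}\<close> bdD2_facts in \<open>auto intro: continuous_on_subset [OF cont]\<close>)
  \<comment> \<open>Reflection of the height reduces the negative half to the case of a positive
    one.\<close>
  define k where "k = h \<circ> (\<lambda>(b, t). (b, - t))"
  have refl: "k ` (bdD2 \<times> T) = h ` (bdD2 \<times> uminus ` T)" for T
    by (force simp: k_def image_iff)
  have "continuous_on (bdD2 \<times> {0..1}) k"
    unfolding k_def case_prod_unfold
    by (intro continuous_on_compose continuous_intros continuous_on_subset [OF cont]) auto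
  moreover have "k ` (bdD2 \<times> {0}) = s" "k ` (bdD2 \<times> {0<..1}) = N"
    unfolding refl h(3,4) [symmetric] by simp_all
  ultimately show "side S s (germ s N)"
    using NP \<open>s \<inter> N = {}\<close> bdD2_facts by (intro half_collar_side [of bdD2 k]) auto
qed

lemma closed_seamed_surface_tame:
  assumes "closed_seamed_surface F"
  shows "tame F"
proof -
  have surf: "polyset (surf F)"
    using assms triangulates_polyset by (auto simp: closed_seamed_surface_def closed_pl_surface_def)
  have seam: "s \<subseteq> surf F \<and> polyset s \<and> s \<noteq> {} \<and> has_chi s 0 \<and>
      side (surf F) s (fst (coor F s)) \<and> side (surf F) s (snd (coor F s))" if s: "s \<in> seams F" for s
  proof -
    obtain N P where NP: "s \<subseteq> surf F" "pl_homeomorphic bdD2 s" "bicollar (surf F) s N P"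
        "coor F s = (germ s N, germ s P)"
    proof -
      have "\<forall>s\<in>seams F. s \<subseteq> surf F \<and> pl_homeomorphic bdD2 s \<and>
          (\<exists>N P. bicollar (surf F) s N P \<and> coor F s = (germ s N, germ s P))"
        using assms unfolding closed_seamed_surface_def by (elim conjE)
      then show thesis using s that by fast
    qed
    obtain f where f: "pl_embedding bdD2 f" "f ` bdD2 = s"
      using NP(2) by (auto simp: pl_homeomorphic_def)
    then have "polyset s" "has_chi s 0" "s \<noteq> {}"
      using pl_on_polyset [OF _ polyset_frontier_cbox order_refl] pl_embedding_has_chi [OF f(1) has_chi_bdD2 order_refl]
        bdD2_facts(3)
      by (auto simp: pl_embedding_def)
    then show ?thesis using NP bicollar_side [OF NP(3)] by simp
  qed
  show ?thesis
    using assms surf seam unfolding tame_def closed_seamed_surface_def region_def by auto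
qed

section \<open>Charts\<close>

text \<open>Replaces the square by the round disc. The homeomorphism theorem for compact convex sets
  says nothing about interiors; invariance of domain, used in both directions, matches interior with
  interior and hence boundary with boundary.\<close>

lemma disc_parametrization:
  fixes g :: "real^2 \<Rightarrow> 'a::t2_space"
  assumes "continuous_on D2 g" "inj_on g D2"
  obtains d :: "complex \<Rightarrow> 'a" where "continuous_on (cball 0 1) d" "inj_on d (cball 0 1)"
    "d ` cball 0 1 = g ` D2" "d ` ball 0 1 = g ` interior D2" "d ` sphere 0 1 = g ` bdD2"
proof -
  have int: "(0::real^2) \<in> interior D2" by (simp add: interior_cbox mem_box_cart)
  have "aff_dim D2 = 2"
    using int by (subst aff_dim_nonempty_interior) (auto simp del: interior_cbox)
  moreover have "aff_dim (cball (0::complex) 1) = 2" by (simp add: aff_dim_cball)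
  ultimately have "cball (0::complex) 1 homeomorphic D2"
    by (intro homeomorphic_convex_compact_sets) (auto simp: convex_box compact_cbox)
  then obtain \<phi> \<psi> where hom: "homeomorphism (cball (0::complex) 1) D2 \<phi> \<psi>"
    by (auto simp: homeomorphic_def)
  have \<phi>: "continuous_on (cball 0 1) \<phi>" "\<phi> ` cball 0 1 = D2" "inj_on \<phi> (cball 0 1)"
    using hom by (auto simp: homeomorphism_def intro: inj_on_inverseI)
  have \<psi>: "continuous_on D2 \<psi>" "\<psi> ` D2 = cball 0 1" "inj_on \<psi> D2"
    using hom by (auto simp: homeomorphism_def intro: inj_on_inverseI)
  have 1: "\<phi> ` ball 0 1 \<subseteq> interior D2"
  proof (rule interior_maximal)
    have sub: "ball (0::complex) 1 \<subseteq> cball 0 1" by auto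
    show "open (\<phi> ` ball 0 1)"
      using continuous_on_subset [OF \<phi>(1) sub] inj_on_subset [OF \<phi>(3) sub]
      by (intro invariance_of_domain_gen) auto
    show "\<phi> ` ball 0 1 \<subseteq> D2" using \<phi>(2) sub by (metis image_mono)
  qed
  have 2: "\<psi> ` interior D2 \<subseteq> interior (cball 0 1)"
  proof (rule interior_maximal)
    show "open (\<psi> ` interior D2)"
      using continuous_on_subset [OF \<psi>(1) interior_subset] inj_on_subset [OF \<psi>(3) interior_subset]
      by (intro invariance_of_domain_gen) auto
    show "\<psi> ` interior D2 \<subseteq> cball 0 1" using \<psi>(2) interior_subset by (metis image_mono)
  qed
  have "interior D2 \<subseteq> \<phi> ` ball 0 1"
  proof
    fix y assume y: "y \<in> interior D2"
    then have "\<psi> y \<in> ball 0 1" using 2 by (simp add: image_subset_iff)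
    moreover have "\<phi> (\<psi> y) = y"
      using y hom interior_subset by (meson homeomorphism_apply2 subsetD)
    ultimately show "y \<in> \<phi> ` ball 0 1" by (metis imageI)
  qed
  with 1 have ball: "\<phi> ` ball 0 1 = interior D2" by blast
  have sphere: "\<phi> ` sphere 0 1 = bdD2"
  proof -
    have "sphere (0::complex) 1 = cball 0 1 - ball 0 1" by auto
    then have "\<phi> ` sphere 0 1 = \<phi> ` cball 0 1 - \<phi> ` ball 0 1"
      using inj_on_image_set_diff [OF \<phi>(3), of "cball 0 1" "ball 0 1"] by auto
    also have "\<dots> = bdD2"
      unfolding \<phi>(2) ball frontier_def by (simp add: closure_closed closed_cbox)
    finally show ?thesis .
  qed
  show thesis
  proof (rule that [of "g \<circ> \<phi>"])
    show "continuous_on (cball 0 1) (g \<circ> \<phi>)" using \<phi> assms(1) by (intro continuous_on_compose) auto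
    show "inj_on (g \<circ> \<phi>) (cball 0 1)" using \<phi> assms(2) by (intro comp_inj_on) auto
  qed (simp_all only: image_comp [symmetric] \<phi>(2) ball sphere)
qed

text \<open>Only the topological structure, with charts in the complex plane: invariance of domain
  and Janiszewski's theorem ask for no more.\<close>

definition surface :: "'a::euclidean_space set \<Rightarrow> bool" where
  "surface S \<longleftrightarrow> (\<forall>x\<in>S. \<exists>(U::complex set) V f g.
     open U \<and> openin (top_of_set S) V \<and> x \<in> V \<and> homeomorphism U V f g)"

lemma surface_chart:
  assumes "surface S" "x \<in> S"
  obtains U :: "complex set" and V f g
  where "open U" "openin (top_of_set S) V" "x \<in> V" "homeomorphism U V f g"
  using bspec [OF assms(1) [unfolded surface_def] assms(2)] by (elim exE conjE)

lemma closed_pl_surface_surface: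
  assumes "closed_pl_surface S"
  shows "surface S"
  unfolding surface_def
proof
  fix x assume "x \<in> S"
  then obtain f where f: "pl_embedding D2 f" "x \<in> f ` interior D2" "openin (top_of_set S) (f ` interior D2)"
  proof -
    have "\<forall>x\<in>S. \<exists>f. pl_embedding D2 f \<and> f ` D2 \<subseteq> S \<and> x \<in> f ` interior D2 \<and>
        openin (top_of_set S) (f ` interior D2)"
      using assms unfolding closed_pl_surface_def by (elim conjE)
    then show thesis using \<open>x \<in> S\<close> that by fast
  qed
  obtain d :: "complex \<Rightarrow> real^3" where d: "continuous_on (cball 0 1) d" "inj_on d (cball 0 1)"
      "d ` cball 0 1 = f ` D2" "d ` ball 0 1 = f ` interior D2" "d ` sphere 0 1 = f ` bdD2"
    by (rule disc_parametrization [of f])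
      (use f(1) in \<open>auto simp: pl_embedding_def pl_on_continuous\<close>)
  obtain e where "homeomorphism (cball 0 1) (d ` cball 0 1) d e"
    using homeomorphism_compact [OF compact_cball d(1) refl d(2)] by blast
  then have "homeomorphism (ball 0 1) (d ` ball 0 1) d e"
    by (rule homeomorphism_of_subsets) (auto simp: image_mono)
  then show "\<exists>(U::complex set) V f g. open U \<and> openin (top_of_set S) V \<and> x \<in> V \<and> homeomorphism U V f g"
    using f d(4) by (intro exI [of _ "ball 0 1"] exI [of _ "d ` ball 0 1"] exI) auto
qed

text \<open>Openness is local, so it may be checked in a chart, where the planar theorem
  applies.\<close>

lemma surface_invariance_of_domain:
  fixes \<gamma> :: "'b::euclidean_space \<Rightarrow> 'a::euclidean_space"
  assumes "surface S" "DIM('b) = 2" "open U" "continuous_on U \<gamma>" "inj_on \<gamma> U" "\<gamma> ` U \<subseteq> S"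
  shows "openin (top_of_set S) (\<gamma> ` U)"
proof (subst openin_subopen, intro ballI)
  fix y assume "y \<in> \<gamma> ` U"
  then obtain u where u: "u \<in> U" "y = \<gamma> u" by blast
  then have "y \<in> S" using assms(6) by blast
  obtain O' :: "complex set" and V f g
    where ch: "open O'" "openin (top_of_set S) V" "y \<in> V" "homeomorphism O' V f g"
    by (rule surface_chart [OF assms(1) \<open>y \<in> S\<close>])
  define U' where "U' = U \<inter> \<gamma> -` V"
  have "openin (top_of_set U) U'"
    unfolding U'_def by (rule continuous_openin_preimage [OF assms(4) _ ch(2)]) (use assms(6) in auto)
  then have openU': "open U'" using assms(3) by (simp add: openin_open_eq)
  have img: "\<gamma> ` U' \<subseteq> V" by (auto simp: U'_def)
  have "continuous_on U' (g \<circ> \<gamma>)"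
    using ch(4) img by (intro continuous_on_compose continuous_on_subset [OF assms(4)])
      (auto simp: U'_def homeomorphism_def intro: continuous_on_subset)
  moreover have "inj_on (g \<circ> \<gamma>) U'"
  proof (rule comp_inj_on)
    show "inj_on \<gamma> U'" using assms(5) by (rule inj_on_subset) (auto simp: U'_def)
    have "inj_on g V" using ch(4) by (auto simp: homeomorphism_def intro: inj_on_inverseI)
    then show "inj_on g (\<gamma> ` U')" using img by (rule inj_on_subset)
  qed
  ultimately have op: "open ((g \<circ> \<gamma>) ` U')"
    using openU' assms(2) by (intro invariance_of_domain_gen) auto
  have "(g \<circ> \<gamma>) ` U' \<subseteq> O'" using ch(4) img by (auto simp: homeomorphism_def)
  then have "openin (top_of_set O') ((g \<circ> \<gamma>) ` U')" using op ch(1) by (simp add: openin_open_eq)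
  then have "openin (top_of_set V) (f ` (g \<circ> \<gamma>) ` U')" by (rule homeomorphism_imp_open_map [OF ch(4)])
  moreover have "f ` (g \<circ> \<gamma>) ` U' = \<gamma> ` U'"
  proof -
    have "f (g (\<gamma> z)) = \<gamma> z" if "z \<in> U'" for z
      using homeomorphism_apply2 [OF ch(4)] img that by blast
    then show ?thesis by (simp add: image_image)
  qed
  ultimately have "openin (top_of_set S) (\<gamma> ` U')" using ch(2) openin_trans by metis
  moreover have "y \<in> \<gamma> ` U'" using u ch(3) by (auto simp: U'_def)
  moreover have "\<gamma> ` U' \<subseteq> \<gamma> ` U" by (auto simp: U'_def)
  ultimately show "\<exists>T. openin (top_of_set S) T \<and> y \<in> T \<and> T \<subseteq> \<gamma> ` U" by blast
qed

section \<open>The outer side of a disc\<close>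

lemma small_cap:
  fixes d :: "complex \<Rightarrow> 'a::metric_space"
  assumes "continuous_on (cball 0 1) d" "norm u = 1" "open W" "d u \<in> W"
  obtains c where "c < 1" "\<And>y. \<lbrakk>y \<in> cball 0 1; c \<le> y \<bullet> u\<rbrakk> \<Longrightarrow> d y \<in> W"
proof -
  obtain e where e: "e > 0" "ball (d u) e \<subseteq> W" using assms(3,4) open_contains_ball by blast
  have "u \<in> cball 0 1" using assms(2) by simp
  then obtain \<delta> where \<delta>: "\<delta> > 0" "\<forall>y\<in>cball 0 1. dist y u < \<delta> \<longrightarrow> dist (d y) (d u) < e"
    using assms(1) e(1) unfolding continuous_on_iff by blast
  show thesis
  \<comment> \<open>Expanding the square gives
    \<open>(norm (y - u))^2 <= 2 - 2 * (y \<bullet> u)\<close>, so this bound makes it at most half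
    of the square of \<open>\<delta>\<close>.\<close>
  proof (rule that [of "1 - \<delta>\<^sup>2 / 4"])
    fix y assume y: "y \<in> cball 0 1" "1 - \<delta>\<^sup>2 / 4 \<le> y \<bullet> u"
    have "(norm (y - u))\<^sup>2 = (norm y)\<^sup>2 + (norm u)\<^sup>2 - 2 * (y \<bullet> u)"
      by (simp add: power2_norm_eq_inner inner_diff_left inner_diff_right inner_commute)
    moreover have "(norm y)\<^sup>2 \<le> 1" using y(1) by (simp add: power_le_one_iff)
    ultimately have "(norm (y - u))\<^sup>2 \<le> \<delta>\<^sup>2 / 2" using y(2) assms(2) by simp
    moreover have "\<delta>\<^sup>2 / 2 < \<delta>\<^sup>2" using \<delta>(1) by simp
    ultimately have "(norm (y - u))\<^sup>2 < \<delta>\<^sup>2" by linarith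
    then have "dist y u < \<delta>" using \<delta>(1) by (simp add: dist_norm power_less_imp_less_base)
    then have "dist (d y) (d u) < e" using \<delta>(2) y(1) by blast
    then show "d y \<in> W" using e(2) by (auto simp: dist_commute)
  qed (use \<delta>(1) in simp)
qed

context
  fixes S :: "'a::euclidean_space set" and d :: "complex \<Rightarrow> 'a"
  assumes surf: "surface S"
    and cont: "continuous_on (cball 0 1) d" and inj: "inj_on d (cball 0 1)"
    and sub: "d ` cball 0 1 \<subseteq> S"
begin

lemma open_disc_openin: "openin (top_of_set S) (d ` ball 0 1)"
proof -
  have "ball (0::complex) 1 \<subseteq> cball 0 1" by auto
  then show ?thesis
    using continuous_on_subset [OF cont] inj_on_subset [OF inj] sub
    by (intro surface_invariance_of_domain [OF surf]) auto
qed

text \<open>Otherwise the disc would contain a neighbourhood of \<open>d u\<close> in the surface.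
  Through a chart and the inverse of \<open>d\<close> this becomes an open planar set inside the
  closed unit disc that contains the boundary point \<open>u\<close>.\<close>

lemma outside_accumulates:
  assumes "u \<in> sphere 0 1" "openin (top_of_set S) T" "d u \<in> T"
  shows "T - d ` cball 0 1 \<noteq> {}"
proof
  assume "T - d ` cball 0 1 = {}"
  then have T: "T \<subseteq> d ` cball 0 1" by blast
  obtain e where e: "homeomorphism (cball 0 1) (d ` cball 0 1) d e"
    using homeomorphism_compact [OF compact_cball cont refl inj] by blast
  have "d u \<in> S" using assms(1) sub by auto
  obtain U :: "complex set" and V f g
    where ch: "open U" "openin (top_of_set S) V" "d u \<in> V" "homeomorphism U V f g"
    by (rule surface_chart [OF surf \<open>d u \<in> S\<close>])
  have "openin (top_of_set V) (T \<inter> V)"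
    using openin_subset_trans [of S "T \<inter> V" V] assms(2) ch(2) by (simp add: openin_Int openin_imp_subset)
  then have "openin (top_of_set U) (g ` (T \<inter> V))"
    using homeomorphism_imp_open_map homeomorphism_symD [OF ch(4)] by blast
  then have op: "open (g ` (T \<inter> V))" using ch(1) by (simp add: openin_open_eq)
  have gT: "f ` (g ` (T \<inter> V)) = T \<inter> V" "g ` (T \<inter> V) \<subseteq> U"
    using ch(4) by (auto simp: homeomorphism_def image_image image_subset_iff)
  have "continuous_on (g ` (T \<inter> V)) (e \<circ> f)"
  proof (rule continuous_on_compose)
    show "continuous_on (g ` (T \<inter> V)) f"
      using gT(2) ch(4) by (auto simp: homeomorphism_def intro: continuous_on_subset)
    show "continuous_on (f ` g ` (T \<inter> V)) e"
      unfolding gT(1) using e T by (auto simp: homeomorphism_def intro: continuous_on_subset)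
  qed
  moreover have "inj_on (e \<circ> f) (g ` (T \<inter> V))"
  proof (rule comp_inj_on)
    have "inj_on f U" using ch(4) by (auto simp: homeomorphism_def intro: inj_on_inverseI)
    then show "inj_on f (g ` (T \<inter> V))" using gT(2) by (rule inj_on_subset)
    have "inj_on e (d ` cball 0 1)" using e by (auto simp: homeomorphism_def intro: inj_on_inverseI)
    then show "inj_on e (f ` g ` (T \<inter> V))" unfolding gT(1) using T by (meson inf.coboundedI1 inj_on_subset)
  qed
  ultimately have "open ((e \<circ> f) ` g ` (T \<inter> V))" using op by (intro invariance_of_domain)
  then have "open (e ` (T \<inter> V))" unfolding image_comp [symmetric] gT(1) .
  moreover have "e ` (T \<inter> V) \<subseteq> cball 0 1"
    using T e by (auto simp: homeomorphism_def)
  ultimately have "e ` (T \<inter> V) \<subseteq> interior (cball 0 1)" by (rule interior_maximal [rotated])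
  moreover have "e (d u) = u" using homeomorphism_apply1 [OF e] assms(1) by auto
  then have "u \<in> e ` (T \<inter> V)" using assms(3) ch(3) by (metis IntI imageI)
  ultimately have "u \<in> ball 0 1" by auto
  then show False using assms(1) by simp
qed

text \<open>In a chart around \<open>d u\<close> the disc looks like the compact set \<open>B\<close>, which does not separate the
  plane. The cap \<open>{y. y \<bullet> u > c1}\<close> is cut off from the disc along a line, so what is left of \<open>B\<close>
  outside a suitable neighbourhood is connected and Janiszewski's theorem applies.\<close>

lemma outside_locally_connected:
  assumes "u \<in> sphere 0 1" "open W" "d u \<in> W"
  shows "\<exists>T. openin (top_of_set S) T \<and> d u \<in> T \<and> T \<subseteq> W \<and> connected (T - d ` cball 0 1)"
proof -
  have u: "norm u = 1" "u \<in> cball 0 1" using assms(1) by auto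
  have "d u \<in> S" using u sub by auto
  obtain U :: "complex set" and V f g
    where ch: "open U" "openin (top_of_set S) V" "d u \<in> V" "homeomorphism U V f g"
    by (rule surface_chart [OF surf \<open>d u \<in> S\<close>])
  obtain V0 where V0: "open V0" "V = S \<inter> V0" using ch(2) by (auto simp: openin_open)
  obtain c0 where c0: "c0 < 1" "\<And>y. \<lbrakk>y \<in> cball 0 1; c0 \<le> y \<bullet> u\<rbrakk> \<Longrightarrow> d y \<in> W \<inter> V0"
    by (rule small_cap [OF cont u(1), of "W \<inter> V0"]) (use assms V0 ch(3) in auto)
  \<comment> \<open>Any value strictly between \<open>c0\<close> and 1 serves. \<open>R\<close> is a
    closed cap mapped into \<open>W\<close> and the chart, \<open>R'\<close> a smaller cap around
    \<open>u\<close>, and \<open>R - R'\<close> a convex slab. \<open>K\<close>, the disc without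
    \<open>R'\<close>, is to be kept away from the neighbourhood.\<close>
  define c1 where "c1 = (c0 + 1) / 2"
  have c1: "c0 < c1" "c1 < 1" using c0(1) by (auto simp: c1_def)
  define R where "R = cball 0 1 \<inter> {y. u \<bullet> y \<ge> c0}"
  define R' where "R' = cball 0 1 \<inter> {y. u \<bullet> y > c1}"
  define K where "K = cball 0 1 \<inter> {y. u \<bullet> y \<le> c1}"
  have R'R: "R' \<subseteq> R" "R - R' = R \<inter> {y. u \<bullet> y \<le> c1}" "R \<subseteq> cball 0 1"
    using c1 by (auto simp: R_def R'_def)
  have dR: "d y \<in> W" "d y \<in> V" if "y \<in> R" for y
    using c0(2) [of y] that sub V0(2) by (auto simp: R_def inner_commute image_subset_iff)
  have cvxR: "compact R" "convex R" "connected R'" "connected (R - R')"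
    unfolding R'R(2) unfolding R_def R'_def
    by (auto intro!: convex_connected convex_Int convex_halfspace_ge convex_halfspace_gt convex_halfspace_le
        compact_Int_closed closed_halfspace_ge)
  have "compact K" unfolding K_def by (intro compact_Int_closed closed_halfspace_le) auto
  then have "compact (d ` K)"
    by (intro compact_continuous_image continuous_on_subset [OF cont]) (auto simp: K_def)
  then have clK: "closed (d ` K)" by (rule compact_imp_closed)
  have fg: "continuous_on U f" "continuous_on V g" "f ` U = V" "g ` V = U"
      "\<And>z. z \<in> U \<Longrightarrow> g (f z) = z" "\<And>z. z \<in> V \<Longrightarrow> f (g z) = z"
    using ch(4) by (auto simp: homeomorphism_def)
  define q where "q = g \<circ> d"
  have contq: "continuous_on R q"
    unfolding q_def using dR R'R(3)
    by (intro continuous_on_compose continuous_on_subset [OF cont] continuous_on_subset [OF fg(2)]) auto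
  have fq: "f (q y) = d y" if "y \<in> R" for y using fg(6) dR(2) that by (simp add: q_def)
  have injq: "inj_on q R"
  proof (rule inj_onI)
    fix x y assume xy: "x \<in> R" "y \<in> R" "q x = q y"
    then have "d x = d y" using fq by metis
    then show "x = y" using inj xy R'R(3) by (meson inj_onD subsetD)
  qed
  define B where "B = q ` R"
  have "R homeomorphic B"
    unfolding B_def using homeomorphism_compact [OF cvxR(1) contq refl injq] by (auto simp: homeomorphic_def)
  then have "B homeomorphic R" by (rule homeomorphic_sym [THEN iffD1])
  then have connB: "connected (- B)"
    by (rule connected_complement_homeomorphic_convex_compact [OF _ cvxR(2,1)]) simp
  have compB: "compact B" unfolding B_def by (rule compact_continuous_image [OF contq cvxR(1)])
  \<comment> \<open>With the image of \<open>K\<close> removed, the disc can meet the neighbourhood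
    only in the image of \<open>R'\<close>.\<close>
  define O' where "O' = U \<inter> f -` (W - d ` K)"
  have "openin (top_of_set U) O'"
    unfolding O'_def using assms(2) clK by (intro continuous_openin_preimage_gen [OF fg(1)]) auto
  then have opO: "open O'" using ch(1) by (simp add: openin_open_eq)
  have qO: "q y \<in> O'" if "y \<in> R'" for y
  proof -
    have y: "y \<in> R" using that R'R by blast
    have "d y \<notin> d ` K"
    proof
      assume "d y \<in> d ` K"
      then obtain z where "z \<in> K" "d y = d z" by blast
      then have "y = z" using inj y R'R(3) by (auto simp: K_def dest!: inj_onD)
      then show False using that \<open>z \<in> K\<close> by (auto simp: K_def R'_def)
    qed
    moreover have "q y \<in> U" using dR(2) [OF y] fg(4) by (auto simp: q_def)
    ultimately show ?thesis using fq [OF y] dR(1) [OF y] by (simp add: O'_def)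
  qed
  have uR': "u \<in> R'" using u c1 by (simp add: R'_def norm_eq_1)
  define U' where "U' = connected_component_set O' (q u)"
  have U': "open U'" "connected U'" "U' \<subseteq> O'" "q u \<in> U'"
    using opO qO [OF uR'] by (auto simp: U'_def open_connected_component connected_component_subset)
  have "connected (q ` R')" using cvxR(3) R'R by (intro connected_continuous_image continuous_on_subset [OF contq]) auto
  then have qR': "q ` R' \<subseteq> U'"
    unfolding U'_def using uR' qO by (intro connected_component_maximal) auto
  have BU: "z \<in> q ` R'" if zU: "z \<in> U'" "f z \<in> d ` cball 0 1" for z
  proof -
    obtain y where y: "y \<in> cball 0 1" "f z = d y" using zU by blast
    have z: "z \<in> U" "f z \<notin> d ` K" using zU(1) U'(3) by (auto simp: O'_def)
    then have "y \<in> R'" using y by (auto simp: R'_def K_def)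
    moreover have "z = q y" using fg(5) [OF z(1)] y(2) by (simp add: q_def)
    ultimately show ?thesis by blast
  qed
  have BU': "B - U' = q ` (R - R')"
  proof -
    have "z \<in> q ` R'" if "z \<in> U'" "z \<in> B" for z
      using BU [OF that(1)] that(2) fq R'R(3) unfolding B_def by auto
    then have "B - U' = q ` R - q ` R'" using qR' unfolding B_def by blast
    then show ?thesis using inj_on_image_set_diff [OF injq, of R R'] R'R(1) by auto
  qed
  have conn: "connected (U' - B)"
    unfolding connected_iff_connected_component
  proof (intro ballI)
    fix a b assume ab: "a \<in> U' - B" "b \<in> U' - B"
    \<comment> \<open>Neither \<open>B\<close> nor the complement of \<open>U'\<close> separates
      \<open>a\<close> from \<open>b\<close>, and their intersection is the image of the connected
      slab \<open>R - R'\<close>. Hence their union does not separate them either.\<close>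
    have "connected_component (- (B \<union> - U')) a b"
    proof (rule Janiszewski [OF compB])
      show "closed (- U')" unfolding closed_def using U'(1) by simp
      have "B \<inter> - U' = q ` (R - R')" using BU' by blast
      then show "connected (B \<inter> - U')"
        using cvxR(4) by (simp add: connected_continuous_image continuous_on_subset [OF contq])
      show "connected_component (- B) a b"
        using connB ab unfolding connected_iff_connected_component by blast
      show "connected_component (- (- U')) a b"
        using U'(2) ab unfolding connected_iff_connected_component by simp
    qed
    moreover have "- (B \<union> - U') = U' - B" by blast
    ultimately show "connected_component (U' - B) a b" by simp
  qed
  have U'U: "U' \<subseteq> U" using U'(3) by (auto simp: O'_def)
  have "f ` U' - d ` cball 0 1 = f ` (U' - B)"
  proof (intro subset_antisym subsetI)
    fix x assume "x \<in> f ` U' - d ` cball 0 1"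
    then obtain z where z: "z \<in> U'" "x = f z" "f z \<notin> d ` cball 0 1" by blast
    then have "z \<notin> B" using fq R'R(3) unfolding B_def by auto
    then show "x \<in> f ` (U' - B)" using z by blast
  next
    fix x assume "x \<in> f ` (U' - B)"
    then obtain z where z: "z \<in> U'" "z \<notin> B" "x = f z" by blast
    then have "f z \<notin> d ` cball 0 1" using BU [OF z(1)] R'R(1) unfolding B_def by blast
    then show "x \<in> f ` U' - d ` cball 0 1" using z(1,3) by simp
  qed
  moreover have "connected (f ` (U' - B))"
    using conn U'U by (intro connected_continuous_image continuous_on_subset [OF fg(1)]) auto
  moreover have "openin (top_of_set U) U'" using U'(1) U'U ch(1) by (simp add: openin_open_eq)
  then have "openin (top_of_set V) (f ` U')" by (rule homeomorphism_imp_open_map [OF ch(4)])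
  then have "openin (top_of_set S) (f ` U')" using ch(2) by (rule openin_trans)
  moreover have "d u \<in> f ` U'" using fq [of u] uR' R'R(1) U'(4) by (metis imageI subsetD)
  moreover have "f ` U' \<subseteq> W" using U'(3) by (auto simp: O'_def)
  ultimately show ?thesis by (intro exI [of _ "f ` U'"]) simp
qed

text \<open>The connected exterior pieces around the points of the boundary circle overlap for
  nearby points, because the exterior accumulates there. Chaining them along the connected circle
  yields one connected set, which plays the part of a thin outer collar.\<close>

lemma outer_side: "side S (d ` sphere 0 1) (germ (d ` sphere 0 1) (S - d ` cball 0 1))"
  unfolding side_def
proof (intro conjI allI impI)
  let ?s = "d ` sphere 0 1" and ?D = "d ` cball 0 1"
  have sD: "?s \<subseteq> ?D" by (intro image_mono) auto
  fix W assume W: "open W \<and> ?s \<subseteq> W"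
  have "\<forall>x\<in>?s. \<exists>T. openin (top_of_set S) T \<and> x \<in> T \<and> T \<subseteq> W \<and> connected (T - ?D)"
    using outside_locally_connected W by blast
  from bchoice [OF this] obtain T
    where T: "\<forall>x\<in>?s. openin (top_of_set S) (T x) \<and> x \<in> T x \<and> T x \<subseteq> W \<and> connected (T x - ?D)" ..
  define C where "C = (\<Union>x\<in>?s. T x - ?D)"
  have meet: "(T x \<inter> T y) - ?D \<noteq> {}" if "x \<in> ?s" "y \<in> ?s" "y \<in> T x" for x y
  proof -
    have "openin (top_of_set S) (T x \<inter> T y)" "y \<in> T x \<inter> T y" using T that by (auto intro: openin_Int)
    then show ?thesis using outside_accumulates that(2) by blast
  qed
  have conn_T: "connected_component C p q" if "x \<in> ?s" "p \<in> T x - ?D" "q \<in> T x - ?D" for x p q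
  proof -
    have "T x - ?D \<subseteq> C" using that(1) unfolding C_def by blast
    then show ?thesis using T that unfolding connected_component_def by blast
  qed
  \<comment> \<open>This relation between boundary points holds locally, hence globally on the
    connected circle. Transitivity needs the piece at the middle point to be nonempty, which is the
    case \<open>x = y\<close> of \<open>meet\<close>.\<close>
  define R where "R x y \<longleftrightarrow> (\<forall>p\<in>T x - ?D. \<forall>q\<in>T y - ?D. connected_component C p q)" for x y
  have conn_s: "connected ?s"
  proof (rule connected_continuous_image)
    show "continuous_on (sphere 0 1) d" by (rule continuous_on_subset [OF cont]) auto
    show "connected (sphere (0::complex) 1)" by (rule connected_sphere) simp
  qed
  have R: "R x y" if "x \<in> ?s" "y \<in> ?s" for x y
  proof (rule connected_equivalence_relation [OF conn_s that])
    show "R y x" if "R x y" for x y using that unfolding R_def by (meson connected_component_sym)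
    show "R x z" if xyz: "R x y" "R y z" "y \<in> ?s" for x y z
    proof -
      obtain r where "r \<in> T y - ?D" using meet [of y y] xyz(3) T by blast
      then show ?thesis using xyz(1,2) unfolding R_def by (meson connected_component_trans)
    qed
    fix a assume a: "a \<in> ?s"
    have "R a x" if x: "x \<in> ?s \<inter> T a" for x
    proof -
      obtain r where r: "r \<in> T a - ?D" "r \<in> T x - ?D" using meet [OF a, of x] x by blast
      show ?thesis
        unfolding R_def using conn_T [OF a _ r(1)] conn_T [of x r] r(2) x
        by (meson Int_iff connected_component_trans)
    qed
    moreover have "openin (top_of_set ?s) (?s \<inter> T a)"
    proof -
      have "openin (top_of_set S) (T a)" using T a by blast
      then obtain O' where O': "open O'" "T a = S \<inter> O'" unfolding openin_open by blast
      then have "?s \<inter> T a = ?s \<inter> O'" using sub sD by blast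
      then show ?thesis using O'(1) by (simp add: openin_open_Int)
    qed
    ultimately show "\<exists>X. openin (top_of_set ?s) X \<and> a \<in> X \<and> (\<forall>x\<in>X. R a x)"
      using a T by (intro exI [of _ "?s \<inter> T a"]) auto
  qed
  have "connected C"
    unfolding connected_iff_connected_component
  proof (intro ballI)
    fix p q assume "p \<in> C" "q \<in> C"
    then obtain x y where "x \<in> ?s" "p \<in> T x - ?D" "y \<in> ?s" "q \<in> T y - ?D" unfolding C_def by blast
    then show "connected_component C p q" using R unfolding R_def by blast
  qed
  moreover have "C \<subseteq> W \<inter> S - ?s"
    using T sD openin_imp_subset unfolding C_def by blast
  moreover have "\<forall>\<^sub>F x in germ ?s (S - ?D). x \<in> C"
  proof -
    have "openin (top_of_set S) (\<Union>x\<in>?s. T x)" using T by (intro openin_Union) auto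
    then obtain O' where O': "open O'" "(\<Union>x\<in>?s. T x) = S \<inter> O'" by (auto simp: openin_open)
    moreover have "?s \<subseteq> (\<Union>x\<in>?s. T x)" using T by blast
    ultimately have "?s \<subseteq> O'" by blast
    moreover have "\<forall>x\<in>O' \<inter> (S - ?D). x \<in> C" using O'(2) unfolding C_def by blast
    ultimately show ?thesis unfolding eventually_germ using O'(1) by blast
  qed
  ultimately show "\<exists>C. connected C \<and> C \<subseteq> W \<inter> S - ?s \<and> (\<forall>\<^sub>F x in germ ?s (S - ?D). x \<in> C)" by blast
next
  let ?s = "d ` sphere 0 1" and ?D = "d ` cball 0 1"
  fix A assume "\<forall>\<^sub>F x in germ ?s (S - ?D). x \<in> A"
  then obtain W where W: "open W" "?s \<subseteq> W" "W \<inter> (S - ?D) \<subseteq> A" unfolding eventually_germ by blast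
  show "?s \<subseteq> closure A"
  proof
    fix x assume x: "x \<in> ?s"
    then have "x \<in> S" using sub by auto
    have "A \<inter> O' \<noteq> {}" if "open O'" "x \<in> O'" for O'
    proof -
      have "openin (top_of_set S) (S \<inter> (W \<inter> O'))" using W(1) that(1) by (intro openin_open_Int) auto
      moreover have "x \<in> S \<inter> (W \<inter> O')" using \<open>x \<in> S\<close> W(2) x that(2) by blast
      ultimately have "S \<inter> (W \<inter> O') - ?D \<noteq> {}" using outside_accumulates x by blast
      then show ?thesis using W(3) by blast
    qed
    then show "x \<in> closure A" unfolding closure_iff_nhds_not_empty by blast
  qed
qed

text \<open>The open disc is a half collar of its boundary circle by radial contraction, height 1
  being the center.\<close>

lemma inner_side: "side S (d ` sphere 0 1) (germ (d ` sphere 0 1) (d ` ball 0 1))"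
proof -
  define k where "k = (\<lambda>(b::complex, t::real). d ((1 - t) *\<^sub>R b))"
  have "side S (d ` sphere 0 1) (germ (d ` sphere 0 1) (d ` ball 0 1))"
  proof (rule half_collar_side [of "sphere (0::complex) 1" k])
    show "continuous_on (sphere 0 1 \<times> {0..1}) k"
      unfolding k_def case_prod_unfold
      by (intro continuous_on_compose2 [OF cont] continuous_intros) (auto simp: mult_le_one)
    show "compact (sphere (0::complex) 1)" by simp
    show "connected (sphere (0::complex) 1)" by (rule connected_sphere) simp
    show "k ` (sphere 0 1 \<times> {0}) = d ` sphere 0 1" by (force simp: k_def)
    show "k ` (sphere 0 1 \<times> {0<..1}) = d ` ball 0 1"
    proof (intro subset_antisym subsetI)
      fix x assume "x \<in> k ` (sphere 0 1 \<times> {0<..1})"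
      then obtain b :: complex and t :: real where "norm b = 1" "0 < t" "t \<le> 1" "x = d ((1 - t) *\<^sub>R b)"
        by (auto simp: k_def)
      then show "x \<in> d ` ball 0 1" by auto
    next
      fix x assume "x \<in> d ` ball 0 1"
      then obtain z where z: "norm z < 1" "x = d z" by auto
      \<comment> \<open>The center has no direction; 1 is an arbitrary unit vector.\<close>
      define b where "b = (if z = 0 then 1 else sgn z)"
      have "norm b = 1" "norm z *\<^sub>R b = z" by (auto simp: b_def norm_sgn sgn_div_norm)
      then have "(b, 1 - norm z) \<in> sphere 0 1 \<times> {0<..1}" "x = k (b, 1 - norm z)"
        using z by (auto simp: k_def)
      then show "x \<in> k ` (sphere 0 1 \<times> {0<..1})" by blast
    qed
    have "ball (0::complex) 1 \<subseteq> cball 0 1" by auto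
    then show "d ` ball 0 1 \<subseteq> S" using sub by blast
    have "d ` sphere 0 1 \<inter> d ` ball 0 1 = d ` (sphere 0 1 \<inter> ball 0 1)"
      by (rule inj_on_image_Int [OF inj, symmetric]) auto
    then show "d ` sphere 0 1 \<inter> d ` ball 0 1 = {}" by auto
  qed
  then show ?thesis .
qed

end

section \<open>Dot relations\<close>

lemma add_dot_simps [simp]:
  "surf (add_dot p F) = surf F" "seams (add_dot p F) = seams F" "coor (add_dot p F) = coor F"
  "dots (add_dot p F) = insert p (dots F)" "region (add_dot p F) = region F"
  by (simp_all add: add_dot_def region_def)

lemma colorings_add_dot [simp]: "colorings (add_dot p F) = colorings F"
  by (simp add: colorings_def)

lemma tame_add_dot: "\<lbrakk>tame F; p \<in> region F\<rbrakk> \<Longrightarrow> tame (add_dot p F)"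
  by (simp add: tame_def)

text \<open>Dots form a set, so only a new point contributes another factor.\<close>

lemma weight_add_dot:
  assumes "tame F" "p \<notin> dots F"
  shows "weight (add_dot p F) \<phi> = alpha (\<phi> p) * weight F \<phi>"
  using assms by (simp add: weight_def capped_chi_def seams_of_color_1_def tame_finite mult.left_commute)

lemma evaluation_add_dot:
  assumes "tame F" "p \<in> region F" "p \<notin> dots F"
  shows "evaluation (add_dot p F) = (\<Sum>\<phi>\<in>colorings F. alpha (\<phi> p) * weight F \<phi>)"
  using evaluation_eq_sum_weight [OF tame_add_dot [OF assms(1,2)]] weight_add_dot [OF assms(1,3)] by simp

lemma evaluation_add_two_dots:
  assumes "tame F" "p \<in> region F" "p \<notin> dots F" "q \<in> region F" "q \<notin> dots F" "p \<noteq> q"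
  shows "evaluation (add_dot p (add_dot q F)) = (\<Sum>\<phi>\<in>colorings F. alpha (\<phi> p) * (alpha (\<phi> q) * weight F \<phi>))"
  using evaluation_add_dot [of "add_dot q F" p] tame_add_dot [OF assms(1,4)] weight_add_dot [OF assms(1,5)] assms
  by simp

lemma coloring_values: "\<lbrakk>\<phi> \<in> colorings F; x \<in> region F\<rbrakk> \<Longrightarrow> \<phi> x = 1 \<or> \<phi> x = 2"
  by (auto simp: colorings_def)

lemma coloring_facet:
  assumes "tame F" "\<phi> \<in> colorings F" "f \<in> facets F" "x \<in> f" "y \<in> f"
  shows "\<phi> x = \<phi> y"
  using assms facet_subset [OF assms(1,3)] in_components_connected [of f "region F"] facets_eq [OF assms(1)]
  by (intro loc_const_connected [of "region F" \<phi> f]) (auto simp: colorings_def)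

lemma coloring_across_seam:
  assumes "tame F" "\<phi> \<in> colorings F" "s \<in> seams F" "p \<in> facet_out F s" "q \<in> facet_into F s"
  shows "\<phi> p = 1 \<and> \<phi> q = 2 \<or> \<phi> p = 2 \<and> \<phi> q = 1"
proof -
  have "\<phi> \<in> spread F ` adm F" using bij_betw_spread [OF assms(1)] assms(2) by (simp add: bij_betw_def)
  then obtain c where c: "c \<in> adm F" "\<phi> = spread F c" by blast
  have "\<phi> p = c (facet_out F s)" "\<phi> q = c (facet_into F s)"
    using spread_facet [OF assms(1)] facet_out(1) [OF assms(1,3)] facet_into(1) [OF assms(1,3)] assms(4,5) c(2)
    by auto
  moreover have "c (facet_out F s) \<noteq> c (facet_into F s)" using c(1) assms(3) by (simp add: adm_def)
  moreover have "c (facet_out F s) \<in> {1, 2}" "c (facet_into F s) \<in> {1, 2}"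
    using c(1) facet_out(1) [OF assms(1,3)] facet_into(1) [OF assms(1,3)] by (auto simp: adm_def)
  ultimately show ?thesis by auto
qed

text \<open>Opposite colors across the seam mean that \<open>alpha (\<phi> p)\<close> and
  \<open>alpha (\<phi> q)\<close> are \<open>\<alpha>1\<close> and \<open>\<alpha>2\<close> in some
  order, with the same symmetric functions for every coloring.\<close>

lemma dot_migration:
  assumes "tame F" "s \<in> seams F" "p \<in> facet_out F s - dots F" "q \<in> facet_into F s - dots F"
  shows "evaluation (add_dot p F) + evaluation (add_dot q F) = E1 * evaluation F"
proof -
  have reg: "p \<in> region F" "q \<in> region F"
    using facet_subset [OF assms(1)] facet_out(1) [OF assms(1,2)] facet_into(1) [OF assms(1,2)] assms(3,4) by blast+
  have "alpha (\<phi> p) + alpha (\<phi> q) = E1" if "\<phi> \<in> colorings F" for \<phi>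
    using coloring_across_seam [OF assms(1) that assms(2), of p q] assms(3,4) by (auto simp: alpha_def E1_def)
  then have "alpha (\<phi> p) * weight F \<phi> + alpha (\<phi> q) * weight F \<phi> = E1 * weight F \<phi>" if "\<phi> \<in> colorings F" for \<phi>
    using that by (metis distrib_right)
  then show ?thesis
    using assms reg evaluation_add_dot evaluation_eq_sum_weight [OF assms(1)]
    by (simp add: sum_distrib_left flip: sum.distrib)
qed

lemma dots_across_seam:
  assumes "tame F" "s \<in> seams F" "p \<in> facet_out F s - dots F" "q \<in> facet_into F s - dots F" "p \<noteq> q"
  shows "evaluation (add_dot p (add_dot q F)) = E2 * evaluation F"
proof -
  have reg: "p \<in> region F" "q \<in> region F"
    using facet_subset [OF assms(1)] facet_out(1) [OF assms(1,2)] facet_into(1) [OF assms(1,2)] assms(3,4) by blast+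
  have "alpha (\<phi> p) * alpha (\<phi> q) = E2" if "\<phi> \<in> colorings F" for \<phi>
    using coloring_across_seam [OF assms(1) that assms(2), of p q] assms(3,4)
    by (auto simp: alpha_def E2_def mult.commute)
  then have "alpha (\<phi> p) * (alpha (\<phi> q) * weight F \<phi>) = E2 * weight F \<phi>" if "\<phi> \<in> colorings F" for \<phi>
    using that by (metis mult.assoc)
  then show ?thesis
    using assms reg
    by (subst evaluation_add_two_dots) (auto simp: evaluation_eq_sum_weight sum_distrib_left intro: sum.cong)
qed

text \<open>Both \<open>\<alpha>1\<close> and \<open>\<alpha>2\<close> are roots of
  \<open>X^2 - E1 * X + E2\<close>.\<close>

lemma two_dots_on_facet:
  assumes "tame F" "f \<in> facets F" "p \<in> f - dots F" "q \<in> f - dots F" "r \<in> f - dots F" "q \<noteq> r"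
  shows "evaluation (add_dot q (add_dot r F)) = E1 * evaluation (add_dot p F) - E2 * evaluation F"
proof -
  have reg: "p \<in> region F" "q \<in> region F" "r \<in> region F"
    using facet_subset [OF assms(1,2)] assms(3,4,5) by blast+
  have alpha: "alpha i * alpha i = E1 * alpha i - E2" for i
    by (simp add: alpha_def E1_def E2_def algebra_simps)
  have "alpha (\<phi> q) * (alpha (\<phi> r) * weight F \<phi>) = E1 * (alpha (\<phi> p) * weight F \<phi>) - E2 * weight F \<phi>"
    if "\<phi> \<in> colorings F" for \<phi>
  proof -
    have "\<phi> q = \<phi> p" "\<phi> r = \<phi> p"
      using coloring_facet [OF assms(1) that assms(2)] assms(3,4,5) by blast+
    then have "alpha (\<phi> q) * (alpha (\<phi> r) * weight F \<phi>) = (alpha (\<phi> p) * alpha (\<phi> p)) * weight F \<phi>" by simp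
    then show ?thesis unfolding alpha by (simp add: algebra_simps)
  qed
  then show ?thesis
    using assms reg evaluation_add_dot evaluation_add_two_dots evaluation_eq_sum_weight [OF assms(1)]
    by (simp add: sum_distrib_left flip: sum_subtractf)
qed

section \<open>Spheres\<close>

lemma \<alpha>_distinct: "\<alpha>2 - \<alpha>1 \<noteq> 0"
  by (simp add: \<alpha>1_def \<alpha>2_def)

lemma connected_S2: "connected S2" "S2 \<noteq> {}"
proof -
  have int: "(0::real^3) \<in> interior (cbox (- 1) 1)" by (simp add: interior_cbox mem_box_cart)
  then have ri: "rel_frontier (cbox (- 1) 1) = S2" by (intro rel_frontier_nonempty_interior) auto
  have "aff_dim (cbox (- 1) 1 :: (real^3) set) = 3"
    using int by (subst aff_dim_nonempty_interior) (auto simp del: interior_cbox)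
  then have "connected (rel_frontier (cbox (- 1) 1 :: (real^3) set))"
    by (intro connected_sphere_gen) (auto simp: convex_box bounded_cbox)
  then show "connected S2" by (simp only: ri)
  have "(\<chi> i. 1) \<in> S2" by (auto simp: frontier_cbox mem_box_cart)
  then show "S2 \<noteq> {}" by blast
qed

text \<open>Only the two constant colorings exist. Color 1 gets a minus sign from half the
  characteristic of the sphere, so for a positive number of dots the result is a complete
  homogeneous symmetric polynomial in \<open>\<alpha>1\<close> and \<open>\<alpha>2\<close>.\<close>

lemma evaluation_sphere:
  assumes "tame F" "pl_homeomorphic S2 (surf F)" "seams F = {}"
  shows "evaluation F = (\<alpha>2 ^ card (dots F) - \<alpha>1 ^ card (dots F)) / (\<alpha>2 - \<alpha>1)"
proof -
  obtain f where f: "pl_embedding S2 f" "f ` S2 = surf F" using assms(2) by (auto simp: pl_homeomorphic_def)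
  have reg: "region F = surf F" using assms(3) by (simp add: region_def)
  have "connected (f ` S2)"
    using f(1) connected_S2 by (intro connected_continuous_image) (auto simp: pl_embedding_def pl_on_continuous)
  then have conn: "connected (region F)" unfolding f(2) reg .
  obtain a where a: "a \<in> region F" using connected_S2(2) f(2) reg by blast
  have chi: "chi (surf F) = 2"
    using pl_embedding_has_chi [OF f(1) has_chi_S2 order_refl] f(2) chi_unique by metis
  define \<kappa> where "\<kappa> i = (\<lambda>x\<in>region F. i :: nat)" for i
  have "colorings F = {\<kappa> 1, \<kappa> 2}"
  proof (intro subset_antisym subsetI)
    fix \<phi> assume \<phi>: "\<phi> \<in> colorings F"
    then have lc: "loc_const (region F) \<phi>" and ext: "\<phi> \<in> extensional (region F)"
      by (auto simp: colorings_def PiE_iff)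
    have "\<phi> x = \<phi> a" if "x \<in> region F" for x
      using loc_const_connected [OF lc conn order_refl that a] .
    then have "\<phi> = \<kappa> (\<phi> a)" using ext by (auto simp: \<kappa>_def fun_eq_iff extensional_def)
    then show "\<phi> \<in> {\<kappa> 1, \<kappa> 2}" using coloring_values [OF \<phi> a] by auto
  next
    fix \<phi> assume "\<phi> \<in> {\<kappa> 1, \<kappa> 2}"
    then show "\<phi> \<in> colorings F"
      using assms(3) by (auto simp: \<kappa>_def colorings_def loc_const_def intro: exI [of _ UNIV])
  qed
  moreover have "\<kappa> 1 \<noteq> \<kappa> 2"
  proof
    assume "\<kappa> 1 = \<kappa> 2"
    then have "\<kappa> 1 a = \<kappa> 2 a" by simp
    then show False using a by (simp add: \<kappa>_def)
  qed
  ultimately have ev: "evaluation F = weight F (\<kappa> 1) + weight F (\<kappa> 2)"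
    using evaluation_eq_sum_weight [OF assms(1)] by simp
  have dots: "(\<Prod>p\<in>dots F. alpha (\<kappa> i p)) = alpha i ^ card (dots F)" for i
  proof -
    have "dots F \<subseteq> region F" using assms(1) by (simp add: tame_def)
    then have "(\<Prod>p\<in>dots F. alpha (\<kappa> i p)) = (\<Prod>p\<in>dots F. alpha i)"
      by (intro prod.cong) (auto simp: \<kappa>_def)
    then show ?thesis by simp
  qed
  have "{x \<in> region F. \<kappa> 1 x = 1} = surf F" "{x \<in> region F. \<kappa> 2 x = 1} = {}"
    unfolding reg [symmetric] by (auto simp: \<kappa>_def)
  then have "capped_chi F (\<kappa> 1) = 2" "capped_chi F (\<kappa> 2) = 0"
    unfolding capped_chi_def using assms(3) chi chi_unique [OF has_chi_empty] by (simp_all only: card.empty of_nat_0 add_0_right)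
  then show ?thesis
    unfolding ev weight_def dots chi using assms(3)
    by (simp add: seams_of_color_1_def alpha_def diff_divide_distrib)
qed

lemma evaluation_sphere_dots:
  assumes "tame F" "pl_homeomorphic S2 (surf F)" "seams F = {}"
  shows "dots F = {} \<Longrightarrow> evaluation F = 0" "card (dots F) = 1 \<Longrightarrow> evaluation F = 1"
  using evaluation_sphere [OF assms] \<alpha>_distinct by simp_all

section \<open>Circles bounding a disc\<close>

lemma germ_color_cong:
  assumes "\<forall>\<^sub>F x in \<F>. \<phi> x = \<psi> x"
  shows "germ_color \<phi> \<F> = germ_color \<psi> \<F>"
proof -
  have "(\<forall>\<^sub>F x in \<F>. \<phi> x = i) \<longleftrightarrow> (\<forall>\<^sub>F x in \<F>. \<psi> x = i)" for i
    using assms by (auto elim: eventually_elim2)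
  then show ?thesis by (simp add: germ_color_def)
qed

lemma side_eventually_not:
  assumes "side S s \<F>" "closed A" "s \<inter> A = {}"
  shows "\<forall>\<^sub>F x in \<F>. x \<in> S - A - s"
proof -
  have "open (- A) \<and> s \<subseteq> - A" using assms by auto
  then obtain C where "C \<subseteq> - A \<inter> S - s" "\<forall>\<^sub>F x in \<F>. x \<in> C"
    using assms(1) unfolding side_def by meson
  then show ?thesis by (auto elim: eventually_mono)
qed

lemma minus_one_powi_add: "(- 1 :: coeff) powi (m + n) = (- 1) powi m * (- 1) powi n"
  by (simp add: power_int_add)

lemma tame_disjoint:
  assumes "tame F" "s \<in> seams F" "t \<in> seams F" "s \<noteq> t"
  shows "s \<inter> t = {}"
proof -
  have "pairwise disjnt (seams F)" using assms(1) by (simp add: tame_def)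
  then show ?thesis using pairwiseD [of disjnt "seams F" s t] assms by (simp add: disjnt_def)
qed

text \<open>Colorings correspond by exchanging 1 and 2 on the disc. Outside color 1 leaves the
  capped characteristic unchanged, outside color 2 raises its half by one. The new seam has the
  outside color if co-oriented inward and the inside color otherwise, so of the two exponents
  exactly one changes in the inward case, and none or both in the outward case.\<close>

lemma evaluation_add_circle:
  fixes inward :: bool
  assumes tame: "tame F" and surf: "surface (surf F)" and f: "f \<in> facets F"
    and g: "pl_embedding D2 g" and gf: "g ` D2 \<subseteq> f" and gd: "g ` D2 \<inter> dots F = {}"
    and F': "F' = F\<lparr>seams := insert (g ` bdD2) (seams F), coor := (coor F)(g ` bdD2 :=
        (if inward then (germ (g ` bdD2) (surf F - g ` D2), germ (g ` bdD2) (g ` D2 - g ` bdD2))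
         else (germ (g ` bdD2) (g ` D2 - g ` bdD2), germ (g ` bdD2) (surf F - g ` D2))))\<rparr>"
  shows "evaluation F' = (if inward then - 1 else 1) * evaluation F"
proof -
  define s D where "s = g ` bdD2" and "D = g ` D2"
  define outer inner where "outer = germ s (surf F - D)" and "inner = germ s (D - s)"
  have cont: "continuous_on D2 g" and inj: "inj_on g D2"
    using g by (auto simp: pl_embedding_def pl_on_continuous)
  obtain d :: "complex \<Rightarrow> real^3" where d: "continuous_on (cball 0 1) d" "inj_on d (cball 0 1)"
      "d ` cball 0 1 = D" "d ` ball 0 1 = g ` interior D2" "d ` sphere 0 1 = s"
    unfolding s_def D_def by (rule disc_parametrization [OF cont inj])
  have Ds: "D - s = d ` ball 0 1"
  proof -
    have "ball (0::complex) 1 = cball 0 1 - sphere 0 1" by auto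
    then show ?thesis
      unfolding d(3,5) [symmetric] using inj_on_image_set_diff [OF d(2), of "cball 0 1" "sphere 0 1"] by auto
  qed
  have sD: "s \<subseteq> D" using bdD2_facts(4) unfolding s_def D_def by (rule image_mono)
  have Df: "D \<subseteq> f" using gf by (simp add: D_def)
  then have Dreg: "D \<subseteq> region F" using facet_subset [OF tame f] by blast
  then have Dsurf: "D \<subseteq> surf F" by (auto simp: region_def)
  have s_ne: "s \<noteq> {}" using bdD2_facts(3) by (simp add: s_def)
  have "compact D" unfolding D_def by (rule compact_continuous_image [OF cont]) (simp add: compact_cbox)
  then have clD: "closed D" by (rule compact_imp_closed)
  have sides: "side (surf F) s outer" "side (surf F) s inner"
    using outer_side [OF surf d(1,2)] inner_side [OF surf d(1,2)] Dsurf
    unfolding d(3,5) Ds [symmetric] outer_def inner_def by auto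
  then have nb: "outer \<noteq> bot" "inner \<noteq> bot" using side_not_bot s_ne by blast+
  have chi_s: "has_chi s 0" "polyset s"
  proof -
    show "has_chi s 0" unfolding s_def by (rule pl_embedding_has_chi [OF g has_chi_bdD2 bdD2_facts(4)])
    show "polyset s"
      unfolding s_def using g bdD2_facts(4)
      by (intro pl_on_polyset [of D2] polyset_frontier_cbox) (auto simp: pl_embedding_def)
  qed
  have chi_D: "has_chi D 1" unfolding D_def by (rule pl_embedding_has_chi [OF g has_chi_D2 order_refl])
  have chi_Ds: "has_chi (D - s) 1" using has_chi_Diff [OF chi_D chi_s(1) sD] by simp
  obtain V where V: "open V" "D - s = surf F \<inter> V"
    using open_disc_openin [OF surf d(1,2)] Dsurf unfolding d(3) Ds [symmetric] openin_open by blast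
  have connDs: "connected (D - s)"
    unfolding Ds by (rule connected_continuous_image [OF continuous_on_subset [OF d(1)]]) auto
  have disj: "t \<inter> D = {}" if "t \<in> seams F" for t using Dreg that by (auto simp: region_def)
  have s_new: "s \<notin> seams F" using disj sD s_ne by blast
  have F'_simps: "surf F' = surf F" "seams F' = insert s (seams F)" "dots F' = dots F"
      "coor F' s = (if inward then (outer, inner) else (inner, outer))"
    by (simp_all add: F' s_def D_def outer_def inner_def)
  have coor': "coor F' t = coor F t" if "t \<in> seams F" for t
    using that s_new by (auto simp: F' s_def)
  have reg': "region F' = region F - s" by (auto simp: region_def F'_simps)
  have tame': "tame F'"
    unfolding tame_def F'_simps(1,2,3) reg'
  proof (intro conjI ballI)
    show "polyset (surf F)" "finite (insert s (seams F))" "finite (dots F)"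
      using tame by (simp_all add: tame_def)
    have "t \<inter> s = {}" if "t \<in> seams F" for t using disj [OF that] sD by blast
    moreover have "pairwise disjnt (seams F)" using tame by (simp add: tame_def)
    ultimately show "pairwise disjnt (insert s (seams F))"
      by (auto simp: pairwise_insert disjnt_def Int_commute)
    have "dots F \<subseteq> region F" using tame by (simp add: tame_def)
    moreover have "s \<inter> dots F = {}" using gd sD unfolding D_def by blast
    ultimately show "dots F \<subseteq> region F - s" by blast
    fix t assume t: "t \<in> insert s (seams F)"
    show "t \<subseteq> surf F" "polyset t" "t \<noteq> {}" "has_chi t 0"
      using t tame_seam [OF tame] sD Dsurf s_ne chi_s by auto
    show "side (surf F) t (fst (coor F' t))" "side (surf F) t (snd (coor F' t))"
      using t tame_seam(5,6) [OF tame] sides coor' by (auto simp: F'_simps(4))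
  qed
  \<comment> \<open>Germs at old seams avoid the disc, so recoloring the disc does not affect the
    conditions there.\<close>
  have away: "\<forall>\<^sub>F x in fst (coor F t). x \<in> region F - D" "\<forall>\<^sub>F x in snd (coor F t). x \<in> region F - D"
    if t: "t \<in> seams F" for t
  proof -
    have cl: "closed (D \<union> \<Union>(seams F - {t}))"
      using clD tame_closed(2) [OF tame] by (intro closed_Un) auto
    have "t \<inter> r = {}" if "r \<in> seams F - {t}" for r
      using tame_disjoint [OF tame] that t by blast
    then have dj: "t \<inter> (D \<union> \<Union>(seams F - {t})) = {}" using disj [OF t] by blast
    have "\<forall>\<^sub>F x in fst (coor F t). x \<in> surf F - (D \<union> \<Union>(seams F - {t})) - t"
        "\<forall>\<^sub>F x in snd (coor F t). x \<in> surf F - (D \<union> \<Union>(seams F - {t})) - t"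
      using side_eventually_not [OF tame_seam(5) [OF tame t] cl dj]
        side_eventually_not [OF tame_seam(6) [OF tame t] cl dj] by simp_all
    then show "\<forall>\<^sub>F x in fst (coor F t). x \<in> region F - D" "\<forall>\<^sub>F x in snd (coor F t). x \<in> region F - D"
      by (auto simp: region_def elim!: eventually_mono)
  qed
  define up where "up \<phi> = (\<lambda>x\<in>region F - s. if x \<in> D then 3 - \<phi> x else \<phi> x :: nat)" for \<phi>
  \<comment> \<open>The disc, together with its boundary circle, is filled with the color seen just
    outside.\<close>
  define down where "down \<phi> = (\<lambda>x\<in>region F. if x \<in> D then germ_color \<phi> outer else \<phi> x :: nat)" for \<phi> :: "real^3 \<Rightarrow> nat"
  obtain z where z: "z \<in> s" using s_ne by blast
  have const: "\<phi> x = \<phi> z" if "\<phi> \<in> colorings F" "x \<in> D" for \<phi> x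
    using coloring_facet [OF tame that(1) f] that(2) z sD Df by blast
  have lc: "\<exists>W. open W \<and> x \<in> W \<and> (\<forall>y\<in>W \<inter> region F. \<phi> y = \<phi> x)" if "\<phi> \<in> colorings F" "x \<in> region F" for \<phi> x
    using that by (simp add: colorings_def loc_const_def)
  \<comment> \<open>\<open>\<phi>\<close> has the value \<open>\<phi> z\<close> on the whole disc,
    including its boundary, and by local constancy still has it just beyond.\<close>
  have up_outer: "\<forall>\<^sub>F x in outer. up \<phi> x = \<phi> z" if \<phi>: "\<phi> \<in> colorings F" for \<phi>
  proof -
    have "\<forall>x\<in>D. \<exists>W. open W \<and> x \<in> W \<and> (\<forall>y\<in>W \<inter> region F. \<phi> y = \<phi> z)"
      using lc [OF \<phi>] const [OF \<phi>] Dreg by (metis subsetD)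
    from bchoice [OF this] obtain W
      where W: "\<forall>x\<in>D. open (W x) \<and> x \<in> W x \<and> (\<forall>y\<in>W x \<inter> region F. \<phi> y = \<phi> z)" ..
    define O' where "O' = (\<Union>x\<in>s. W x)"
    have "open O'" "s \<subseteq> O'" using W sD unfolding O'_def by blast+
    moreover have "closed (\<Union>(seams F))" using tame_closed(2) [OF tame order_refl] .
    moreover have "s \<subseteq> - \<Union>(seams F)" using Dreg sD by (auto simp: region_def)
    moreover have "up \<phi> x = \<phi> z" if xO: "x \<in> (O' - \<Union>(seams F)) \<inter> (surf F - D)" for x
    proof -
      have "x \<in> region F - s" "x \<notin> D" using xO sD by (auto simp: region_def)
      then have up: "up \<phi> x = \<phi> x" by (simp add: up_def)
      obtain y where "y \<in> s" "x \<in> W y" using xO unfolding O'_def by blast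
      moreover then have "y \<in> D" using sD by blast
      ultimately have "\<phi> x = \<phi> z" using bspec [OF W, of y] \<open>x \<in> region F - s\<close> by simp
      then show ?thesis using up by simp
    qed
    ultimately show ?thesis
      unfolding outer_def eventually_germ by (intro exI [of _ "O' - \<Union>(seams F)"]) auto
  qed
  have up_inner: "\<forall>\<^sub>F x in inner. up \<phi> x = 3 - \<phi> z" if \<phi>: "\<phi> \<in> colorings F" for \<phi>
    unfolding inner_def eventually_germ
  proof (intro exI [of _ UNIV] conjI ballI)
    fix x assume "x \<in> UNIV \<inter> (D - s)"
    then show "up \<phi> x = 3 - \<phi> z" using Dreg const [OF \<phi>, of x] by (auto simp: up_def)
  qed auto
  have up_germ: "germ_color (up \<phi>) (fst (coor F t)) = germ_color \<phi> (fst (coor F t))"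
      "germ_color (up \<phi>) (snd (coor F t)) = germ_color \<phi> (snd (coor F t))" if "t \<in> seams F" for \<phi> t
    using away [OF that] sD by (auto intro!: germ_color_cong elim!: eventually_mono simp: up_def)
  have zval: "\<phi> z = 1 \<or> \<phi> z = 2" if "\<phi> \<in> colorings F" for \<phi>
    using coloring_values [OF that] z sD Dreg by blast
  have up_germ_s: "germ_color (up \<phi>) outer = \<phi> z" "germ_color (up \<phi>) inner = 3 - \<phi> z"
    if "\<phi> \<in> colorings F" for \<phi>
    using germ_color_eq [OF nb(1) up_outer [OF that]] germ_color_eq [OF nb(2) up_inner [OF that]] by auto
  have up_col: "up \<phi> \<in> colorings F'" if \<phi>: "\<phi> \<in> colorings F" for \<phi>
    unfolding colorings_def reg'
  proof (intro CollectI conjI ballI)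
    show "up \<phi> \<in> region F - s \<rightarrow>\<^sub>E {1, 2}"
    proof (rule PiE_I)
      fix x assume "x \<in> region F - s"
      then show "up \<phi> x \<in> {1, 2}" using coloring_values [OF \<phi>, of x] by (auto simp: up_def)
    qed (auto simp: up_def)
    show "loc_const (region F - s) (up \<phi>)"
      unfolding loc_const_def
    proof
      fix x assume x: "x \<in> region F - s"
      then obtain W where W: "open W" "x \<in> W" "\<forall>y\<in>W \<inter> region F. \<phi> y = \<phi> x" using lc [OF \<phi>] by blast
      show "\<exists>W. open W \<and> x \<in> W \<and> (\<forall>y\<in>W \<inter> (region F - s). up \<phi> y = up \<phi> x)"
      proof (cases "x \<in> D")
        case True
        then have "x \<in> V" using V x by blast
        moreover have "up \<phi> y = up \<phi> x" if y: "y \<in> (W \<inter> V) \<inter> (region F - s)" for y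
        proof -
          have "y \<in> surf F \<inter> V" using y by (simp add: region_def)
          then have "y \<in> D" using V(2) by blast
          moreover have "\<phi> y = \<phi> x" using W(3) y by simp
          ultimately show ?thesis using True x y by (simp add: up_def)
        qed
        ultimately show ?thesis
          using W(1,2) V(1) by (intro exI [of _ "W \<inter> V"]) (simp add: open_Int)
      next
        case False
        have "up \<phi> y = up \<phi> x" if y: "y \<in> (W - D) \<inter> (region F - s)" for y
          using W(3) False x y by (simp add: up_def)
        then show ?thesis
          using W(1,2) False clD by (intro exI [of _ "W - D"]) (simp add: open_Diff)
      qed
    qed
    fix t assume "t \<in> seams F'"
    then consider "t = s" | "t \<in> seams F" by (auto simp: F'_simps)
    then show "germ_color (up \<phi>) (fst (coor F' t)) \<noteq> germ_color (up \<phi>) (snd (coor F' t))"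
    proof cases
      case 1
      then show ?thesis using up_germ_s [OF \<phi>] zval [OF \<phi>] by (auto simp: F'_simps(4))
    next
      case 2
      then show ?thesis using \<phi> up_germ [OF 2] coor' [OF 2] by (simp add: colorings_def)
    qed
  qed
  have lc': "\<exists>W. open W \<and> x \<in> W \<and> (\<forall>y\<in>W \<inter> (region F - s). \<phi> y = \<phi> x)"
    if "\<phi> \<in> colorings F'" "x \<in> region F - s" for \<phi> x
    using that by (simp add: colorings_def loc_const_def reg')
  have germ': "\<forall>\<^sub>F x in outer. \<phi> x = germ_color \<phi> outer" "\<forall>\<^sub>F x in inner. \<phi> x = germ_color \<phi> inner"
      "germ_color \<phi> outer \<in> {1, 2}" "germ_color \<phi> inner \<in> {1, 2}" "germ_color \<phi> outer \<noteq> germ_color \<phi> inner"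
    if \<phi>: "\<phi> \<in> colorings F'" for \<phi>
  proof -
    have lcF': "loc_const (region F') \<phi>" using \<phi> by (simp add: colorings_def)
    have sF': "s \<in> seams F'" by (simp add: F'_simps)
    have "side (surf F') s outer" "side (surf F') s inner" using sides by (simp_all add: F'_simps)
    note o = loc_const_germ_color [OF tame' lcF' sF' this(1)] and i = loc_const_germ_color [OF tame' lcF' sF' this(2)]
    show "\<forall>\<^sub>F x in outer. \<phi> x = germ_color \<phi> outer" using o(1) by (rule eventually_mono) simp
    show "\<forall>\<^sub>F x in inner. \<phi> x = germ_color \<phi> inner" using i(1) by (rule eventually_mono) simp
    have two: "\<phi> ` region F' \<subseteq> {1, 2}" using \<phi> by (auto simp: colorings_def)
    show "germ_color \<phi> outer \<in> {1, 2}" "germ_color \<phi> inner \<in> {1, 2}"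
      using o(2) i(2) two by blast+
    have "germ_color \<phi> (fst (coor F' s)) \<noteq> germ_color \<phi> (snd (coor F' s))"
      using \<phi> sF' by (simp add: colorings_def)
    then show "germ_color \<phi> outer \<noteq> germ_color \<phi> inner" by (auto simp: F'_simps(4) split: if_splits)
  qed
  \<comment> \<open>The open disc is connected, so it has a single color; being different from the
    outer one, it is 3 minus that color.\<close>
  have inside': "\<phi> x = 3 - germ_color \<phi> outer" if \<phi>: "\<phi> \<in> colorings F'" and x: "x \<in> D - s" for \<phi> x
  proof -
    have sub: "D - s \<subseteq> region F'" using Dreg by (auto simp: reg')
    have lcF': "loc_const (region F') \<phi>" using \<phi> by (simp add: colorings_def)
    have "\<phi> y = \<phi> x" if "y \<in> D - s" for y using loc_const_connected [OF lcF' connDs sub that x] .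
    then have "\<forall>\<^sub>F y in inner. \<phi> y = \<phi> x" unfolding inner_def eventually_germ by (intro exI [of _ UNIV]) auto
    then have "germ_color \<phi> inner = \<phi> x" by (rule germ_color_eq [OF nb(2)])
    then show ?thesis using germ'(3,4,5) [OF \<phi>] by auto
  qed
  have down_col: "down \<phi> \<in> colorings F" if \<phi>: "\<phi> \<in> colorings F'" for \<phi>
    unfolding colorings_def
  proof (intro CollectI conjI ballI)
    have "\<phi> x = 1 \<or> \<phi> x = 2" if "x \<in> region F - D" for x
      using coloring_values [OF \<phi>, of x] that sD by (auto simp: reg')
    then show "down \<phi> \<in> region F \<rightarrow>\<^sub>E {1, 2}"
      using germ'(3) [OF \<phi>] by (intro PiE_I) (auto simp: down_def)
    show "loc_const (region F) (down \<phi>)"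
      unfolding loc_const_def
    proof
      fix x assume x: "x \<in> region F"
      consider "x \<in> s" | "x \<in> D - s" | "x \<notin> D" by blast
      then show "\<exists>W. open W \<and> x \<in> W \<and> (\<forall>y\<in>W \<inter> region F. down \<phi> y = down \<phi> x)"
      proof cases
        case 1
        obtain W where W: "open W" "s \<subseteq> W" "\<forall>y\<in>W \<inter> (surf F - D). \<phi> y = germ_color \<phi> outer"
          using germ'(1) [OF \<phi>] unfolding outer_def eventually_germ by blast
        then have "\<forall>y\<in>W \<inter> region F. down \<phi> y = germ_color \<phi> outer"
          by (auto simp: down_def region_def)
        moreover have "down \<phi> x = germ_color \<phi> outer" using 1 sD x by (auto simp: down_def)
        ultimately show ?thesis using W 1 by (intro exI [of _ W]) auto
      next
        case 2
        then have "x \<in> V" using V by blast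
        moreover have "down \<phi> y = down \<phi> x" if y: "y \<in> V \<inter> region F" for y
        proof -
          have "y \<in> surf F \<inter> V" using y by (simp add: region_def)
          then have "y \<in> D" using V(2) by blast
          then show ?thesis using 2 x y by (simp add: down_def)
        qed
        ultimately show ?thesis using V(1) by (intro exI [of _ V]) simp
      next
        case 3
        then have "x \<in> region F - s" using x sD by blast
        from lc' [OF \<phi> this] obtain W
          where W: "open W" "x \<in> W" "\<forall>y\<in>W \<inter> (region F - s). \<phi> y = \<phi> x" by blast
        have "down \<phi> y = down \<phi> x" if y: "y \<in> (W - D) \<inter> region F" for y
        proof -
          have "y \<notin> s" using y sD by blast
          then show ?thesis using W(3) 3 x y by (simp add: down_def)
        qed
        then show ?thesis using W(1,2) 3 clD by (intro exI [of _ "W - D"]) (simp add: open_Diff)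
      qed
    qed
    fix t assume t: "t \<in> seams F"
    have "germ_color (down \<phi>) (fst (coor F t)) = germ_color \<phi> (fst (coor F t))"
        "germ_color (down \<phi>) (snd (coor F t)) = germ_color \<phi> (snd (coor F t))"
      using away [OF t] by (auto intro!: germ_color_cong elim!: eventually_mono simp: down_def)
    moreover have "germ_color \<phi> (fst (coor F' t)) \<noteq> germ_color \<phi> (snd (coor F' t))"
      using \<phi> t by (simp add: colorings_def F'_simps)
    ultimately show "germ_color (down \<phi>) (fst (coor F t)) \<noteq> germ_color (down \<phi>) (snd (coor F t))"
      using coor' [OF t] by simp
  qed
  have "bij_betw up (colorings F) (colorings F')"
  proof (rule bij_betw_byWitness [of _ down])
    show "\<forall>\<phi>\<in>colorings F. down (up \<phi>) = \<phi>"
    proof (intro ballI ext)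
      fix \<phi> x assume \<phi>: "\<phi> \<in> colorings F"
      then have "\<phi> x = undefined" if "x \<notin> region F" using that by (auto simp: colorings_def PiE_iff extensional_def)
      then show "down (up \<phi>) x = \<phi> x"
        using up_germ_s [OF \<phi>] const [OF \<phi>, of x] sD by (auto simp: down_def up_def)
    qed
    show "\<forall>\<phi>\<in>colorings F'. up (down \<phi>) = \<phi>"
    proof (intro ballI ext)
      fix \<phi> x assume \<phi>: "\<phi> \<in> colorings F'"
      then have "\<phi> x = undefined" if "x \<notin> region F - s"
        using that by (auto simp: colorings_def PiE_iff extensional_def reg')
      then show "up (down \<phi>) x = \<phi> x"
        using inside' [OF \<phi>, of x] by (auto simp: down_def up_def)
    qed
    show "up ` colorings F \<subseteq> colorings F'" "down ` colorings F' \<subseteq> colorings F"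
      using up_col down_col by auto
  qed
  moreover have "weight F' (up \<phi>) = (if inward then - 1 else 1) * weight F \<phi>" if \<phi>: "\<phi> \<in> colorings F" for \<phi>
  proof -
    define X where "X = {x \<in> region F. \<phi> x = 1}"
    have lcF: "loc_const (region F) \<phi>" using \<phi> by (simp add: colorings_def)
    have chiX: "has_chi X (chi X)" unfolding X_def by (rule has_chi_color_class [OF tame lcF])
    \<comment> \<open>With outside color 1 the closed disc leaves the class, its boundary having
      become a seam; with outside color 2 only the open disc joins. Both have characteristic 1,
      because the circle has 0.\<close>
    have chiX': "chi {x \<in> region F'. up \<phi> x = 1} = chi X + (if \<phi> z = 1 then - 1 else 1)"
    proof (cases "\<phi> z = 1")
      case True
      have DX: "D \<subseteq> X" using const [OF \<phi>] True Dreg by (auto simp: X_def)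
      have "{x \<in> region F'. up \<phi> x = 1} = X - D"
        using const [OF \<phi>] True sD by (auto simp: X_def up_def reg')
      moreover have "has_chi (X - D) (chi X - 1)" by (rule has_chi_Diff [OF chiX chi_D DX])
      ultimately show ?thesis using True chi_unique by fastforce
    next
      case False
      then have two: "\<phi> z = 2" using zval [OF \<phi>] by simp
      then have DX: "X \<inter> D = {}" using const [OF \<phi>] by (auto simp: X_def)
      have "{x \<in> region F'. up \<phi> x = 1} = X \<union> (D - s)"
        using const [OF \<phi>] two sD Dreg by (auto simp: X_def up_def reg')
      moreover have "has_chi (X \<union> (D - s)) (chi X + 1)"
        by (rule has_chi_Un [OF chiX chi_Ds]) (use DX in blast)
      ultimately show ?thesis using False chi_unique by fastforce
    qed
    have capped: "capped_chi F' (up \<phi>) = capped_chi F \<phi> + (if \<phi> z = 1 then 0 else 2)"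
      using chiX' s_new tame_finite(1) [OF tame] by (simp add: capped_chi_def F'_simps X_def)
    have count: "seams_of_color_1 F' (up \<phi>) = seams_of_color_1 F \<phi> + (if inward = (\<phi> z = 1) then 1 else 0)"
    proof -
      define Q where "Q = {t \<in> seams F. germ_color \<phi> (fst (coor F t)) = 1}"
      have "germ_color (up \<phi>) (fst (coor F' s)) = 1 \<longleftrightarrow> inward = (\<phi> z = 1)"
        using up_germ_s [OF \<phi>] zval [OF \<phi>] by (auto simp: F'_simps(4))
      moreover have "germ_color (up \<phi>) (fst (coor F' t)) = germ_color \<phi> (fst (coor F t))" if "t \<in> seams F" for t
        using up_germ [OF that] coor' [OF that] by simp
      ultimately have "{t \<in> seams F'. germ_color (up \<phi>) (fst (coor F' t)) = 1} =
          (if inward = (\<phi> z = 1) then insert s Q else Q)"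
        unfolding F'_simps(2) Q_def by auto
      moreover have "finite Q" "s \<notin> Q" using tame_finite(1) [OF tame] s_new by (auto simp: Q_def)
      moreover have "seams_of_color_1 F \<phi> = int (card Q)" by (simp add: seams_of_color_1_def Q_def)
      ultimately show ?thesis unfolding seams_of_color_1_def [of F'] by simp
    qed
    have dots: "(\<Prod>p\<in>dots F'. alpha (up \<phi> p)) = (\<Prod>p\<in>dots F. alpha (\<phi> p))"
    proof (rule prod.cong)
      fix p assume "p \<in> dots F"
      then have "p \<in> region F - D" using tame gd by (auto simp: tame_def D_def)
      then show "alpha (up \<phi> p) = alpha (\<phi> p)" using sD by (auto simp: up_def)
    qed (simp add: F'_simps)
    have half: "(capped_chi F \<phi> + 2) div 2 = capped_chi F \<phi> div 2 + 1" by simp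
    have exponent: "(- 1 :: coeff) powi (seams_of_color_1 F' (up \<phi>) + capped_chi F' (up \<phi>) div 2) =
        (if inward then - 1 else 1) * (- 1) powi (seams_of_color_1 F \<phi> + capped_chi F \<phi> div 2)"
      unfolding count capped using zval [OF \<phi>]
      by (cases inward; cases "\<phi> z = 1") (auto simp: half minus_one_powi_add)
    show ?thesis unfolding weight_def exponent dots F'_simps(1) by simp
  qed
  ultimately have "(\<Sum>\<phi>\<in>colorings F'. weight F' \<phi>) = (\<Sum>\<phi>\<in>colorings F. (if inward then - 1 else 1) * weight F \<phi>)"
    by (subst sum.reindex_bij_betw [symmetric]) (auto intro: sum.cong)
  then show ?thesis
    unfolding evaluation_eq_sum_weight [OF tame] evaluation_eq_sum_weight [OF tame'] by (simp only: sum_distrib_left)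
qed

lemma evaluation_add_seam:
  assumes "tame F" "surface (surf F)" "f \<in> facets F" "pl_embedding D2 g" "g ` D2 \<subseteq> f" "g ` D2 \<inter> dots F = {}"
  shows "evaluation (add_seam_in g F) = - evaluation F" "evaluation (add_seam_out g F) = evaluation F"
  using evaluation_add_circle [OF assms, of "add_seam_in g F" True]
    evaluation_add_circle [OF assms, of "add_seam_out g F" False]
  by (simp_all add: add_seam_in_def add_seam_out_def Let_def)

section \<open>Neck-cutting\<close>

definition tube :: "((real^2) \<times> real \<Rightarrow> real^3) \<Rightarrow> real set \<Rightarrow> (real^3) set" where
  "tube h J = h ` (bdD2 \<times> J)"

definition cap :: "((real^2) \<times> real \<Rightarrow> real^3) \<Rightarrow> real \<Rightarrow> (real^3) set" where
  "cap h t = h ` (D2 \<times> {t})"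

text \<open>A sample point on the boundary circle at height \<open>t\<close>, above a corner of the
  square. Colors of caps and half tubes are read off there.\<close>

definition rim :: "((real^2) \<times> real \<Rightarrow> real^3) \<Rightarrow> real \<Rightarrow> real^3" where
  "rim h t = h (\<chi> i. 1, t)"

lemma tube_mono: "J \<subseteq> J' \<Longrightarrow> tube h J \<subseteq> tube h J'"
  unfolding tube_def by (intro image_mono) auto

lemma tube_upper: "tube h {1/2<..1} \<subseteq> tube h {1/2..1}"
  by (rule tube_mono) auto

lemma tube_ends: "tube h {0} \<subseteq> tube h {0..<1/2}" "tube h {1} \<subseteq> tube h {1/2<..1}"
  by (rule tube_mono; simp)+

lemma rim_tube: "t \<in> J \<Longrightarrow> rim h t \<in> tube h J"
proof -
  have "(\<chi> i. 1) \<in> bdD2" by (auto simp: frontier_cbox mem_box_cart)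
  then show "t \<in> J \<Longrightarrow> rim h t \<in> tube h J" by (auto simp: rim_def tube_def)
qed

lemma tube_cap: "tube h {t} \<subseteq> cap h t"
  unfolding tube_def cap_def using bdD2_facts(4) by (intro image_mono) auto

text \<open>The flag \<open>seamed\<close> tells whether the tube carries the seam \<open>tube h {1/2}\<close>, co-oriented
  upwards, or no seam at all.\<close>

context
  fixes F G :: seamed_surface and h :: "(real^2) \<times> real \<Rightarrow> real^3" and seamed :: bool
  assumes tameF: "tame F" and surfF: "surface (surf F)" and neck: "neck h F"
    and G_def: "G = cut_neck h F"
    and unseamed: "\<not> seamed \<Longrightarrow> {t \<in> seams F. t \<inter> tube h {0..1} \<noteq> {}} = {}"
    and seamed: "seamed \<Longrightarrow> {t \<in> seams F. t \<inter> tube h {0..1} \<noteq> {}} = {tube h {1/2}}"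
    and seamed_coor: "seamed \<Longrightarrow> coor F (tube h {1/2}) =
      (germ (tube h {1/2}) (tube h {0..<1/2}), germ (tube h {1/2}) (tube h {1/2<..1}))"
begin

section \<open>Tubes and caps inside the neck\<close>

lemma neck_embedding: "pl_embedding (D2 \<times> {0..1}) h" "inj_on h (D2 \<times> {0..1})" "continuous_on (D2 \<times> {0..1}) h"
  using neck by (auto simp: neck_def pl_embedding_def pl_on_continuous)

lemma neck_surf: "h ` (D2 \<times> {0..1}) \<inter> surf F = tube h {0..1}" "tube h {0..1} \<inter> dots F = {}"
  using neck by (simp_all add: neck_def tube_def)

lemma tube_surf: "J \<subseteq> {0..1} \<Longrightarrow> tube h J \<subseteq> surf F"
  using tube_mono neck_surf(1) by blast

lemma image_Int_neck:
  "\<lbrakk>A \<subseteq> D2 \<times> {0..1}; B \<subseteq> D2 \<times> {0..1}\<rbrakk> \<Longrightarrow> h ` A \<inter> h ` B = h ` (A \<inter> B)"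
  using inj_on_image_Int [OF neck_embedding(2)] by simp

lemma bd_times: "J \<subseteq> {0..1} \<Longrightarrow> bdD2 \<times> J \<subseteq> D2 \<times> {0..1::real}"
  using bdD2_facts(4) by (intro Sigma_mono) auto

lemma tube_Int: "\<lbrakk>J \<subseteq> {0..1}; J' \<subseteq> {0..1}\<rbrakk> \<Longrightarrow> tube h J \<inter> tube h J' = tube h (J \<inter> J')"
  unfolding tube_def by (subst image_Int_neck [OF bd_times bd_times]) (auto intro: arg_cong [where f = "\<lambda>A. h ` A"])

lemma tube_disjoint: "\<lbrakk>J \<subseteq> {0..1}; J' \<subseteq> {0..1}; J \<inter> J' = {}\<rbrakk> \<Longrightarrow> tube h J \<inter> tube h J' = {}"
  by (simp add: tube_Int) (simp add: tube_def)

lemma tube_Un: "tube h (J \<union> J') = tube h J \<union> tube h J'"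
  by (auto simp: tube_def)

lemma cap_Int_tube:
  assumes "t \<in> {0..1}" "J \<subseteq> {0..1}"
  shows "cap h t \<inter> tube h J = tube h (J \<inter> {t})"
proof -
  have "cap h t \<inter> tube h J = h ` ((D2 \<times> {t}) \<inter> (bdD2 \<times> J))"
    unfolding tube_def cap_def using assms by (intro image_Int_neck bd_times) auto
  also have "(D2 \<times> {t}) \<inter> (bdD2 \<times> J) = bdD2 \<times> (J \<inter> {t})" using bdD2_facts(4) by auto
  finally show ?thesis by (simp add: tube_def)
qed

lemma cap_surf:
  assumes "t \<in> {0..1}"
  shows "cap h t \<inter> surf F = tube h {t}"
proof -
  have "cap h t \<subseteq> h ` (D2 \<times> {0..1})" unfolding cap_def using assms by (intro image_mono) auto
  then have "cap h t \<inter> surf F = cap h t \<inter> tube h {0..1}" using neck_surf(1) by blast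
  also have "\<dots> = tube h ({0..1} \<inter> {t})" by (rule cap_Int_tube) (use assms in auto)
  also have "{0..1} \<inter> {t} = {t}" using assms by auto
  finally show ?thesis .
qed

lemma caps_disjoint: "cap h 0 \<inter> cap h 1 = {}"
proof -
  have "cap h 0 \<inter> cap h 1 = h ` ((D2 \<times> {0}) \<inter> (D2 \<times> {1}))"
    unfolding cap_def by (intro image_Int_neck) auto
  also have "(D2 \<times> {0}) \<inter> (D2 \<times> {1::real}) = {}" by auto
  finally show ?thesis by simp
qed

lemma compact_tube: "\<lbrakk>compact J; J \<subseteq> {0..1}\<rbrakk> \<Longrightarrow> compact (tube h J)"
  unfolding tube_def
  by (intro compact_continuous_image continuous_on_subset [OF neck_embedding(3)] compact_Times bdD2_facts bd_times)

lemma closed_tube: "\<lbrakk>compact J; J \<subseteq> {0..1}\<rbrakk> \<Longrightarrow> closed (tube h J)"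
  by (intro compact_imp_closed compact_tube)

lemma connected_tube: "\<lbrakk>connected J; J \<subseteq> {0..1}\<rbrakk> \<Longrightarrow> connected (tube h J)"
  unfolding tube_def
  by (intro connected_continuous_image continuous_on_subset [OF neck_embedding(3)] connected_Times bdD2_facts bd_times)

lemma cap_facts:
  assumes "t \<in> {0..1}"
  shows "closed (cap h t)" "connected (cap h t)" "has_chi (cap h t) 1" "polyset (cap h t)"
proof -
  have sub: "D2 \<times> {t} \<subseteq> D2 \<times> {0..1}" using assms by auto
  have "compact (D2 \<times> {t})" "connected (D2 \<times> {t})"
    by (auto intro!: compact_Times connected_Times convex_connected simp: compact_cbox convex_box)
  moreover have "continuous_on (D2 \<times> {t}) h" using neck_embedding(3) sub by (rule continuous_on_subset)
  ultimately show "closed (cap h t)" "connected (cap h t)"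
    unfolding cap_def by (auto intro: compact_imp_closed compact_continuous_image connected_continuous_image)
  have "has_chi (D2 \<times> {t}) 1" by (rule has_chi_times [OF has_chi_D2]) auto
  then show "has_chi (cap h t) 1"
    unfolding cap_def by (rule pl_embedding_has_chi [OF neck_embedding(1) _ sub])
  have "polytope {t}" using polytope_interval [of t t] by simp
  then have "polyset (D2 \<times> {t})" by (intro polyset_times polyset_polytope polytope_interval)
  then show "polyset (cap h t)"
    unfolding cap_def using neck_embedding(1) sub by (intro pl_on_polyset) (auto simp: pl_embedding_def)
qed

lemma tube_polyset:
  assumes "0 \<le> a" "a \<le> b" "b \<le> 1"
  shows "has_chi (tube h {a..b}) 0" "polyset (tube h {a..b})"
proof -
  have sub: "bdD2 \<times> {a..b} \<subseteq> D2 \<times> {0..1}" using assms by (intro bd_times) auto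
  have "has_chi (bdD2 \<times> {a..b}) 0" by (rule has_chi_times [OF has_chi_bdD2]) (use assms in auto)
  then show "has_chi (tube h {a..b}) 0"
    unfolding tube_def by (rule pl_embedding_has_chi [OF neck_embedding(1) _ sub])
  have "polytope {a..b}" using polytope_interval [of a b] by simp
  then have "polyset (bdD2 \<times> {a..b})" by (intro polyset_times polyset_frontier_cbox)
  then show "polyset (tube h {a..b})"
    unfolding tube_def using neck_embedding(1) sub by (intro pl_on_polyset) (auto simp: pl_embedding_def)
qed

lemma has_chi_half_tubes: "has_chi (tube h {0..<1/2}) 0" "has_chi (tube h {1/2<..1}) 0"
proof -
  have mid: "has_chi (tube h {1/2}) 0" using tube_polyset(1) [of "1/2" "1/2"] by simp
  have 0: "{0..1/2::real} = {0..<1/2} \<union> {1/2}" and 1: "{1/2..1::real} = {1/2<..1} \<union> {1/2}" by auto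
  have "tube h {0..<1/2} \<inter> tube h {1/2} = {}" "tube h {1/2<..1} \<inter> tube h {1/2} = {}"
    by (rule tube_disjoint; auto)+
  then have "tube h {0..<1/2} = tube h {0..1/2} - tube h {1/2}" "tube h {1/2<..1} = tube h {1/2..1} - tube h {1/2}"
    unfolding 0 1 tube_Un by auto
  moreover have sub: "tube h {1/2} \<subseteq> tube h {0..1/2}" "tube h {1/2} \<subseteq> tube h {1/2..1}"
    by (rule tube_mono; simp)+
  have "has_chi (tube h {0..1/2} - tube h {1/2}) (0 - 0)" "has_chi (tube h {1/2..1} - tube h {1/2}) (0 - 0)"
    using tube_polyset(1) [of 0 "1/2"] tube_polyset(1) [of "1/2" 1]
    by (intro has_chi_Diff mid sub; simp)+
  ultimately show "has_chi (tube h {0..<1/2}) 0" "has_chi (tube h {1/2<..1}) 0" by simp_all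
qed

text \<open>Polar coordinates turn the open tube into a planar annulus, so that invariance of domain applies.\<close>

lemma open_tube:
  assumes "open J" "J \<subseteq> {0..1}"
  shows "\<exists>V. open V \<and> tube h J = surf F \<inter> V"
proof -
  obtain d :: "complex \<Rightarrow> real^2" where d: "continuous_on (cball 0 1) d" "inj_on d (cball 0 1)"
      "d ` cball 0 1 = id ` D2" "d ` ball 0 1 = id ` interior D2" "d ` sphere 0 1 = id ` bdD2"
    by (rule disc_parametrization [of id]) (auto intro: continuous_on_id)
  \<comment> \<open>The radius is the height plus one, which keeps the annulus away from the origin,
    where \<open>sgn\<close> is discontinuous.\<close>
  define U where "U = {z::complex. norm z - 1 \<in> J}"
  define \<gamma> where "\<gamma> z = h (d (sgn z), norm z - 1)" for z :: complex
  have "open ((\<lambda>z::complex. norm z - 1) -` J)"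
    by (intro open_vimage assms(1) continuous_intros)
  then have opU: "open U" by (simp add: U_def vimage_def)
  have nz: "z \<noteq> 0" if "z \<in> U" for z using that assms(2) by (auto simp: U_def)
  have polar: "(d (sgn z), norm z - 1) \<in> bdD2 \<times> J" if "z \<in> U" for z
  proof -
    have "sgn z \<in> sphere 0 1" using nz [OF that] by (simp add: norm_sgn)
    then have "d (sgn z) \<in> d ` sphere 0 1" by (rule imageI)
    then show ?thesis using that d(5) by (auto simp: U_def)
  qed
  have "continuous_on U \<gamma>"
    unfolding \<gamma>_def
  proof (rule continuous_on_compose2 [OF neck_embedding(3)])
    show "continuous_on U (\<lambda>z. (d (sgn z), norm z - 1))"
      using nz by (intro continuous_intros continuous_on_compose2 [OF d(1)]) (auto simp: norm_sgn)
    show "(\<lambda>z. (d (sgn z), norm z - 1)) ` U \<subseteq> D2 \<times> {0..1}" using polar bd_times [OF assms(2)] by blast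
  qed
  moreover have "inj_on \<gamma> U"
  proof (rule inj_onI)
    fix z w assume zw: "z \<in> U" "w \<in> U" "\<gamma> z = \<gamma> w"
    then have "(d (sgn z), norm z - 1) = (d (sgn w), norm w - 1)"
      using polar bd_times [OF assms(2)] neck_embedding(2) unfolding \<gamma>_def by (meson inj_onD subsetD)
    then have "d (sgn z) = d (sgn w)" "norm z = norm w" by auto
    moreover have "sgn z \<in> cball 0 1" "sgn w \<in> cball 0 1" by (simp_all add: norm_sgn)
    ultimately have "sgn z = sgn w" "norm z = norm w" using d(2) by (auto dest: inj_onD)
    then show "z = w" by (metis scaleR_one sgn_div_norm norm_eq_zero divideR_right sgn_zero_iff)
  qed
  moreover have img: "\<gamma> ` U = tube h J"
  proof (intro subset_antisym subsetI)
    fix x assume "x \<in> \<gamma> ` U"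
    then show "x \<in> tube h J" using polar unfolding \<gamma>_def tube_def by blast
  next
    fix x assume "x \<in> tube h J"
    then obtain b t where bt: "b \<in> bdD2" "t \<in> J" "x = h (b, t)" unfolding tube_def by blast
    then obtain w where w: "norm w = 1" "b = d w" using d(5) by (force simp: image_iff)
    have t: "0 \<le> t" using bt(2) assms(2) by auto
    define z where "z = (1 + t) *\<^sub>R w"
    have "norm z = 1 + t" using w t by (simp add: z_def)
    moreover have "sgn z = w" using w t by (simp add: z_def sgn_scaleR sgn_div_norm)
    ultimately have "z \<in> U" "\<gamma> z = x" using bt w by (auto simp: U_def \<gamma>_def)
    then show "x \<in> \<gamma> ` U" by blast
  qed
  ultimately have "openin (top_of_set (surf F)) (\<gamma> ` U)"
    using opU tube_surf [OF assms(2)] by (intro surface_invariance_of_domain [OF surfF]) auto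
  then show ?thesis unfolding img openin_open by blast
qed

section \<open>The surface after cutting\<close>

lemma G_simps: "surf G = (surf F - tube h {0..1}) \<union> cap h 0 \<union> cap h 1"
  "seams G = {s \<in> seams F. s \<inter> tube h {0..1} = {}}" "coor G = coor F" "dots G = dots F"
  by (simp_all add: G_def cut_neck_def tube_def cap_def)

lemma seams_F: "seams F = (if seamed then insert (tube h {1/2}) (seams G) else seams G)"
  "seamed \<Longrightarrow> tube h {1/2} \<notin> seams G"
proof -
  have "rim h (1/2) \<in> tube h {1/2}" by (rule rim_tube) simp
  moreover have "tube h {1/2} \<subseteq> tube h {0..1}" by (rule tube_mono) auto
  ultimately show "seamed \<Longrightarrow> tube h {1/2} \<notin> seams G" unfolding G_simps by blast
  have "seams F = seams G \<union> {t \<in> seams F. t \<inter> tube h {0..1} \<noteq> {}}" unfolding G_simps by blast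
  then show "seams F = (if seamed then insert (tube h {1/2}) (seams G) else seams G)"
    using seamed unseamed by (cases seamed) auto
qed

lemma seam_avoids_neck:
  assumes "t \<in> seams G"
  shows "t \<in> seams F" "t \<inter> (tube h {0..1} \<union> cap h 0 \<union> cap h 1) = {}"
proof -
  show t: "t \<in> seams F" using assms by (simp add: G_simps)
  have "t \<subseteq> surf F" using tame_seam(1) [OF tameF t] .
  moreover have "cap h 0 \<inter> surf F \<subseteq> tube h {0..1}" "cap h 1 \<inter> surf F \<subseteq> tube h {0..1}"
    by (simp_all add: cap_surf tube_mono)
  moreover have "t \<inter> tube h {0..1} = {}" using assms by (simp add: G_simps)
  ultimately show "t \<inter> (tube h {0..1} \<union> cap h 0 \<union> cap h 1) = {}" by blast
qed

lemma closed_neck: "closed (tube h {0..1} \<union> cap h 0 \<union> cap h 1)"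
  by (intro closed_Un closed_tube cap_facts) auto

lemma tube_region:
  assumes "J \<subseteq> {0..1}" "1/2 \<notin> J \<or> \<not> seamed"
  shows "tube h J \<subseteq> region F"
proof -
  have "tube h J \<inter> t = {}" if t: "t \<in> seams F" for t
  proof (cases "t \<in> seams G")
    case True
    then show ?thesis using seam_avoids_neck(2) tube_mono [OF assms(1)] by blast
  next
    case False
    then have "seamed" "t = tube h {1/2}" using t seams_F(1) by (auto split: if_splits)
    moreover then have "J \<inter> {1/2} = {}" using assms(2) by auto
    ultimately show ?thesis using tube_disjoint [OF assms(1), of "{1/2}"] by simp
  qed
  then show ?thesis using tube_surf [OF assms(1)] unfolding region_def by blast
qed

lemma region_G: "region G = (region F - tube h {0..1}) \<union> cap h 0 \<union> cap h 1"
proof -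
  have "tube h {1/2} \<subseteq> tube h {0..1}" by (rule tube_mono) auto
  moreover have "\<Union>(seams F) = (if seamed then tube h {1/2} else {}) \<union> \<Union>(seams G)"
    by (subst seams_F(1)) simp
  moreover have "\<Union>(seams G) \<inter> tube h {0..1} = {}" using seam_avoids_neck(2) by blast
  ultimately have "\<Union>(seams F) - tube h {0..1} = \<Union>(seams G)" by (auto split: if_splits)
  moreover have "\<Union>(seams G) \<inter> (cap h 0 \<union> cap h 1) = {}" using seam_avoids_neck(2) by blast
  ultimately show ?thesis unfolding region_def G_simps(1) by blast
qed

lemma region_F: "x \<in> region F \<Longrightarrow> x \<in> tube h {0..1} \<Longrightarrow>
   x \<in> tube h {0..<1/2} \<or> x \<in> tube h {1/2<..1} \<or> \<not> seamed \<and> x \<in> tube h {1/2}"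
proof -
  assume x: "x \<in> region F" "x \<in> tube h {0..1}"
  have "{0..1} = {0..<1/2} \<union> {1/2<..1} \<union> {1/2::real}" by auto
  then have "x \<in> tube h {0..<1/2} \<union> tube h {1/2<..1} \<union> tube h {1/2}" using x(2) by (simp only: tube_Un)
  moreover have "x \<notin> tube h {1/2}" if seamed using x(1) seams_F(1) that by (auto simp: region_def)
  ultimately show ?thesis by blast
qed

lemma surf_G_polyset: "polyset (surf G)"
proof -
  have "\<exists>K. simplicial_complex K \<and> (\<forall>A\<in>{surf F, tube h {0..1}, cap h 0, cap h 1}. cellular K A)"
    by (rule polysets_common_refinement) (use tameF tube_polyset(2) cap_facts(4) in \<open>auto simp: tame_def\<close>)
  then obtain K where K: "cellular K (surf F)" "cellular K (tube h {0..1})" "cellular K (cap h 0)" "cellular K (cap h 1)"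
    by auto
  have "cellular K (surf G)" unfolding G_simps(1) using K by (intro cellular_Un cellular_Diff)
  moreover have "closed (surf G)"
  proof -
    \<comment> \<open>Closedness is not visible from removing the closed tube. The caps contain its
      end circles, so removing the open tube gives the same surface, and the open tube is relatively
      open.\<close>
    have J: "{0<..<1::real} \<subseteq> {0..1}" by auto
    from open_tube [OF open_greaterThanLessThan this]
    obtain V where V: "open V" "tube h {0<..<1} = surf F \<inter> V" by blast
    have "{0..1} = {0<..<1} \<union> {0} \<union> {1::real}" by auto
    then have "tube h {0..1} = tube h {0<..<1} \<union> tube h {0} \<union> tube h {1}" by (simp only: tube_Un)
    moreover have "tube h {0<..<1} \<inter> cap h 0 = {}" "tube h {0<..<1} \<inter> cap h 1 = {}"
      using cap_Int_tube [OF _ J, of 0] cap_Int_tube [OF _ J, of 1] by (simp_all add: tube_def Int_commute)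
    ultimately have "surf G = (surf F - V) \<union> cap h 0 \<union> cap h 1"
      using tube_cap [of h 0] tube_cap [of h 1] V(2) unfolding G_simps(1) by blast
    moreover have "closed (surf F)" by (rule tame_closed(1) [OF tameF])
    ultimately show ?thesis using V(1) by (simp add: closed_Diff closed_Un cap_facts)
  qed
  ultimately show ?thesis by (rule cellular_closed_polyset)
qed

text \<open>The removed tube has characteristic 0 and each new cap 1.\<close>

lemma chi_surf_G: "chi (surf G) = chi (surf F) + 2"
proof -
  have F: "has_chi (surf F) (chi (surf F))" using tameF by (intro polyset_has_chi) (simp add: tame_def)
  have "has_chi (surf F - tube h {0..1}) (chi (surf F) - 0)"
    using tube_polyset(1) [of 0 1] tube_surf by (intro has_chi_Diff [OF F]) auto
  moreover have "(surf F - tube h {0..1}) \<inter> cap h 0 = {}" "(surf F - tube h {0..1}) \<inter> cap h 1 = {}"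
    using cap_surf [of 0] cap_surf [of 1] tube_mono [of "{0}" "{0..1}" h] tube_mono [of "{1}" "{0..1}" h] by auto
  ultimately have "has_chi (surf G) (chi (surf F) - 0 + 1 + 1)"
    unfolding G_simps(1) using cap_facts(3) [of 0] cap_facts(3) [of 1] caps_disjoint
    by (intro has_chi_Un) auto
  then show ?thesis using chi_unique by fastforce
qed

lemma dots_G: "dots F \<subseteq> region F - tube h {0..1}" "dots F \<inter> (cap h 0 \<union> cap h 1) = {}"
proof -
  show sub: "dots F \<subseteq> region F - tube h {0..1}" using tameF neck_surf(2) by (auto simp: tame_def)
  have "cap h 0 \<inter> surf F \<subseteq> tube h {0..1}" "cap h 1 \<inter> surf F \<subseteq> tube h {0..1}"
    by (simp_all add: cap_surf tube_mono)
  then show "dots F \<inter> (cap h 0 \<union> cap h 1) = {}" using sub unfolding region_def by blast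
qed

lemma tame_G: "tame G"
  unfolding tame_def
proof (intro conjI ballI)
  show "polyset (surf G)" by (rule surf_G_polyset)
  show "finite (seams G)" "finite (dots G)" using tame_finite [OF tameF] by (simp_all add: G_simps)
  have "pairwise disjnt (seams F)" using tameF by (simp add: tame_def)
  then show "pairwise disjnt (seams G)" by (rule pairwise_subset) (auto simp: G_simps)
  show "dots G \<subseteq> region G" using dots_G unfolding region_G G_simps by blast
  fix t assume t: "t \<in> seams G"
  note tF = tame_seam [OF tameF seam_avoids_neck(1) [OF t]]
  show "t \<subseteq> surf G" using tF(1) seam_avoids_neck(2) [OF t] unfolding G_simps(1) by blast
  show "polyset t" "t \<noteq> {}" "has_chi t 0" using tF by simp_all
  let ?V = "- (tube h {0..1} \<union> cap h 0 \<union> cap h 1)"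
  have V: "open ?V" "t \<subseteq> ?V" "surf F \<inter> ?V \<subseteq> surf G"
  proof -
    show "open ?V" using closed_neck by (rule open_Compl)
    show "t \<subseteq> ?V" using seam_avoids_neck(2) [OF t] by blast
    show "surf F \<inter> ?V \<subseteq> surf G" unfolding G_simps(1) by blast
  qed
  show "side (surf G) t (fst (coor G t))" "side (surf G) t (snd (coor G t))"
    unfolding G_simps(3) using tF(5,6) side_cong V by blast+
qed

lemma seam_eventually:
  assumes "t \<in> seams G"
  shows "\<forall>\<^sub>F x in fst (coor F t). x \<in> region F - (tube h {0..1} \<union> cap h 0 \<union> cap h 1)"
    "\<forall>\<^sub>F x in snd (coor F t). x \<in> region F - (tube h {0..1} \<union> cap h 0 \<union> cap h 1)"
proof -
  have tF: "t \<in> seams F" using seam_avoids_neck(1) [OF assms] .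
  let ?A = "(tube h {0..1} \<union> cap h 0 \<union> cap h 1) \<union> \<Union>(seams F - {t})"
  have cl: "closed ?A"
    by (rule closed_Un [OF closed_neck tame_closed(2) [OF tameF Diff_subset]])
  have dj: "t \<inter> ?A = {}" using seam_avoids_neck(2) [OF assms] tame_disjoint [OF tameF tF] by blast
  have "\<forall>\<^sub>F x in fst (coor F t). x \<in> surf F - ?A - t" "\<forall>\<^sub>F x in snd (coor F t). x \<in> surf F - ?A - t"
    using side_eventually_not [OF tame_seam(5) [OF tameF tF] cl dj]
      side_eventually_not [OF tame_seam(6) [OF tameF tF] cl dj] by simp_all
  then show "\<forall>\<^sub>F x in fst (coor F t). x \<in> region F - (tube h {0..1} \<union> cap h 0 \<union> cap h 1)"
    "\<forall>\<^sub>F x in snd (coor F t). x \<in> region F - (tube h {0..1} \<union> cap h 0 \<union> cap h 1)"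
    by (auto simp: region_def elim!: eventually_mono)
qed

section \<open>Transport of colorings through the cut\<close>

definition cut :: "(real^3 \<Rightarrow> nat) \<Rightarrow> real^3 \<Rightarrow> nat" where
  "cut \<phi> = (\<lambda>x\<in>region G. if x \<in> cap h 0 then \<phi> (rim h 0) else if x \<in> cap h 1 then \<phi> (rim h 1) else \<phi> x)"

text \<open>The middle circle is counted with the upper half. On a seamed tube it lies outside
  \<open>region F\<close>; on an unseamed one the two rim colors agree for the colorings that are
  glued.\<close>

definition glue :: "(real^3 \<Rightarrow> nat) \<Rightarrow> real^3 \<Rightarrow> nat" where
  "glue \<psi> = (\<lambda>x\<in>region F. if x \<in> tube h {0..<1/2} then \<psi> (rim h 0)
     else if x \<in> tube h {1/2..1} then \<psi> (rim h 1) else \<psi> x)"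

lemma rim_region: "rim h 0 \<in> region F" "rim h 1 \<in> region F" "rim h 0 \<in> cap h 0" "rim h 1 \<in> cap h 1"
  using tube_region [of "{0}"] tube_region [of "{1}"] rim_tube [of _ "{_}" h] tube_cap by (auto simp: subset_iff)

lemma rim_color:
  assumes \<phi>: "\<phi> \<in> colorings F"
  shows "x \<in> tube h {0..<1/2} \<Longrightarrow> \<phi> x = \<phi> (rim h 0)" "x \<in> tube h {1/2<..1} \<Longrightarrow> \<phi> x = \<phi> (rim h 1)"
    "\<lbrakk>\<not> seamed; x \<in> tube h {0..1}\<rbrakk> \<Longrightarrow> \<phi> x = \<phi> (rim h 0)" "\<lbrakk>\<not> seamed; x \<in> tube h {0..1}\<rbrakk> \<Longrightarrow> \<phi> x = \<phi> (rim h 1)"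
proof -
  have lc: "loc_const (region F) \<phi>" using \<phi> by (simp add: colorings_def)
  have *: "\<phi> x = \<phi> (rim h t)" if "J \<subseteq> {0..1}" "1/2 \<notin> J \<or> \<not> seamed" "connected J" "x \<in> tube h J" "t \<in> J" for x t J
    using loc_const_connected [OF lc connected_tube [OF that(3,1)] tube_region [OF that(1,2)] that(4) rim_tube [OF that(5)]] .
  show "x \<in> tube h {0..<1/2} \<Longrightarrow> \<phi> x = \<phi> (rim h 0)" by (rule * [of "{0..<1/2}"]) auto
  show "x \<in> tube h {1/2<..1} \<Longrightarrow> \<phi> x = \<phi> (rim h 1)" by (rule * [of "{1/2<..1}"]) auto
  show "\<lbrakk>\<not> seamed; x \<in> tube h {0..1}\<rbrakk> \<Longrightarrow> \<phi> x = \<phi> (rim h 0)" by (rule * [of "{0..1}"]) auto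
  show "\<lbrakk>\<not> seamed; x \<in> tube h {0..1}\<rbrakk> \<Longrightarrow> \<phi> x = \<phi> (rim h 1)" by (rule * [of "{0..1}"]) auto
qed

lemma cap_color:
  assumes \<psi>: "\<psi> \<in> colorings G"
  shows "x \<in> cap h 0 \<Longrightarrow> \<psi> x = \<psi> (rim h 0)" "x \<in> cap h 1 \<Longrightarrow> \<psi> x = \<psi> (rim h 1)"
proof -
  have lc: "loc_const (region G) \<psi>" using \<psi> by (simp add: colorings_def)
  have sub: "cap h 0 \<subseteq> region G" "cap h 1 \<subseteq> region G" by (auto simp: region_G)
  show "x \<in> cap h 0 \<Longrightarrow> \<psi> x = \<psi> (rim h 0)"
    using loc_const_connected [OF lc cap_facts(2) sub(1) _ rim_region(3)] by simp
  show "x \<in> cap h 1 \<Longrightarrow> \<psi> x = \<psi> (rim h 1)"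
    using loc_const_connected [OF lc cap_facts(2) sub(2) _ rim_region(4)] by simp
qed

lemma cut_simps:
  "x \<in> cap h 0 \<Longrightarrow> cut \<phi> x = \<phi> (rim h 0)" "x \<in> cap h 1 \<Longrightarrow> cut \<phi> x = \<phi> (rim h 1)"
  "\<lbrakk>x \<in> region F; x \<notin> tube h {0..1}; x \<notin> cap h 0; x \<notin> cap h 1\<rbrakk> \<Longrightarrow> cut \<phi> x = \<phi> x"
  using caps_disjoint by (auto simp: cut_def region_G)

lemma outside_caps: "\<lbrakk>x \<in> surf F; x \<notin> tube h {0..1}\<rbrakk> \<Longrightarrow> x \<notin> cap h 0 \<and> x \<notin> cap h 1"
  using cap_surf [of 0] cap_surf [of 1] tube_mono [of "{0}" "{0..1}" h] tube_mono [of "{1}" "{0..1}" h] by auto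

lemma glue_simps:
  "\<lbrakk>x \<in> region F; x \<in> tube h {0..<1/2}\<rbrakk> \<Longrightarrow> glue \<psi> x = \<psi> (rim h 0)"
  "\<lbrakk>x \<in> region F; x \<in> tube h {1/2..1}\<rbrakk> \<Longrightarrow> glue \<psi> x = \<psi> (rim h 1)"
  "\<lbrakk>x \<in> region F; x \<notin> tube h {0..1}\<rbrakk> \<Longrightarrow> glue \<psi> x = \<psi> x"
proof -
  show "\<lbrakk>x \<in> region F; x \<in> tube h {0..<1/2}\<rbrakk> \<Longrightarrow> glue \<psi> x = \<psi> (rim h 0)" by (simp add: glue_def)
  have "tube h {0..<1/2} \<inter> tube h {1/2..1} = {}" by (rule tube_disjoint) auto
  then show "\<lbrakk>x \<in> region F; x \<in> tube h {1/2..1}\<rbrakk> \<Longrightarrow> glue \<psi> x = \<psi> (rim h 1)" by (auto simp: glue_def)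
  have "tube h {0..<1/2} \<subseteq> tube h {0..1}" "tube h {1/2..1} \<subseteq> tube h {0..1}" by (rule tube_mono; auto)+
  then show "\<lbrakk>x \<in> region F; x \<notin> tube h {0..1}\<rbrakk> \<Longrightarrow> glue \<psi> x = \<psi> x" by (auto simp: glue_def)
qed

lemma coloring_nbhd:
  assumes "\<phi> \<in> colorings S" "x \<in> region S"
  obtains W where "open W" "x \<in> W" "\<And>y. \<lbrakk>y \<in> W; y \<in> region S\<rbrakk> \<Longrightarrow> \<phi> y = \<phi> x"
proof -
  have "loc_const (region S) \<phi>" using assms(1) by (simp add: colorings_def)
  then obtain W where "open W" "x \<in> W" "\<forall>y\<in>W \<inter> region S. \<phi> y = \<phi> x"
    using assms(2) unfolding loc_const_def by blast
  then show thesis using that by simp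
qed

text \<open>A cap point off \<open>surf F\<close> has a neighbourhood in which the region of
  \<open>G\<close> consists of that cap alone. On the boundary circle, local constancy of
  \<open>\<phi>\<close> along \<open>F\<close> joins the cap to the surface outside the neck. The
  pair \<open>t\<close>, \<open>t'\<close> treats both caps at once.\<close>

lemma cut_nbhd_cap:
  fixes t t' :: real
  assumes \<phi>: "\<phi> \<in> colorings F" and t: "t = 0 \<and> t' = 1 \<or> t = 1 \<and> t' = 0" and x: "x \<in> cap h t"
  shows "\<exists>W. open W \<and> x \<in> W \<and> (\<forall>y\<in>W \<inter> region G. cut \<phi> y = \<phi> (rim h t))"
proof -
  have tt: "t \<in> {0..1}" "t' \<in> {0..1}" "cap h t \<inter> cap h t' = {}" using t caps_disjoint by auto
  have cl: "closed (cap h t')" by (rule cap_facts(1) [OF tt(2)])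
  have clF: "closed (surf F)" by (rule tame_closed(1) [OF tameF])
  have reg: "y \<in> cap h t \<or> y \<in> region F \<and> y \<notin> tube h {0..1} \<and> y \<notin> cap h 0 \<and> y \<notin> cap h 1"
    if "y \<in> region G" "y \<notin> cap h t'" for y
    using that t outside_caps [of y] unfolding region_G by (auto simp: region_def)
  have cap: "cut \<phi> y = \<phi> (rim h t)" if "y \<in> cap h t" for y using that t cut_simps(1,2) by auto
  show ?thesis
  proof (cases "x \<in> surf F")
    case False
    have "cut \<phi> y = \<phi> (rim h t)" if "y \<in> - (surf F \<union> cap h t') \<inter> region G" for y
      using reg [of y] that cap by (auto simp: region_def)
    moreover have "open (- (surf F \<union> cap h t'))" using cl clF by (intro open_Compl closed_Un)
    ultimately show ?thesis using False x tt(3) by (intro exI [of _ "- (surf F \<union> cap h t')"]) auto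
  next
    case True
    then have xt: "x \<in> tube h {t}" using cap_surf [OF tt(1)] x by blast
    have xr: "x \<in> region F" using tube_region [of "{t}"] xt t by auto
    have col: "\<phi> x = \<phi> (rim h t)"
      using rim_color(1,2) [OF \<phi>, of x] xt t tube_ends by blast
    obtain W where W: "open W" "x \<in> W" "\<And>y. \<lbrakk>y \<in> W; y \<in> region F\<rbrakk> \<Longrightarrow> \<phi> y = \<phi> x"
      using coloring_nbhd [OF \<phi> xr] by metis
    have "cut \<phi> y = \<phi> (rim h t)" if "y \<in> (W - cap h t') \<inter> region G" for y
      using reg [of y] that cap cut_simps(3) [of y \<phi>] W(3) col by auto
    then show ?thesis using W(1,2) cl x tt(3) by (intro exI [of _ "W - cap h t'"]) (auto intro: open_Diff)
  qed
qed

text \<open>The co-orientation points upwards, out of the lower half, so the seam has the color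
  found at the bottom rim.\<close>

lemma rim_colors_match:
  assumes \<phi>: "\<phi> \<in> colorings F"
  shows "\<phi> (rim h 0) = \<phi> (rim h 1) \<longleftrightarrow> \<not> seamed"
    "seamed \<Longrightarrow> germ_color \<phi> (fst (coor F (tube h {1/2}))) = \<phi> (rim h 0)"
proof -
  have s: "tube h {1/2} \<in> seams F" if seamed using that seams_F(1) by simp
  have germ: "germ_color \<phi> (fst (coor F (tube h {1/2}))) = \<phi> (rim h 0)"
      "germ_color \<phi> (snd (coor F (tube h {1/2}))) = \<phi> (rim h 1)" if seamed
  proof -
    have "\<forall>\<^sub>F x in germ (tube h {1/2}) (tube h {0..<1/2}). \<phi> x = \<phi> (rim h 0)"
        "\<forall>\<^sub>F x in germ (tube h {1/2}) (tube h {1/2<..1}). \<phi> x = \<phi> (rim h 1)"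
      using rim_color(1,2) [OF \<phi>] unfolding eventually_germ by (intro exI [of _ UNIV]; simp)+
    then show "germ_color \<phi> (fst (coor F (tube h {1/2}))) = \<phi> (rim h 0)"
        "germ_color \<phi> (snd (coor F (tube h {1/2}))) = \<phi> (rim h 1)"
      using tame_seam(7,8) [OF tameF s [OF that]] unfolding seamed_coor [OF that]
      by (auto intro!: germ_color_eq)
  qed
  then show "seamed \<Longrightarrow> germ_color \<phi> (fst (coor F (tube h {1/2}))) = \<phi> (rim h 0)" by simp
  show "\<phi> (rim h 0) = \<phi> (rim h 1) \<longleftrightarrow> \<not> seamed"
  proof (cases seamed)
    case True
    have "germ_color \<phi> (fst (coor F (tube h {1/2}))) \<noteq> germ_color \<phi> (snd (coor F (tube h {1/2})))"
      using \<phi> s [OF True] by (simp add: colorings_def)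
    then show ?thesis using germ True by simp
  next
    case False
    have "rim h 0 \<in> tube h {0..1}" by (rule rim_tube) simp
    then show ?thesis using rim_color(4) [OF \<phi> False] False by simp
  qed
qed

lemma cut_germ:
  assumes "t \<in> seams G"
  shows "germ_color (cut \<phi>) (fst (coor F t)) = germ_color \<phi> (fst (coor F t))"
    "germ_color (cut \<phi>) (snd (coor F t)) = germ_color \<phi> (snd (coor F t))"
  by (rule germ_color_cong, rule eventually_mono [OF seam_eventually(1) [OF assms]], simp add: cut_simps)
    (rule germ_color_cong, rule eventually_mono [OF seam_eventually(2) [OF assms]], simp add: cut_simps)

lemma glue_germ:
  assumes "t \<in> seams G"
  shows "germ_color (glue \<phi>) (fst (coor F t)) = germ_color \<phi> (fst (coor F t))"
    "germ_color (glue \<phi>) (snd (coor F t)) = germ_color \<phi> (snd (coor F t))"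
  by (rule germ_color_cong, rule eventually_mono [OF seam_eventually(1) [OF assms]], simp add: glue_simps)
    (rule germ_color_cong, rule eventually_mono [OF seam_eventually(2) [OF assms]], simp add: glue_simps)

lemma cut_coloring:
  assumes \<phi>: "\<phi> \<in> colorings F"
  shows "cut \<phi> \<in> colorings G"
  unfolding colorings_def
proof (intro CollectI conjI ballI)
  show "cut \<phi> \<in> region G \<rightarrow>\<^sub>E {1, 2}"
  proof (rule PiE_I)
    fix x assume "x \<in> region G"
    then show "cut \<phi> x \<in> {1, 2}"
      using coloring_values [OF \<phi>] rim_region(1,2) by (auto simp: cut_def region_G)
  qed (auto simp: cut_def)
  show "loc_const (region G) (cut \<phi>)"
    unfolding loc_const_def
  proof
    fix x assume x: "x \<in> region G"
    consider "x \<in> cap h 0" | "x \<in> cap h 1" | "x \<in> region F" "x \<notin> tube h {0..1}" "x \<notin> cap h 0" "x \<notin> cap h 1"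
      using x unfolding region_G by blast
    then show "\<exists>W. open W \<and> x \<in> W \<and> (\<forall>y\<in>W \<inter> region G. cut \<phi> y = cut \<phi> x)"
    proof cases
      case 1
      then show ?thesis using cut_nbhd_cap [OF \<phi>, of 0 1] cut_simps(1) by simp
    next
      case 2
      then show ?thesis using cut_nbhd_cap [OF \<phi>, of 1 0] cut_simps(2) by simp
    next
      case 3
      obtain W where W: "open W" "x \<in> W" "\<And>y. \<lbrakk>y \<in> W; y \<in> region F\<rbrakk> \<Longrightarrow> \<phi> y = \<phi> x"
        using coloring_nbhd [OF \<phi> 3(1)] by metis
      have "cut \<phi> y = cut \<phi> x" if "y \<in> (W - (tube h {0..1} \<union> cap h 0 \<union> cap h 1)) \<inter> region G" for y
      proof -
        have "y \<in> region F" "y \<notin> tube h {0..1}" "y \<notin> cap h 0" "y \<notin> cap h 1" "y \<in> W"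
          using that by (auto simp: region_G)
        then show ?thesis using cut_simps(3) [OF 3] cut_simps(3) [of y] W(3) by simp
      qed
      moreover have "open (W - (tube h {0..1} \<union> cap h 0 \<union> cap h 1))" using W(1) closed_neck by (rule open_Diff)
      ultimately show ?thesis
        using W(2) 3 by (intro exI [of _ "W - (tube h {0..1} \<union> cap h 0 \<union> cap h 1)"]) auto
    qed
  qed
  fix t assume t: "t \<in> seams G"
  have "germ_color \<phi> (fst (coor F t)) \<noteq> germ_color \<phi> (snd (coor F t))"
    using \<phi> seam_avoids_neck(1) [OF t] by (simp add: colorings_def)
  then show "germ_color (cut \<phi>) (fst (coor G t)) \<noteq> germ_color (cut \<phi>) (snd (coor G t))"
    unfolding G_simps(3) cut_germ [OF t] .
qed

text \<open>Treats the two half tubes \<open>V\<close> uniformly, \<open>t\<close> being the end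
  height and \<open>V'\<close> the rest of the tube. Away from the end circle the half tube is open
  in the surface; at the end circle the color is continued from the cap by local constancy of
  \<open>\<psi>\<close>.\<close>

lemma glue_nbhd_tube:
  fixes V V' :: "real set" and t :: real
  assumes "V = {0..<1/2} \<and> t = 0 \<and> V' = {1/2..1} \<or> V = {1/2<..1} \<and> t = 1 \<and> V' = {0..1/2}"
    and \<psi>: "\<psi> \<in> colorings G" and x: "x \<in> tube h V"
  shows "\<exists>W. open W \<and> x \<in> W \<and> (\<forall>y\<in>W \<inter> region F. glue \<psi> y = \<psi> (rim h t))"
proof -
  have V: "V \<subseteq> {0..1}" "V' \<subseteq> {0..1}" "V \<inter> V' = {}" "compact V'" "V \<union> V' = {0..1}" "t \<in> {0..1}" "t \<in> V" "V - {t} = {0<..<1/2} \<or> V - {t} = {1/2<..<1}"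
    using assms(1) by auto
  have glueV: "glue \<psi> y = \<psi> (rim h t)" if "y \<in> region F" "y \<in> tube h V" for y
    using assms(1) that glue_simps(1,2) [of y \<psi>] tube_upper by auto
  show ?thesis
  proof (cases "x \<in> tube h {t}")
    case False
    have "V = (V - {t}) \<union> {t}" using V(7) by auto
    then have "tube h V = tube h (V - {t}) \<union> tube h {t}" by (metis tube_Un)
    then have x': "x \<in> tube h (V - {t})" using x False by blast
    have "open (V - {t})" using V(8) open_greaterThanLessThan by metis
    then obtain O' where O': "open O'" "tube h (V - {t}) = surf F \<inter> O'" using open_tube [of "V - {t}"] V(1) by auto
    have "glue \<psi> y = \<psi> (rim h t)" if "y \<in> O' \<inter> region F" for y
    proof -
      have "y \<in> tube h (V - {t})" using that O'(2) by (auto simp: region_def)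
      then have "y \<in> tube h V" using tube_mono [of "V - {t}" V h] by auto
      then show ?thesis using glueV that by simp
    qed
    then show ?thesis using O' x' by blast
  next
    case True
    then have xc: "x \<in> cap h t" using tube_cap by blast
    have t: "t = 0 \<or> t = 1" using assms(1) by auto
    then have xG: "x \<in> region G" using xc by (auto simp: region_G)
    obtain W where W: "open W" "x \<in> W" "\<And>y. \<lbrakk>y \<in> W; y \<in> region G\<rbrakk> \<Longrightarrow> \<psi> y = \<psi> x"
      using coloring_nbhd [OF \<psi> xG] by metis
    have col: "\<psi> x = \<psi> (rim h t)" using cap_color [OF \<psi>] xc t by auto
    have "glue \<psi> y = \<psi> (rim h t)" if y: "y \<in> (W - tube h V') \<inter> region F" for y
    proof (cases "y \<in> tube h {0..1}")
      case True
      then have "y \<in> tube h V" using y tube_Un [of V V'] V(5) by auto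
      then show ?thesis using glueV y by simp
    next
      case False
      then have "y \<in> region G" using y by (simp add: region_G)
      then show ?thesis using W(3) y col glue_simps(3) False by simp
    qed
    moreover have "open (W - tube h V')" using W(1) closed_tube [OF V(4,2)] by (rule open_Diff)
    moreover have "x \<notin> tube h V'" using x tube_disjoint [OF V(1,2,3)] by blast
    ultimately show ?thesis using W(2) by (intro exI [of _ "W - tube h V'"]) auto
  qed
qed

lemma glue_coloring:
  assumes \<psi>: "\<psi> \<in> colorings G" and match: "\<psi> (rim h 0) = \<psi> (rim h 1) \<longleftrightarrow> \<not> seamed"
  shows "glue \<psi> \<in> colorings F"
  unfolding colorings_def
proof (intro CollectI conjI ballI)
  have rimG: "rim h 0 \<in> region G" "rim h 1 \<in> region G" using rim_region by (auto simp: region_G)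
  show "glue \<psi> \<in> region F \<rightarrow>\<^sub>E {1, 2}"
  proof (rule PiE_I)
    fix x assume x: "x \<in> region F"
    have "{0..1} = {0..<1/2} \<union> {1/2..1::real}" by auto
    then have "tube h {0..1} = tube h {0..<1/2} \<union> tube h {1/2..1}" by (simp only: tube_Un)
    then show "glue \<psi> x \<in> {1, 2}"
      using x coloring_values [OF \<psi>, of x] coloring_values [OF \<psi> rimG(1)] coloring_values [OF \<psi> rimG(2)]
      by (auto simp: glue_def region_G)
  qed (auto simp: glue_def)
  show "loc_const (region F) (glue \<psi>)"
    unfolding loc_const_def
  proof
    fix x assume x: "x \<in> region F"
    consider "x \<notin> tube h {0..1}" | "x \<in> tube h {0..<1/2}" | "x \<in> tube h {1/2<..1}" | "\<not> seamed" "x \<in> tube h {1/2}"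
      using region_F [OF x] by blast
    then show "\<exists>W. open W \<and> x \<in> W \<and> (\<forall>y\<in>W \<inter> region F. glue \<psi> y = glue \<psi> x)"
    proof cases
      case 1
      then have "x \<in> region G" using x by (simp add: region_G)
      then obtain W where W: "open W" "x \<in> W" "\<And>y. \<lbrakk>y \<in> W; y \<in> region G\<rbrakk> \<Longrightarrow> \<psi> y = \<psi> x"
        using coloring_nbhd [OF \<psi>] by metis
      have "glue \<psi> y = glue \<psi> x" if "y \<in> (W - tube h {0..1}) \<inter> region F" for y
      proof -
        have "y \<in> region G" using that by (simp add: region_G)
        then show ?thesis using W(3) that 1 x by (simp add: glue_simps)
      qed
      moreover have "open (W - tube h {0..1})" using W(1) by (intro open_Diff closed_tube) auto
      ultimately show ?thesis using W(2) 1 by (intro exI [of _ "W - tube h {0..1}"]) auto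
    next
      case 2
      then show ?thesis using glue_nbhd_tube [of "{0..<1/2}" 0 "{1/2..1}", OF _ \<psi>] glue_simps(1) [OF x] by simp
    next
      case 3
      then have "x \<in> tube h {1/2..1}" using tube_upper by blast
      then show ?thesis using 3 glue_nbhd_tube [of "{1/2<..1}" 1 "{0..1/2}", OF _ \<psi>] glue_simps(2) [OF x] by simp
    next
      case 4
      \<comment> \<open>On the middle circle of an unseamed tube both halves meet; equality of the
        rim colors makes the glued function constant on the open tube around it.\<close>
      have "{0<..<1::real} \<subseteq> {0..1}" by auto
      from open_tube [OF open_greaterThanLessThan this]
      obtain V where V: "open V" "tube h {0<..<1} = surf F \<inter> V" by blast
      have eq: "\<psi> (rim h 0) = \<psi> (rim h 1)" using match 4 by simp
      have val: "glue \<psi> y = \<psi> (rim h 1)" if "y \<in> region F" "y \<in> tube h {0<..<1}" for y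
      proof -
        have "{0<..<1} \<subseteq> {0..<1/2} \<union> {1/2..1::real}" by auto
        then have "tube h {0<..<1} \<subseteq> tube h {0..<1/2} \<union> tube h {1/2..1}" unfolding tube_Un [symmetric] by (rule tube_mono)
        then show ?thesis using that glue_simps(1,2) [of y \<psi>] eq by auto
      qed
      have xo: "x \<in> tube h {0<..<1}" using 4(2) tube_mono [of "{1/2}" "{0<..<1}" h] by auto
      have "glue \<psi> y = glue \<psi> x" if "y \<in> V \<inter> region F" for y
      proof -
        have "y \<in> tube h {0<..<1}" using that V(2) by (auto simp: region_def)
        then show ?thesis using val [OF x xo] val [of y] that by simp
      qed
      then show ?thesis using V xo by blast
    qed
  qed
  fix t assume t: "t \<in> seams F"
  show "germ_color (glue \<psi>) (fst (coor F t)) \<noteq> germ_color (glue \<psi>) (snd (coor F t))"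
  proof (cases "t \<in> seams G")
    case True
    have "germ_color \<psi> (fst (coor G t)) \<noteq> germ_color \<psi> (snd (coor G t))" using \<psi> True by (simp add: colorings_def)
    then show ?thesis unfolding G_simps(3) glue_germ [OF True] .
  next
    case False
    then have s: seamed "t = tube h {1/2}" using t seams_F(1) by (auto split: if_splits)
    have reg: "tube h {0..<1/2} \<subseteq> region F" "tube h {1/2<..1} \<subseteq> region F" by (rule tube_region; auto)+
    have sub: "tube h {1/2<..1} \<subseteq> tube h {1/2..1}" by (rule tube_mono) auto
    have "\<forall>\<^sub>F x in germ (tube h {1/2}) (tube h {0..<1/2}). glue \<psi> x = \<psi> (rim h 0)"
        "\<forall>\<^sub>F x in germ (tube h {1/2}) (tube h {1/2<..1}). glue \<psi> x = \<psi> (rim h 1)"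
      using glue_simps(1,2) reg sub unfolding eventually_germ by (intro exI [of _ UNIV]; blast)+
    then have "germ_color (glue \<psi>) (fst (coor F t)) = \<psi> (rim h 0)" "germ_color (glue \<psi>) (snd (coor F t)) = \<psi> (rim h 1)"
      using tame_seam(7,8) [OF tameF t] unfolding s(2) seamed_coor [OF s(1)] by (auto intro!: germ_color_eq)
    then show ?thesis using match s(1) by simp
  qed
qed

text \<open>A coloring of the cut surface extends over the tube exactly when its caps agree on an
  unseamed tube or differ on a seamed one.\<close>

lemma bij_betw_cut:
  "bij_betw cut (colorings F) {\<psi> \<in> colorings G. \<psi> (rim h 0) = \<psi> (rim h 1) \<longleftrightarrow> \<not> seamed}"
proof (rule bij_betw_byWitness [of _ glue])
  show "\<forall>\<phi>\<in>colorings F. glue (cut \<phi>) = \<phi>"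
  proof (intro ballI ext)
    fix \<phi> x assume \<phi>: "\<phi> \<in> colorings F"
    have rim: "cut \<phi> (rim h 0) = \<phi> (rim h 0)" "cut \<phi> (rim h 1) = \<phi> (rim h 1)" using cut_simps rim_region by auto
    show "glue (cut \<phi>) x = \<phi> x"
    proof (cases "x \<in> region F")
      case False
      then show ?thesis using \<phi> by (auto simp: glue_def colorings_def PiE_iff extensional_def)
    next
      case x: True
      consider "x \<notin> tube h {0..1}" | "x \<in> tube h {0..<1/2}" | "x \<in> tube h {1/2<..1}" | "\<not> seamed" "x \<in> tube h {1/2}"
        using region_F [OF x] by blast
      then show ?thesis
      proof cases
        case 1
        then show ?thesis using x outside_caps [of x] glue_simps(3) cut_simps(3) by (auto simp: region_def)
      next
        case 2
        then show ?thesis using glue_simps(1) [OF x 2] rim rim_color(1) [OF \<phi>] by simp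
      next
        case 3
        then have "x \<in> tube h {1/2..1}" using tube_upper by blast
        then show ?thesis using glue_simps(2) [OF x] rim rim_color(2) [OF \<phi> 3] by simp
      next
        case 4
        then have "x \<in> tube h {1/2..1}" "x \<in> tube h {0..1}"
          using tube_mono [of "{1/2}" "{1/2..1}" h] tube_mono [of "{1/2}" "{0..1}" h] by auto
        then show ?thesis using glue_simps(2) [OF x] rim rim_color(4) [OF \<phi> 4(1)] by simp
      qed
    qed
  qed
  show "\<forall>\<psi>\<in>{\<psi> \<in> colorings G. \<psi> (rim h 0) = \<psi> (rim h 1) \<longleftrightarrow> \<not> seamed}. cut (glue \<psi>) = \<psi>"
  proof (intro ballI ext)
    fix \<psi> x assume "\<psi> \<in> {\<psi> \<in> colorings G. \<psi> (rim h 0) = \<psi> (rim h 1) \<longleftrightarrow> \<not> seamed}"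
    then have \<psi>: "\<psi> \<in> colorings G" by simp
    have "rim h 0 \<in> tube h {0..<1/2}" "rim h 1 \<in> tube h {1/2..1}" by (rule rim_tube; simp)+
    then have rim: "glue \<psi> (rim h 0) = \<psi> (rim h 0)" "glue \<psi> (rim h 1) = \<psi> (rim h 1)"
      using glue_simps(1,2) rim_region(1,2) by auto
    show "cut (glue \<psi>) x = \<psi> x"
    proof (cases "x \<in> region G")
      case False
      then show ?thesis using \<psi> by (auto simp: cut_def colorings_def PiE_iff extensional_def)
    next
      case True
      then consider "x \<in> cap h 0" | "x \<in> cap h 1" | "x \<in> region F" "x \<notin> tube h {0..1}" "x \<notin> cap h 0" "x \<notin> cap h 1"
        unfolding region_G by blast
      then show ?thesis
        by cases (use rim cap_color [OF \<psi>] in \<open>simp_all add: cut_simps glue_simps\<close>)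
    qed
  qed
  show "cut ` colorings F \<subseteq> {\<psi> \<in> colorings G. \<psi> (rim h 0) = \<psi> (rim h 1) \<longleftrightarrow> \<not> seamed}"
    using cut_coloring rim_colors_match(1) cut_simps(1,2) rim_region(3,4) by auto
  show "glue ` {\<psi> \<in> colorings G. \<psi> (rim h 0) = \<psi> (rim h 1) \<longleftrightarrow> \<not> seamed} \<subseteq> colorings F"
    using glue_coloring by auto
qed

section \<open>Weights under cutting\<close>

lemma chi_cut:
  assumes \<phi>: "\<phi> \<in> colorings F"
  shows "chi {x \<in> region G. cut \<phi> x = 1} = chi {x \<in> region F. \<phi> x = 1} +
    (if \<phi> (rim h 0) = 1 then 1 else 0) + (if \<phi> (rim h 1) = 1 then 1 else 0)"
proof -
  define X Z Y where "X = {x \<in> region F. \<phi> x = 1}" and "Z = X \<inter> tube h {0..1}" and "Y = X - Z"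
  have lc: "loc_const (region F) \<phi>" using \<phi> by (simp add: colorings_def)
  have X: "has_chi X (chi X)" unfolding X_def by (rule has_chi_color_class [OF tameF lc])
  \<comment> \<open>The color 1 part of the tube is empty, the whole tube, or a union of half-open
    tubes, of characteristic 0 in each case. Hence only the caps change the count.\<close>
  have Z: "has_chi Z 0"
  proof (cases seamed)
    case False
    have "tube h {0..1} \<subseteq> region F" by (rule tube_region) (use False in auto)
    then have "Z = (if \<phi> (rim h 0) = 1 then tube h {0..1} else {})"
      using rim_color(3) [OF \<phi> False] by (auto simp: Z_def X_def)
    then show ?thesis using tube_polyset(1) [of 0 1] by simp
  next
    case True
    define P where "P J b = (if b then tube h J else {})" for J b
    have sub: "tube h {0..<1/2} \<subseteq> region F" "tube h {1/2<..1} \<subseteq> region F" by (rule tube_region; auto)+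
    have sub': "tube h {0..<1/2} \<subseteq> tube h {0..1}" "tube h {1/2<..1} \<subseteq> tube h {0..1}" by (rule tube_mono; auto)+
    have "Z = P {0..<1/2} (\<phi> (rim h 0) = 1) \<union> P {1/2<..1} (\<phi> (rim h 1) = 1)"
    proof (intro subset_antisym subsetI)
      fix x assume "x \<in> Z"
      then have x: "x \<in> region F" "\<phi> x = 1" "x \<in> tube h {0..1}" by (auto simp: Z_def X_def)
      then consider "x \<in> tube h {0..<1/2}" | "x \<in> tube h {1/2<..1}" using region_F True by blast
      then show "x \<in> P {0..<1/2} (\<phi> (rim h 0) = 1) \<union> P {1/2<..1} (\<phi> (rim h 1) = 1)"
        by cases (use x(2) rim_color(1,2) [OF \<phi>, of x] in \<open>auto simp: P_def\<close>)
    next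
      fix x assume "x \<in> P {0..<1/2} (\<phi> (rim h 0) = 1) \<union> P {1/2<..1} (\<phi> (rim h 1) = 1)"
      then show "x \<in> Z"
        using sub sub' rim_color(1,2) [OF \<phi>, of x] by (auto simp: P_def Z_def X_def split: if_splits)
    qed
    moreover have "tube h {0..<1/2} \<inter> tube h {1/2<..1} = {}" by (rule tube_disjoint) auto
    then have "P {0..<1/2} b \<inter> P {1/2<..1} b' = {}" for b b' by (simp add: P_def)
    moreover have "has_chi (P {0..<1/2} b) 0" "has_chi (P {1/2<..1} b) 0" for b
      using has_chi_half_tubes by (simp_all add: P_def)
    ultimately show ?thesis
      using has_chi_Un [of "P {0..<1/2} (\<phi> (rim h 0) = 1)" 0 "P {1/2<..1} (\<phi> (rim h 1) = 1)" 0] by simp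
  qed
  have Y: "has_chi Y (chi X)"
    using has_chi_Diff [OF X Z] by (simp add: Y_def Z_def)
  define C where "C t = (if \<phi> (rim h t) = 1 then cap h t else {})" for t
  have C: "has_chi (C t) (if \<phi> (rim h t) = 1 then 1 else 0)" if "t = 0 \<or> t = 1" for t
    using cap_facts(3) [of t] that by (auto simp: C_def)
  have dj: "Y \<inter> C 0 = {}" "(Y \<union> C 0) \<inter> C 1 = {}"
  proof -
    have "x \<notin> cap h 0 \<and> x \<notin> cap h 1" if "x \<in> Y" for x
      using that outside_caps [of x] by (auto simp: Y_def Z_def X_def region_def)
    then show "Y \<inter> C 0 = {}" "(Y \<union> C 0) \<inter> C 1 = {}" using caps_disjoint by (auto simp: C_def)
  qed
  have "{x \<in> region G. cut \<phi> x = 1} = Y \<union> C 0 \<union> C 1"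
  proof (intro subset_antisym subsetI)
    fix x assume "x \<in> {x \<in> region G. cut \<phi> x = 1}"
    then have x: "x \<in> region G" "cut \<phi> x = 1" by auto
    consider "x \<in> cap h 0" | "x \<in> cap h 1" | "x \<in> region F" "x \<notin> tube h {0..1}" "x \<notin> cap h 0" "x \<notin> cap h 1"
      using x(1) unfolding region_G by blast
    then show "x \<in> Y \<union> C 0 \<union> C 1"
      by cases (use x(2) in \<open>auto simp: cut_simps C_def Y_def Z_def X_def\<close>)
  next
    fix x assume x: "x \<in> Y \<union> C 0 \<union> C 1"
    then consider "x \<in> Y" | "x \<in> cap h 0" "\<phi> (rim h 0) = 1" | "x \<in> cap h 1" "\<phi> (rim h 1) = 1"
      by (auto simp: C_def split: if_splits)
    then show "x \<in> {x \<in> region G. cut \<phi> x = 1}"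
    proof cases
      case 1
      then have y: "x \<in> region F" "\<phi> x = 1" "x \<notin> tube h {0..1}" by (auto simp: Y_def Z_def X_def)
      then have "x \<notin> cap h 0" "x \<notin> cap h 1" using outside_caps [of x] by (auto simp: region_def)
      then show ?thesis using y cut_simps(3) [of x \<phi>] by (simp add: region_G)
    qed (auto simp: cut_simps region_G)
  qed
  moreover have "has_chi (Y \<union> C 0 \<union> C 1)
      (chi X + (if \<phi> (rim h 0) = 1 then 1 else 0) + (if \<phi> (rim h 1) = 1 then 1 else 0))"
    using Y C dj by (intro has_chi_Un) auto
  ultimately show ?thesis using chi_unique unfolding X_def by fastforce
qed

text \<open>The factor \<open>\<alpha>2 - \<alpha>1\<close> compensates the larger characteristic of
  the cut surface. On an unseamed tube of color 1 both caps join the class, so half the capped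
  characteristic rises by one. On a seamed tube exactly one cap has color 1, and it balances the
  lost seam in the capped characteristic; the sign then comes from counting the lost seam, of color
  1 precisely when the bottom rim is.\<close>

lemma weight_cut:
  assumes \<phi>: "\<phi> \<in> colorings F"
  shows "weight F \<phi> = (if \<phi> (rim h 0) = 1 then - 1 else 1) * (\<alpha>2 - \<alpha>1) * weight G (cut \<phi>)"
proof -
  have vals: "\<phi> (rim h t) = 1 \<or> \<phi> (rim h t) = 2" if "t = 0 \<or> t = 1" for t
    using coloring_values [OF \<phi>] rim_region(1,2) that by blast
  define Q where "Q = {t \<in> seams G. germ_color \<phi> (fst (coor F t)) = 1}"
  have fin: "finite (seams G)" "finite Q" using tame_finite(1) [OF tame_G] by (auto simp: Q_def)
  have countG: "seams_of_color_1 G (cut \<phi>) = int (card Q)"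
    unfolding seams_of_color_1_def Q_def G_simps(3)
    by (rule arg_cong [where f = "\<lambda>A. int (card A)"]) (auto simp: cut_germ)
  have countF: "seams_of_color_1 F \<phi> = int (card Q) + (if seamed \<and> \<phi> (rim h 0) = 1 then 1 else 0)"
  proof -
    have "{t \<in> seams F. germ_color \<phi> (fst (coor F t)) = 1} =
        (if seamed \<and> \<phi> (rim h 0) = 1 then insert (tube h {1/2}) Q else Q)"
      using seams_F(1) rim_colors_match(2) [OF \<phi>] by (auto simp: Q_def)
    moreover have "tube h {1/2} \<notin> Q" if seamed using seams_F(2) [OF that] by (simp add: Q_def)
    ultimately show ?thesis using fin unfolding seams_of_color_1_def by simp
  qed
  have card: "card (seams F) = card (seams G) + (if seamed then 1 else 0)"
    using seams_F fin(1) by simp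
  have capped: "capped_chi G (cut \<phi>) = capped_chi F \<phi> + (if \<not> seamed \<and> \<phi> (rim h 0) = 1 then 2 else 0)"
    unfolding capped_chi_def chi_cut [OF \<phi>] card
    using rim_colors_match(1) [OF \<phi>] vals [of 0] vals [of 1] by (cases seamed) auto
  have half: "(n + 2) div 2 = n div 2 + 1" for n :: int by simp
  have sign: "(- 1 :: coeff) powi (seams_of_color_1 F \<phi> + capped_chi F \<phi> div 2) =
      (if \<phi> (rim h 0) = 1 then - 1 else 1) * (- 1) powi (seams_of_color_1 G (cut \<phi>) + capped_chi G (cut \<phi>) div 2)"
    unfolding countF countG capped by (cases seamed; cases "\<phi> (rim h 0) = 1") (simp_all add: half minus_one_powi_add)
  have dots: "(\<Prod>p\<in>dots G. alpha (cut \<phi> p)) = (\<Prod>p\<in>dots F. alpha (\<phi> p))"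
    unfolding G_simps(4)
  proof (rule prod.cong [OF refl])
    fix p assume "p \<in> dots F"
    then have "p \<in> region F" "p \<notin> tube h {0..1}" "p \<notin> cap h 0" "p \<notin> cap h 1" using dots_G by auto
    then show "alpha (cut \<phi> p) = alpha (\<phi> p)" by (simp add: cut_simps)
  qed
  have "(\<alpha>2 - \<alpha>1) powi (chi (surf G) div 2) = (\<alpha>2 - \<alpha>1) powi (chi (surf F) div 2) * (\<alpha>2 - \<alpha>1)"
    unfolding chi_surf_G half using \<alpha>_distinct by (simp add: power_int_add)
  then show ?thesis unfolding weight_def sign dots using \<alpha>_distinct by simp
qed

text \<open>The coefficient vanishes on colorings that do not come from \<open>F\<close>, so the sum
  over cut colorings may be extended to all colorings of \<open>G\<close>.\<close>

lemma neck_sum: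
  assumes "\<And>\<psi>. \<psi> \<in> colorings G \<Longrightarrow> c \<psi> =
      (if \<psi> (rim h 0) = \<psi> (rim h 1) \<longleftrightarrow> \<not> seamed then (if \<psi> (rim h 0) = 1 then - 1 else 1) * (\<alpha>2 - \<alpha>1) else 0)"
  shows "evaluation F = (\<Sum>\<psi>\<in>colorings G. c \<psi> * weight G \<psi>)"
proof -
  let ?C = "{\<psi> \<in> colorings G. \<psi> (rim h 0) = \<psi> (rim h 1) \<longleftrightarrow> \<not> seamed}"
  have "evaluation F = (\<Sum>\<phi>\<in>colorings F. c (cut \<phi>) * weight G (cut \<phi>))"
    unfolding evaluation_eq_sum_weight [OF tameF]
  proof (rule sum.cong [OF refl])
    fix \<phi> assume \<phi>: "\<phi> \<in> colorings F"
    have rim: "cut \<phi> (rim h 0) = \<phi> (rim h 0)" "cut \<phi> (rim h 1) = \<phi> (rim h 1)" using cut_simps rim_region by auto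
    show "weight F \<phi> = c (cut \<phi>) * weight G (cut \<phi>)"
      unfolding assms [OF cut_coloring [OF \<phi>]] rim weight_cut [OF \<phi>] using rim_colors_match(1) [OF \<phi>] by simp
  qed
  also have "\<dots> = (\<Sum>\<psi>\<in>?C. c \<psi> * weight G \<psi>)" by (rule sum.reindex_bij_betw [OF bij_betw_cut])
  also have "\<dots> = (\<Sum>\<psi>\<in>colorings G. c \<psi> * weight G \<psi>)"
    using finite_colorings [OF tame_G] assms by (intro sum.mono_neutral_left) auto
  finally show ?thesis .
qed

text \<open>A dot on a cap contributes \<open>alpha\<close> of its rim color.
  \<open>alpha i + alpha j - E1\<close> is \<open>\<alpha>1 - \<alpha>2\<close> if both colors are
  1, its negative if both are 2, and 0 if they differ; \<open>alpha i - alpha j\<close> has these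
  first two values for the ordered pairs (1, 2) and (2, 1) and vanishes for equal colors. These are
  the signed factors of \<open>weight_cut\<close>.\<close>

lemma neck_relation:
  assumes p: "p \<in> cap h 0" and q: "q \<in> cap h 1"
  shows "\<not> seamed \<Longrightarrow> evaluation F = evaluation (add_dot q G) + evaluation (add_dot p G) - E1 * evaluation G"
    "seamed \<Longrightarrow> evaluation F = evaluation (add_dot p G) - evaluation (add_dot q G)"
proof -
  have pq: "p \<in> region G" "q \<in> region G" "p \<notin> dots G" "q \<notin> dots G"
    using p q dots_G(2) by (auto simp: region_G G_simps)
  have rimG: "rim h 0 \<in> region G" "rim h 1 \<in> region G" using rim_region by (auto simp: region_G)
  have ev: "evaluation (add_dot p G) = (\<Sum>\<psi>\<in>colorings G. alpha (\<psi> (rim h 0)) * weight G \<psi>)"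
      "evaluation (add_dot q G) = (\<Sum>\<psi>\<in>colorings G. alpha (\<psi> (rim h 1)) * weight G \<psi>)"
    unfolding evaluation_add_dot [OF tame_G pq(1,3)] evaluation_add_dot [OF tame_G pq(2,4)]
    by (rule sum.cong [OF refl], simp add: cap_color(1) [OF _ p])
      (rule sum.cong [OF refl], simp add: cap_color(2) [OF _ q])
  show "evaluation F = evaluation (add_dot q G) + evaluation (add_dot p G) - E1 * evaluation G" if "\<not> seamed"
  proof -
    have "evaluation F = (\<Sum>\<psi>\<in>colorings G. (alpha (\<psi> (rim h 1)) + alpha (\<psi> (rim h 0)) - E1) * weight G \<psi>)"
    proof (rule neck_sum)
      fix \<psi> assume \<psi>: "\<psi> \<in> colorings G"
      show "alpha (\<psi> (rim h 1)) + alpha (\<psi> (rim h 0)) - E1 =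
          (if \<psi> (rim h 0) = \<psi> (rim h 1) \<longleftrightarrow> \<not> seamed then (if \<psi> (rim h 0) = 1 then - 1 else 1) * (\<alpha>2 - \<alpha>1) else 0)"
        using coloring_values [OF \<psi> rimG(1)] coloring_values [OF \<psi> rimG(2)] that by (auto simp: alpha_def E1_def)
    qed
    then show ?thesis
      unfolding ev evaluation_eq_sum_weight [OF tame_G]
      by (simp add: sum_distrib_left left_diff_distrib distrib_right sum.distrib sum_subtractf)
  qed
  show "evaluation F = evaluation (add_dot p G) - evaluation (add_dot q G)" if seamed
  proof -
    have "evaluation F = (\<Sum>\<psi>\<in>colorings G. (alpha (\<psi> (rim h 0)) - alpha (\<psi> (rim h 1))) * weight G \<psi>)"
    proof (rule neck_sum)
      fix \<psi> assume \<psi>: "\<psi> \<in> colorings G"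
      show "alpha (\<psi> (rim h 0)) - alpha (\<psi> (rim h 1)) =
          (if \<psi> (rim h 0) = \<psi> (rim h 1) \<longleftrightarrow> \<not> seamed then (if \<psi> (rim h 0) = 1 then - 1 else 1) * (\<alpha>2 - \<alpha>1) else 0)"
        using coloring_values [OF \<psi> rimG(1)] coloring_values [OF \<psi> rimG(2)] that by (auto simp: alpha_def)
    qed
    then show ?thesis unfolding ev by (simp add: left_diff_distrib sum_subtractf)
  qed
qed

end

theorem lemma3p5:
  fixes F :: seamed_surface
  assumes "closed_seamed_surface F"
  shows
    "(\<forall>h p q. neck h F \<and> (\<forall>s\<in>seams F. s \<inter> h ` (bdD2 \<times> {0..1}) = {}) \<and>
        p \<in> h ` (D2 \<times> {0}) \<and> q \<in> h ` (D2 \<times> {1}) \<longrightarrow>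
        evaluation F =
          evaluation (add_dot q (cut_neck h F)) + evaluation (add_dot p (cut_neck h F))
          - E1 * evaluation (cut_neck h F)) \<and>
     (\<forall>h p q s. neck h F \<and> s = h ` (bdD2 \<times> {1/2}) \<and>
        {t \<in> seams F. t \<inter> h ` (bdD2 \<times> {0..1}) \<noteq> {}} = {s} \<and>
        coor F s = (germ s (h ` (bdD2 \<times> {0..<1/2})), germ s (h ` (bdD2 \<times> {1/2<..1}))) \<and>
        p \<in> h ` (D2 \<times> {0}) \<and> q \<in> h ` (D2 \<times> {1}) \<longrightarrow>
        evaluation F =
          evaluation (add_dot p (cut_neck h F)) - evaluation (add_dot q (cut_neck h F))) \<and>
     (\<forall>s p q. s \<in> seams F \<and> p \<in> facet_out F s - dots F \<and> q \<in> facet_into F s - dots F \<longrightarrow>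
        evaluation (add_dot p F) + evaluation (add_dot q F) = E1 * evaluation F) \<and>
     (\<forall>s p q. s \<in> seams F \<and> p \<in> facet_out F s - dots F \<and> q \<in> facet_into F s - dots F \<and> p \<noteq> q \<longrightarrow>
        evaluation (add_dot p (add_dot q F)) = E2 * evaluation F) \<and>
     (\<forall>f\<in>facets F. \<forall>p\<in>f - dots F. \<forall>q\<in>f - dots F. \<forall>r\<in>f - dots F. q \<noteq> r \<longrightarrow>
        evaluation (add_dot q (add_dot r F)) =
          E1 * evaluation (add_dot p F) - E2 * evaluation F) \<and>
     (\<forall>f\<in>facets F. \<forall>g. pl_embedding D2 g \<and> g ` D2 \<subseteq> f \<and> g ` D2 \<inter> dots F = {} \<longrightarrow>
        evaluation (add_seam_in g F) = - evaluation (add_seam_out g F) \<and>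
        - evaluation (add_seam_out g F) = - evaluation F) \<and>
     (pl_homeomorphic S2 (surf F) \<and> seams F = {} \<longrightarrow>
        (dots F = {} \<longrightarrow> evaluation F = 0) \<and>
        (card (dots F) = 1 \<longrightarrow> evaluation F = 1))"
proof -
  have tame: "tame F" using assms by (rule closed_seamed_surface_tame)
  have surf: "surface (surf F)"
    using assms by (intro closed_pl_surface_surface) (simp add: closed_seamed_surface_def)
  have neck_cutting: "evaluation F =
      evaluation (add_dot q (cut_neck h F)) + evaluation (add_dot p (cut_neck h F)) - E1 * evaluation (cut_neck h F)"
    if "neck h F" "\<forall>s\<in>seams F. s \<inter> h ` (bdD2 \<times> {0..1}) = {}" "p \<in> h ` (D2 \<times> {0})" "q \<in> h ` (D2 \<times> {1})" for h p q
    by (rule neck_relation(1) [OF tame surf that(1) refl, where seamed = False])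
      (use that in \<open>auto simp: tube_def cap_def\<close>)
  have seamed_neck_cutting: "evaluation F =
      evaluation (add_dot p (cut_neck h F)) - evaluation (add_dot q (cut_neck h F))"
    if "neck h F" "s = h ` (bdD2 \<times> {1/2})" "{t \<in> seams F. t \<inter> h ` (bdD2 \<times> {0..1}) \<noteq> {}} = {s}"
      "coor F s = (germ s (h ` (bdD2 \<times> {0..<1/2})), germ s (h ` (bdD2 \<times> {1/2<..1})))"
      "p \<in> h ` (D2 \<times> {0})" "q \<in> h ` (D2 \<times> {1})" for h p q s
    by (rule neck_relation(2) [OF tame surf that(1) refl, where seamed = True])
      (use that in \<open>simp_all add: tube_def cap_def\<close>)
  show ?thesis
  proof (intro conjI allI impI ballI, goal_cases)
    case (1 h p q)
    then show ?case by (elim conjE) (rule neck_cutting)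
  next
    case (2 h p q s)
    then show ?case by (elim conjE) (rule seamed_neck_cutting)
  next
    case (3 s p q)
    then show ?case by (elim conjE) (rule dot_migration [OF tame])
  next
    case (4 s p q)
    then show ?case by (elim conjE) (rule dots_across_seam [OF tame])
  next
    case (5 f p q r)
    then show ?case by (rule two_dots_on_facet [OF tame])
  next
    case (6 f g)
    then show ?case by (simp add: evaluation_add_seam [OF tame surf])
  next
    case (7 f g)
    then show ?case by (simp add: evaluation_add_seam [OF tame surf])
  next
    case 8
    then show ?case using evaluation_sphere_dots(1) [OF tame] by simp
  next
    case 9
    then show ?case using evaluation_sphere_dots(2) [OF tame] by simp
  qed
qed

end
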